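(* Let $m\ge1$ and let $\{a_{ij}\}_{i,j=1}^m,\{b_i\}_{i=1}^m,\{c_i\}_{i=1}^m$ be the coefficients of the $m$-stage Gauss–Legendre collocation Runge–Kutta method. Assume $\eta_F\ge\eta_0$ for all $F\in\mathcal F_h$, where $\eta_0$ is a sufficiently large constant independent of $h$; $\zeta_F\ge0.5$ for all $F\in\mathcal F_h^\partial$; and $\int_0^t\|\bm f(s)\|_{L^2(\Omega)}ds<\infty$ for all $t\in[0,T]$. In addition assume that one of the following holds: (a) $\bm\tau_h(\bm v)=\nabla_h\bm v$; (b) $\bm\tau_h(\bm v)=\nabla_h\bm v+(\nabla_h\bm v)^T$; (c) $\bm\tau_h(\bm v)=\nabla_h\bm v+(\nabla_h\bm v)^T-\frac23(\nabla_h\cdot\bm v)\mathbb I$, and $\|\bm v_h\|_{L^2(\Omega)}\le C'\|\bm v_h\|_{1,h}$ for all $\bm v_h\in\bm V_h$ with a constant $C'>0$ independent of $h$. Let $0=t_0<t_1<\dots<t_N=T$, $\tau_n=t_{n+1}-t_n$, and let $\bm u_h^n\in\bm V_h$ be generated by the fully discrete scheme: for $n\geq 0$, $$(\bm u_h^{n+1},\bm v_h)=(\bm u_h^n,\bm v_h)+\tau_n\sum_{i=1}^mb_i\{(\bm f^i,\bm v_h)-N_h(\bm U_h^i;\bm v_h)+b_h(\bm v_h,P_h^i)\}\quad\forall\bm v_h\in\bm V_h,$$ where $\bm f^i=\bm f(t_n+c_i\tau_n)$ and the stages $\bm U_h^i\in\bm V_h$, $P_h^i\in Q_h$, $1\le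 i\le m$, satisfy $$(\bm U_h^i,\bm v_h)=(\bm u_h^n,\bm v_h)+\tau_n\sum_{j=1}^ma_{ij}\{(\bm f^j,\bm v_h)-N_h(\bm U_h^j;\bm v_h)+b_h(\bm v_h,P_h^j)\}\quad\forall\bm v_h\in\bm V_h,\qquad b_h(\bm U_h^i,q_h)=0\quad\forall q_h\in Q_h.$$ Then there is a constant $C>0$ independent of $h$ such that $$\|\bm u_h^n\|_{L^2(\Omega)}^2\le\|\bm u_h^0\|_{L^2(\Omega)}^2+C\sum_{j=0}^{n-1}\tau_j\sum_{i=1}^mb_i\|\bm f(t_j+c_i\tau_j)\|_{L^2(\Omega)}^2\qquad\forall n\ge1.$$
   Context: Problem. The scheme discretizes the incompressible Navier–Stokes problem $\partial_t\bm u+\nabla\cdot(\bm u\otimes\bm u+p\mathbb I)-\nu\nabla\cdot\bm\tau(\bm u)=\bm f$, $\nabla\cdot\bm u=0$ in $(0,T]\times\Omega$, $\bm u=\bm0$ on $(0,T]\times\partial\Omega$, $\bm u(0,\cdot)=\bm u_0$, with constant $\nu>0$ and $\bm\tau$ the continuous counterpart of $\bm\tau_h$ (broken derivatives replaced by derivatives). Constants. "Independent of $h$" means not depending on the particular mesh in the shape-regular family. The constant $C$ in the conclusion does not depend on the mesh, the time steps, $n$, $\bm f$ or $\bm u_h^0$; it may depend on fixed data such as $\nu$, $\Omega$, the polynomial degree and shape regularity (and on $C'$ in case (c)). "Sufficiently large" $\eta_0$ means: large enough that, whenever all $\eta_F\ge\eta_0$, the form $a_h$ below satisfies $a_h(\bm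 v_h,\bm v_h)\ge C_0\|\bm v_h\|_{1,h}^2$ for all $\bm v_h\in\bm V_h$ with some $C_0>0$ independent of $h$ (such an $\eta_0$ exists). Gauss–Legendre collocation method. $c_1,\dots,c_m$ are the zeros of $\frac{d^m}{ds^m}\big(s^m(1-s)^m\big)$; with $\ell_j$ the Lagrange basis polynomials for the nodes $c_1,\dots,c_m$, $a_{ij}=\int_0^{c_i}\ell_j(s)\,ds$ and $b_i=\int_0^1\ell_i(s)\,ds$. (E.g. $m=1$: $a_{11}=c_1=\frac12$, $b_1=1$.) Mesh. $\Omega\subset\mathbb R^d$, $d\in\{2,3\}$, is a bounded Lipschitz domain and $\mathcal T_h$ is a conforming, shape-regular simplicial mesh of $\Omega$ (from a shape-regular family). $\mathcal F_h$ is the set of faces of $\mathcal T_h$, $\mathcal F_h^i$ the interior faces, $\mathcal F_h^\partial$ the boundary faces. $h_F$ is the diameter of $F$, and $h|_F=h_F$ is the face size function. Spaces. $\bm V_h$ is any linear subspace of $\{\bm v_h\in[L^2(\Omega)]^d:\bm v_h|_K\in[\mathcal P_r(K)]^d\ \forall K\in\mathcal T_h\}$ and $Q_h$ any linear subspace of $\{q_h\in L^2_0(\Omega):q_h|_K\in\mathcal P_k(K)\ \forall K\in\mathcal T_h\}$, where $\mathcal P_j(K)$ denotes polynomials of degree at most $j$ on $K$ and $L^2_0(\Omega)=\{q\in L^2(\Omega):\int_\Omega q=0\}$; no relation between $r$ and $k$ is required. Inner products and operators. $(\cdot,\cdot)$ is the $L^2(\Omega)$ inner product (scalar, vector, or matrix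 valued with Frobenius product); $\nabla_h$ is the broken (elementwise) gradient, $(\nabla\bm v)_{ij}=\partial_j v_i$, $\nabla_h\cdot$ the broken divergence, $\mathbb I$ the identity matrix, $(\bm a\otimes\bm b)_{ij}=a_ib_j$. $\langle\cdot,\cdot\rangle_\Sigma$ is the $L^2$ inner product on a $(d-1)$-dimensional set $\Sigma$, and $\langle\cdot,\cdot\rangle_{\partial\mathcal T_h}=\sum_{K}\langle\cdot,\cdot\rangle_{\partial K}$, $\langle\cdot,\cdot\rangle_{\partial\mathring{\mathcal T}_h}=\sum_K\langle\cdot,\cdot\rangle_{\partial K\setminus\partial\Omega}$, $\langle\cdot,\cdot\rangle_{\mathcal F_h}=\sum_{F\in\mathcal F_h}\langle\cdot,\cdot\rangle_F$. Jumps and averages. For $F\in\mathcal F_h^i$ a unit normal $\bm n_F$ is fixed, pointing from $K^+$ to $K^-$ (the two elements sharing $F$). On $F$: $[\![\bm v]\!]=\bm v|_{K^+}-\bm v|_{K^-}$, $[\![\bm v\otimes\bm n]\!]=\bm v|_{K^+}\otimes\bm n_F-\bm v|_{K^-}\otimes\bm n_F$, $\{\!\{\bm v\}\!\}=\frac12(\bm v|_{K^+}+\bm v|_{K^-})$, and similarly for scalars and matrices. For $F\in\mathcal F_h^\partial$ contained in $K$, $\bm n_F$ is the outward normal to $\partial\Omega$, $[\![\bm v]\!]=\{\!\{\bm v\}\!\}=\bm v|_K$, $[\![\bm v\otimes\bm n]\!]=\bm v|_K\otimes\bm n_F$. In face sums $\langle\cdot,\cdot\rangle_{\mathcal F_h}$,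 $\bm n|_F=\bm n_F$; in sums over $\partial K$ (i.e. $\langle\cdot,\cdot\rangle_{\partial\mathcal T_h}$, $\langle\cdot,\cdot\rangle_{\partial\mathring{\mathcal T}_h}$), a factor $\bm n$ appearing outside jump brackets is the outward unit normal of $K$. Norm. $\|\bm v_h\|_{1,h}=\big(\|\bm\tau_h(\bm v_h)\|_{L^2(\Omega)}^2+\langle\eta h^{-1}[\![\bm v_h]\!],[\![\bm v_h]\!]\rangle_{\mathcal F_h}\big)^{1/2}$. Forms. With piecewise constants $\eta=\{\eta_F\}$, $\zeta=\{\zeta_F\}$, $\eta_F,\zeta_F\ge0$, $$a_h(\bm v_h,\bm w_h)=(\bm\tau_h(\bm v_h),\nabla_h\bm w_h)-\langle(\{\!\{\bm\tau_h(\bm v_h)\}\!\}-\eta h^{-1}[\![\bm v_h\otimes\bm n]\!])\bm n,\bm w_h\rangle_{\partial\mathcal T_h}+\langle\{\!\{\bm v_h\}\!\}-\bm v_h,\bm\tau_h(\bm w_h)\bm n\rangle_{\partial\mathring{\mathcal T}_h}-\langle\bm v_h,\bm\tau_h(\bm w_h)\bm n\rangle_{\partial\Omega},$$ $$b_h(\bm v_h,q_h)=(\nabla_h\cdot\bm v_h,q_h)-\langle[\![\bm v_h]\!]\cdot\bm n,\{\!\{q_h\}\!\}\rangle_{\mathcal F_h},$$ $$\begin{aligned}c_h(\bm\beta_h;\bm v_h,\bm w_h)=&-(\bm v_h\otimes\bm\beta_h,\nabla_h\bm w_h)-\tfrac12((\nabla_h\cdot\bm\beta_h)\bm v_h,\bm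 w_h)+\langle(\zeta|\{\!\{\bm\beta_h\}\!\}\cdot\bm n|\,[\![\bm v_h\otimes\bm n]\!])\bm n,\bm w_h\rangle_{\partial\mathcal T_h}\\&+\langle(\{\!\{\bm v_h\}\!\}\otimes\{\!\{\bm\beta_h\}\!\})\bm n,\bm w_h\rangle_{\partial\mathcal T_h}+\tfrac12\langle\bm\beta_h,\bm n\{\!\{\bm v_h\cdot\bm w_h\}\!\}\rangle_{\partial\mathring{\mathcal T}_h},\end{aligned}$$ $$N_h(\bm u_h;\bm v_h)=c_h(\bm u_h;\bm u_h,\bm v_h)+\nu a_h(\bm u_h,\bm v_h)+d_h(\bm u_h,\bm v_h).$$ The penalty $d_h(\cdot,\cdot)$ is a form, linear in its second argument, that is positive semi-definite, $d_h(\bm v_h,\bm v_h)\ge0$ for all $\bm v_h\in\bm V_h$, and consistent, $d_h(\bm u,\bm v_h)=0$ for all $\bm v_h\in\bm V_h$ where $\bm u$ is the exact solution. It is understood that $\bm f(t)\in[L^2(\Omega)]^d$ is defined at the quadrature times $t_j+c_i\tau_j$. *)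

theory Defs
  imports "HOL-Analysis.Analysis" "HOL-Computational_Algebra.Polynomial"
begin

section \<open>Lebesgue spaces\<close>

text \<open>
  Functions stand for their almost-everywhere classes. All volume integrals use the completed
  Lebesgue measure, so the values of an integrand on a null set never matter, not even for
  measurability.
\<close>

definition L2 :: "(real^'d) set \<Rightarrow> (real^'d \<Rightarrow> 'b::euclidean_space) set" where
  "L2 \<Omega> = {f. set_borel_measurable lebesgue \<Omega> f \<and>
              set_integrable lebesgue \<Omega> (\<lambda>x. (norm (f x))\<^sup>2)}"

text \<open>On \<open>real^'d^'d\<close> the library's inner product is the Frobenius product.\<close>

definition L2_inner :: "(real^'d) set \<Rightarrow> (real^'d \<Rightarrow> 'b::euclidean_space) \<Rightarrow> (real^'d \<Rightarrow> 'b) \<Rightarrow> real"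
  where "L2_inner \<Omega> f g = (LINT x:\<Omega>|lebesgue. f x \<bullet> g x)"

definition L2_norm :: "(real^'d) set \<Rightarrow> (real^'d \<Rightarrow> 'b::euclidean_space) \<Rightarrow> real" where
  "L2_norm \<Omega> f = sqrt (L2_inner \<Omega> f f)"


section \<open>Domain and mesh\<close>

text \<open>
  Near each boundary point the domain is the strict epigraph of a Lipschitz function of the
  coordinates orthogonal to some direction \<open>e\<close>.
\<close>

definition lipschitz_domain :: "(real^'d) set \<Rightarrow> bool" where
  "lipschitz_domain \<Omega> \<longleftrightarrow> open \<Omega> \<and> connected \<Omega> \<and> \<Omega> \<noteq> {} \<and>
     (\<forall>x\<in>frontier \<Omega>. \<exists>e \<rho> \<phi> L. norm e = 1 \<and> 0 < \<rho> \<and> L-lipschitz_on {z. z \<bullet> e = 0} \<phi> \<and>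
        (\<forall>y\<in>ball x \<rho>. y \<in> \<Omega> \<longleftrightarrow> \<phi> (y - (y \<bullet> e) *\<^sub>R e) < y \<bullet> e))"

text \<open>\<^const>\<open>triangulation\<close> makes the mesh finite and conforming: any two elements meet in a common
  (possibly empty) face. Elements are closed simplices.\<close>

definition simplicial_mesh :: "(real^'d) set \<Rightarrow> (real^'d) set set \<Rightarrow> bool" where
  "simplicial_mesh \<Omega> \<T> \<longleftrightarrow>
     triangulation \<T> \<and> (\<forall>K\<in>\<T>. int CARD('d) simplex K) \<and> \<Union>\<T> = closure \<Omega>"

definition inball_diameter :: "(real^'d) set \<Rightarrow> real" where
  "inball_diameter K = Sup {2 * \<rho> | \<rho>. 0 \<le> \<rho> \<and> (\<exists>x. cball x \<rho> \<subseteq> K)}"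

definition shape_regular_family :: "('h \<Rightarrow> (real^'d) set set) \<Rightarrow> bool" where
  "shape_regular_family \<T> \<longleftrightarrow>
     (\<exists>\<sigma>>0. \<forall>h. \<forall>K\<in>\<T> h. diameter K \<le> \<sigma> * inball_diameter K)"

definition mesh_faces :: "(real^'d) set set \<Rightarrow> (real^'d) set set" where
  "mesh_faces \<T> = {F. \<exists>K\<in>\<T>. F facet_of K}"

definition boundary_faces :: "(real^'d) set \<Rightarrow> (real^'d) set set \<Rightarrow> (real^'d) set set" where
  "boundary_faces \<Omega> \<T> = {F \<in> mesh_faces \<T>. F \<subseteq> frontier \<Omega>}"

definition interior_faces :: "(real^'d) set \<Rightarrow> (real^'d) set set \<Rightarrow> (real^'d) set set" where
  "interior_faces \<Omega> \<T> = mesh_faces \<T> - boundary_faces \<Omega> \<T>"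

definition outward_normal :: "(real^'d) set \<Rightarrow> (real^'d) set \<Rightarrow> real^'d" where
  "outward_normal K F = (THE n. norm n = 1 \<and> (\<forall>x\<in>F. \<forall>y\<in>K. n \<bullet> (y - x) \<le> 0))"

text \<open>
  Fixing the unit normal of a face amounts to choosing which adjacent element is \<open>K\<^sup>+\<close>. This
  choice is a function \<open>Kp\<close> on faces; the face normal points out of \<open>Kp F\<close>, which on a boundary
  face makes it the outward normal of the domain.
\<close>

definition face_orientation :: "(real^'d) set set \<Rightarrow> ((real^'d) set \<Rightarrow> (real^'d) set) \<Rightarrow> bool" where
  "face_orientation \<T> Kp \<longleftrightarrow> (\<forall>F\<in>mesh_faces \<T>. Kp F \<in> \<T> \<and> F facet_of Kp F)"

definition face_normal :: "((real^'d) set \<Rightarrow> (real^'d) set) \<Rightarrow> (real^'d) set \<Rightarrow> real^'d" where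
  "face_normal Kp F = outward_normal (Kp F) F"

definition K_minus ::
  "(real^'d) set set \<Rightarrow> ((real^'d) set \<Rightarrow> (real^'d) set) \<Rightarrow> (real^'d) set \<Rightarrow> (real^'d) set" where
  "K_minus \<T> Kp F = (THE K. K \<in> \<T> \<and> F facet_of K \<and> K \<noteq> Kp F)"


section \<open>Integration over flat faces\<close>

text \<open>
  Integral with respect to the \<open>(d - 1)\<close>-dimensional Lebesgue measure on a subset \<open>F\<close> of full
  dimension of a hyperplane. By Fubini, the \<open>(d - 1)\<close>-dimensional measure of a subset of the
  hyperplane is the Lebesgue measure of the right prism of height one over it, so one integrates
  over the prism on \<open>F\<close> the extension of \<open>g\<close> that is constant in the normal direction. The result
  does not depend on which of the two unit normals is selected.
\<close>

definition face_integral :: "(real^'d) set \<Rightarrow> (real^'d \<Rightarrow> real) \<Rightarrow> real" where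
  "face_integral F g =
     (let n = (SOME n. norm n = 1 \<and> (\<forall>x\<in>F. \<forall>y\<in>F. n \<bullet> (y - x) = 0))
      in LINT x:{y + s *\<^sub>R n | y s. y \<in> F \<and> 0 \<le> s \<and> s \<le> 1}|lebesgue.
           g (closest_point (affine hull F) x))"

text \<open>In the sums over element boundaries the integrand may depend on the element and the face.\<close>

definition sum_element_boundaries ::
  "(real^'d) set set \<Rightarrow> ((real^'d) set \<Rightarrow> (real^'d) set \<Rightarrow> real^'d \<Rightarrow> real) \<Rightarrow> real" where
  "sum_element_boundaries \<T> g = (\<Sum>K\<in>\<T>. \<Sum>F\<in>{F. F facet_of K}. face_integral F (g K F))"

definition sum_interior_element_boundaries ::
  "(real^'d) set \<Rightarrow> (real^'d) set set \<Rightarrow>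
   ((real^'d) set \<Rightarrow> (real^'d) set \<Rightarrow> real^'d \<Rightarrow> real) \<Rightarrow> real" where
  "sum_interior_element_boundaries \<Omega> \<T> g =
     (\<Sum>K\<in>\<T>. \<Sum>F\<in>{F. F facet_of K} - boundary_faces \<Omega> \<T>. face_integral F (g K F))"

definition sum_faces ::
  "(real^'d) set set \<Rightarrow> ((real^'d) set \<Rightarrow> real^'d \<Rightarrow> real) \<Rightarrow> real" where
  "sum_faces \<T> g = (\<Sum>F\<in>mesh_faces \<T>. face_integral F (g F))"

definition sum_boundary_faces ::
  "(real^'d) set \<Rightarrow> (real^'d) set set \<Rightarrow> ((real^'d) set \<Rightarrow> real^'d \<Rightarrow> real) \<Rightarrow> real" where
  "sum_boundary_faces \<Omega> \<T> g = (\<Sum>F\<in>boundary_faces \<Omega> \<T>. face_integral F (g F))"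


section \<open>Differential operators\<close>

text \<open>
  These operators differentiate pointwise. For a function that is polynomial on the (open) interior
  of every element they therefore give the broken operators off the skeleton of the mesh, which is
  a null set; for a differentiable function they give the usual operators.
\<close>

definition gradient :: "(real^'d \<Rightarrow> real^'d) \<Rightarrow> real^'d \<Rightarrow> real^'d^'d" where
  "gradient v x = jacobian v (at x)"

definition divergence :: "(real^'d \<Rightarrow> real^'d) \<Rightarrow> real^'d \<Rightarrow> real" where
  "divergence v x = trace (gradient v x)"

definition row_divergence :: "(real^'d \<Rightarrow> real^'d^'d) \<Rightarrow> real^'d \<Rightarrow> real^'d" where
  "row_divergence A x = (\<chi> i. divergence (\<lambda>y. A y $ i) x)"

definition outer :: "real^'d \<Rightarrow> real^'d \<Rightarrow> real^'d^'d" (infixl \<open>\<otimes>\<^sub>v\<close> 70) where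
  "a \<otimes>\<^sub>v b = (\<chi> i j. a $ i * b $ j)"

definition sym_stress :: "(real^'d \<Rightarrow> real^'d) \<Rightarrow> real^'d \<Rightarrow> real^'d^'d" where
  "sym_stress v x = gradient v x + transpose (gradient v x)"

definition dev_stress :: "(real^'d \<Rightarrow> real^'d) \<Rightarrow> real^'d \<Rightarrow> real^'d^'d" where
  "dev_stress v x =
     gradient v x + transpose (gradient v x) - (2/3 * divergence v x) *\<^sub>R mat 1"


section \<open>Broken polynomial spaces\<close>

definition polys_upto :: "nat \<Rightarrow> (real^'d \<Rightarrow> real) set" where
  "polys_upto r = {p. \<exists>c :: ('d \<Rightarrow> nat) \<Rightarrow> real.
     p = (\<lambda>x. \<Sum>\<alpha> | (\<Sum>i\<in>UNIV. \<alpha> i) \<le> r. c \<alpha> * (\<Prod>i\<in>UNIV. x $ i ^ \<alpha> i))}"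

text \<open>The representatives are polynomial on the interior of each element; their values on the
  skeleton are arbitrary and enter no form below.\<close>

definition broken_vector_polys ::
  "(real^'d) set \<Rightarrow> (real^'d) set set \<Rightarrow> nat \<Rightarrow> (real^'d \<Rightarrow> real^'d) set" where
  "broken_vector_polys \<Omega> \<T> r =
     {v \<in> L2 \<Omega>. \<forall>K\<in>\<T>. \<forall>i. \<exists>p\<in>polys_upto r. \<forall>x\<in>interior K. v x $ i = p x}"

definition broken_mean_zero_polys ::
  "(real^'d) set \<Rightarrow> (real^'d) set set \<Rightarrow> nat \<Rightarrow> (real^'d \<Rightarrow> real) set" where
  "broken_mean_zero_polys \<Omega> \<T> k =
     {q \<in> L2 \<Omega>. (LINT x:\<Omega>|lebesgue. q x) = 0 \<and>
        (\<forall>K\<in>\<T>. \<exists>p\<in>polys_upto k. \<forall>x\<in>interior K. q x = p x)}"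

definition lin_subspace :: "('a \<Rightarrow> 'b::real_vector) set \<Rightarrow> bool" where
  "lin_subspace V \<longleftrightarrow> (\<lambda>x. 0) \<in> V \<and> (\<forall>v\<in>V. \<forall>w\<in>V. (\<lambda>x. v x + w x) \<in> V) \<and>
     (\<forall>c. \<forall>v\<in>V. (\<lambda>x. c *\<^sub>R v x) \<in> V)"

definition linear_form_on :: "('a \<Rightarrow> 'b::real_vector) set \<Rightarrow> (('a \<Rightarrow> 'b) \<Rightarrow> real) \<Rightarrow> bool" where
  "linear_form_on V l \<longleftrightarrow> (\<forall>v\<in>V. \<forall>w\<in>V. l (\<lambda>x. v x + w x) = l v + l w) \<and>
     (\<forall>c. \<forall>v\<in>V. l (\<lambda>x. c *\<^sub>R v x) = c * l v)"


section \<open>Traces, jumps and averages\<close>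

text \<open>\<open>face_trace K v x\<close> is the value at \<open>x\<close>, possibly on the boundary of \<open>K\<close>, of \<open>v\<close> restricted
  to \<open>K\<close>.\<close>

definition face_trace :: "(real^'d) set \<Rightarrow> (real^'d \<Rightarrow> 'b::t2_space) \<Rightarrow> real^'d \<Rightarrow> 'b" where
  "face_trace K v x = Lim (at x within interior K) v"

definition jump ::
  "(real^'d) set \<Rightarrow> (real^'d) set set \<Rightarrow> ((real^'d) set \<Rightarrow> (real^'d) set) \<Rightarrow>
   (real^'d) set \<Rightarrow> (real^'d \<Rightarrow> 'b::real_normed_vector) \<Rightarrow> real^'d \<Rightarrow> 'b" where
  "jump \<Omega> \<T> Kp F v x =
     (if F \<in> interior_faces \<Omega> \<T>
      then face_trace (Kp F) v x - face_trace (K_minus \<T> Kp F) v x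
      else face_trace (Kp F) v x)"

definition jump_normal ::
  "(real^'d) set \<Rightarrow> (real^'d) set set \<Rightarrow> ((real^'d) set \<Rightarrow> (real^'d) set) \<Rightarrow>
   (real^'d) set \<Rightarrow> (real^'d \<Rightarrow> real^'d) \<Rightarrow> real^'d \<Rightarrow> real^'d^'d" where
  "jump_normal \<Omega> \<T> Kp F v x =
     (if F \<in> interior_faces \<Omega> \<T>
      then face_trace (Kp F) v x \<otimes>\<^sub>v face_normal Kp F
           - face_trace (K_minus \<T> Kp F) v x \<otimes>\<^sub>v face_normal Kp F
      else face_trace (Kp F) v x \<otimes>\<^sub>v face_normal Kp F)"

definition average ::
  "(real^'d) set \<Rightarrow> (real^'d) set set \<Rightarrow> ((real^'d) set \<Rightarrow> (real^'d) set) \<Rightarrow>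
   (real^'d) set \<Rightarrow> (real^'d \<Rightarrow> 'b::real_normed_vector) \<Rightarrow> real^'d \<Rightarrow> 'b" where
  "average \<Omega> \<T> Kp F v x =
     (if F \<in> interior_faces \<Omega> \<T>
      then (1/2) *\<^sub>R (face_trace (Kp F) v x + face_trace (K_minus \<T> Kp F) v x)
      else face_trace (Kp F) v x)"


section \<open>Discrete norm and forms\<close>

definition norm_1h ::
  "(real^'d) set \<Rightarrow> (real^'d) set set \<Rightarrow> ((real^'d) set \<Rightarrow> (real^'d) set) \<Rightarrow>
   ((real^'d) set \<Rightarrow> real) \<Rightarrow> ((real^'d \<Rightarrow> real^'d) \<Rightarrow> real^'d \<Rightarrow> real^'d^'d) \<Rightarrow>
   (real^'d \<Rightarrow> real^'d) \<Rightarrow> real" where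
  "norm_1h \<Omega> \<T> Kp \<eta> \<tau> v =
     sqrt ((L2_norm \<Omega> (\<tau> v))\<^sup>2 +
       sum_faces \<T> (\<lambda>F x. ((\<eta> F / diameter F) *\<^sub>R jump \<Omega> \<T> Kp F v x) \<bullet> jump \<Omega> \<T> Kp F v x))"

definition a_h ::
  "(real^'d) set \<Rightarrow> (real^'d) set set \<Rightarrow> ((real^'d) set \<Rightarrow> (real^'d) set) \<Rightarrow>
   ((real^'d) set \<Rightarrow> real) \<Rightarrow> ((real^'d \<Rightarrow> real^'d) \<Rightarrow> real^'d \<Rightarrow> real^'d^'d) \<Rightarrow>
   (real^'d \<Rightarrow> real^'d) \<Rightarrow> (real^'d \<Rightarrow> real^'d) \<Rightarrow> real" where
  "a_h \<Omega> \<T> Kp \<eta> \<tau> v w =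
     L2_inner \<Omega> (\<tau> v) (gradient w)
     - sum_element_boundaries \<T> (\<lambda>K F x.
         ((average \<Omega> \<T> Kp F (\<tau> v) x - (\<eta> F / diameter F) *\<^sub>R jump_normal \<Omega> \<T> Kp F v x)
            *v outward_normal K F) \<bullet> face_trace K w x)
     + sum_interior_element_boundaries \<Omega> \<T> (\<lambda>K F x.
         (average \<Omega> \<T> Kp F v x - face_trace K v x)
            \<bullet> (face_trace K (\<tau> w) x *v outward_normal K F))
     - sum_boundary_faces \<Omega> \<T> (\<lambda>F x.
         face_trace (Kp F) v x \<bullet> (face_trace (Kp F) (\<tau> w) x *v face_normal Kp F))"

definition b_h ::
  "(real^'d) set \<Rightarrow> (real^'d) set set \<Rightarrow> ((real^'d) set \<Rightarrow> (real^'d) set) \<Rightarrow>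
   (real^'d \<Rightarrow> real^'d) \<Rightarrow> (real^'d \<Rightarrow> real) \<Rightarrow> real" where
  "b_h \<Omega> \<T> Kp v q =
     L2_inner \<Omega> (divergence v) q
     - sum_faces \<T> (\<lambda>F x. (jump \<Omega> \<T> Kp F v x \<bullet> face_normal Kp F) * average \<Omega> \<T> Kp F q x)"

definition c_h ::
  "(real^'d) set \<Rightarrow> (real^'d) set set \<Rightarrow> ((real^'d) set \<Rightarrow> (real^'d) set) \<Rightarrow>
   ((real^'d) set \<Rightarrow> real) \<Rightarrow>
   (real^'d \<Rightarrow> real^'d) \<Rightarrow> (real^'d \<Rightarrow> real^'d) \<Rightarrow> (real^'d \<Rightarrow> real^'d) \<Rightarrow> real" where
  "c_h \<Omega> \<T> Kp \<zeta> \<beta> v w =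
     - L2_inner \<Omega> (\<lambda>x. v x \<otimes>\<^sub>v \<beta> x) (gradient w)
     - 1/2 * L2_inner \<Omega> (\<lambda>x. divergence \<beta> x *\<^sub>R v x) w
     + sum_element_boundaries \<T> (\<lambda>K F x.
         (((\<zeta> F * \<bar>average \<Omega> \<T> Kp F \<beta> x \<bullet> outward_normal K F\<bar>) *\<^sub>R jump_normal \<Omega> \<T> Kp F v x)
            *v outward_normal K F) \<bullet> face_trace K w x)
     + sum_element_boundaries \<T> (\<lambda>K F x.
         ((average \<Omega> \<T> Kp F v x \<otimes>\<^sub>v average \<Omega> \<T> Kp F \<beta> x) *v outward_normal K F)
            \<bullet> face_trace K w x)
     + 1/2 * sum_interior_element_boundaries \<Omega> \<T> (\<lambda>K F x.
         face_trace K \<beta> x \<bullet> (average \<Omega> \<T> Kp F (\<lambda>y. v y \<bullet> w y) x *\<^sub>R outward_normal K F))"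

definition N_h ::
  "(real^'d) set \<Rightarrow> (real^'d) set set \<Rightarrow> ((real^'d) set \<Rightarrow> (real^'d) set) \<Rightarrow>
   ((real^'d) set \<Rightarrow> real) \<Rightarrow> ((real^'d) set \<Rightarrow> real) \<Rightarrow>
   ((real^'d \<Rightarrow> real^'d) \<Rightarrow> real^'d \<Rightarrow> real^'d^'d) \<Rightarrow> real \<Rightarrow>
   ((real^'d \<Rightarrow> real^'d) \<Rightarrow> (real^'d \<Rightarrow> real^'d) \<Rightarrow> real) \<Rightarrow>
   (real^'d \<Rightarrow> real^'d) \<Rightarrow> (real^'d \<Rightarrow> real^'d) \<Rightarrow> real" where
  "N_h \<Omega> \<T> Kp \<eta> \<zeta> \<tau> \<nu> d u v =
     c_h \<Omega> \<T> Kp \<zeta> u u v + \<nu> * a_h \<Omega> \<T> Kp \<eta> \<tau> u v + d u v"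

text \<open>
  The meaning of a ``sufficiently large'' penalty threshold for a family of meshes and spaces:
  coercivity, with one constant for the whole family, for all penalties above the threshold.
\<close>

definition sufficiently_large_penalty ::
  "(real^'d) set \<Rightarrow> ('h \<Rightarrow> (real^'d) set set) \<Rightarrow> ('h \<Rightarrow> (real^'d) set \<Rightarrow> (real^'d) set) \<Rightarrow>
   ((real^'d \<Rightarrow> real^'d) \<Rightarrow> real^'d \<Rightarrow> real^'d^'d) \<Rightarrow> ('h \<Rightarrow> (real^'d \<Rightarrow> real^'d) set) \<Rightarrow>
   real \<Rightarrow> bool" where
  "sufficiently_large_penalty \<Omega> \<T> Kp \<tau> V \<eta>\<^sub>0 \<longleftrightarrow> 0 < \<eta>\<^sub>0 \<and>
     (\<exists>C\<^sub>0>0. \<forall>h \<eta>. (\<forall>F\<in>mesh_faces (\<T> h). \<eta>\<^sub>0 \<le> \<eta> F) \<longrightarrow>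
        (\<forall>v\<in>V h. C\<^sub>0 * (norm_1h \<Omega> (\<T> h) (Kp h) \<eta> \<tau> v)\<^sup>2 \<le> a_h \<Omega> (\<T> h) (Kp h) \<eta> \<tau> v v))"


section \<open>Exact solution\<close>

text \<open>Classical solutions on \<open>(0, T] \<times> \<Omega>\<close>, continuous up to the initial time and the boundary.\<close>

definition navier_stokes_solution ::
  "(real^'d) set \<Rightarrow> real \<Rightarrow> real \<Rightarrow> ((real^'d \<Rightarrow> real^'d) \<Rightarrow> real^'d \<Rightarrow> real^'d^'d) \<Rightarrow>
   (real \<Rightarrow> real^'d \<Rightarrow> real^'d) \<Rightarrow> (real^'d \<Rightarrow> real^'d) \<Rightarrow>
   (real \<Rightarrow> real^'d \<Rightarrow> real^'d) \<Rightarrow> (real \<Rightarrow> real^'d \<Rightarrow> real) \<Rightarrow> bool" where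
  "navier_stokes_solution \<Omega> \<nu> T \<tau> f u\<^sub>0 u p \<longleftrightarrow>
     continuous_on ({0..T} \<times> closure \<Omega>) (\<lambda>(t, x). u t x) \<and>
     (\<forall>x\<in>\<Omega>. u 0 x = u\<^sub>0 x) \<and>
     (\<forall>t\<in>{0<..T}. \<forall>x\<in>frontier \<Omega>. u t x = 0) \<and>
     (\<forall>t\<in>{0<..T}. \<forall>x\<in>\<Omega>.
        (\<lambda>s. u s x) differentiable (at t within {0..T}) \<and>
        u t differentiable (at x) \<and> \<tau> (u t) differentiable (at x) \<and> p t differentiable (at x) \<and>
        divergence (u t) x = 0 \<and>
        vector_derivative (\<lambda>s. u s x) (at t within {0..T})
          + row_divergence (\<lambda>y. u t y \<otimes>\<^sub>v u t y + p t y *\<^sub>R mat 1) x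
          - \<nu> *\<^sub>R row_divergence (\<tau> (u t)) x = f t x)"


section \<open>Gauss--Legendre collocation\<close>

definition lagrange_basis :: "nat \<Rightarrow> (nat \<Rightarrow> real) \<Rightarrow> nat \<Rightarrow> real \<Rightarrow> real" where
  "lagrange_basis m c j s = (\<Prod>k\<in>{1..m} - {j}. (s - c k) / (c j - c k))"

text \<open>The polynomial is the \<open>m\<close>-th derivative of \<open>s\<^sup>m (1 - s)\<^sup>m\<close>.\<close>

definition gauss_legendre ::
  "nat \<Rightarrow> (nat \<Rightarrow> nat \<Rightarrow> real) \<Rightarrow> (nat \<Rightarrow> real) \<Rightarrow> (nat \<Rightarrow> real) \<Rightarrow> bool" where
  "gauss_legendre m a b c \<longleftrightarrow>
     bij_betw c {1..m} {s. poly ((pderiv ^^ m) ([:0, 1:] ^ m * [:1, -1:] ^ m)) s = 0} \<and>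
     (\<forall>i\<in>{1..m}. \<forall>j\<in>{1..m}. a i j = integral {0..c i} (lagrange_basis m c j)) \<and>
     (\<forall>i\<in>{1..m}. b i = integral {0..1} (lagrange_basis m c i))"


section \<open>Fully discrete scheme\<close>

text \<open>\<open>rk_slope\<close> is the functional in braces, common to the stage equations and the update; \<open>g\<close> is
  the value of the force at the stage time.\<close>

definition rk_slope ::
  "(real^'d) set \<Rightarrow> (real^'d) set set \<Rightarrow> ((real^'d) set \<Rightarrow> (real^'d) set) \<Rightarrow>
   ((real^'d) set \<Rightarrow> real) \<Rightarrow> ((real^'d) set \<Rightarrow> real) \<Rightarrow>
   ((real^'d \<Rightarrow> real^'d) \<Rightarrow> real^'d \<Rightarrow> real^'d^'d) \<Rightarrow> real \<Rightarrow>
   ((real^'d \<Rightarrow> real^'d) \<Rightarrow> (real^'d \<Rightarrow> real^'d) \<Rightarrow> real) \<Rightarrow>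
   (real^'d \<Rightarrow> real^'d) \<Rightarrow> (real^'d \<Rightarrow> real^'d) \<Rightarrow> (real^'d \<Rightarrow> real) \<Rightarrow>
   (real^'d \<Rightarrow> real^'d) \<Rightarrow> real" where
  "rk_slope \<Omega> \<T> Kp \<eta> \<zeta> \<tau> \<nu> d g U P v =
     L2_inner \<Omega> g v - N_h \<Omega> \<T> Kp \<eta> \<zeta> \<tau> \<nu> d U v + b_h \<Omega> \<T> Kp v P"

text \<open>\<open>U n i\<close> and \<open>P n i\<close> are the velocity and pressure of stage \<open>i\<close> in step \<open>n\<close>.\<close>

definition fully_discrete_solution ::
  "(real^'d) set \<Rightarrow> (real^'d) set set \<Rightarrow> ((real^'d) set \<Rightarrow> (real^'d) set) \<Rightarrow>
   ((real^'d) set \<Rightarrow> real) \<Rightarrow> ((real^'d) set \<Rightarrow> real) \<Rightarrow>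
   ((real^'d \<Rightarrow> real^'d) \<Rightarrow> real^'d \<Rightarrow> real^'d^'d) \<Rightarrow> real \<Rightarrow>
   ((real^'d \<Rightarrow> real^'d) \<Rightarrow> (real^'d \<Rightarrow> real^'d) \<Rightarrow> real) \<Rightarrow>
   (real^'d \<Rightarrow> real^'d) set \<Rightarrow> (real^'d \<Rightarrow> real) set \<Rightarrow>
   nat \<Rightarrow> (nat \<Rightarrow> nat \<Rightarrow> real) \<Rightarrow> (nat \<Rightarrow> real) \<Rightarrow> (nat \<Rightarrow> real) \<Rightarrow>
   (real \<Rightarrow> real^'d \<Rightarrow> real^'d) \<Rightarrow> nat \<Rightarrow> (nat \<Rightarrow> real) \<Rightarrow>
   (nat \<Rightarrow> real^'d \<Rightarrow> real^'d) \<Rightarrow> (nat \<Rightarrow> nat \<Rightarrow> real^'d \<Rightarrow> real^'d) \<Rightarrow>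
   (nat \<Rightarrow> nat \<Rightarrow> real^'d \<Rightarrow> real) \<Rightarrow> bool" where
  "fully_discrete_solution \<Omega> \<T> Kp \<eta> \<zeta> \<tau> \<nu> d V Q m a b c f N t u U P \<longleftrightarrow>
     (\<forall>n\<le>N. u n \<in> V) \<and>
     (\<forall>n<N. let \<tau>\<^sub>n = t (Suc n) - t n;
                slope = (\<lambda>i. rk_slope \<Omega> \<T> Kp \<eta> \<zeta> \<tau> \<nu> d (f (t n + c i * \<tau>\<^sub>n)) (U n i) (P n i))
       in (\<forall>i\<in>{1..m}. U n i \<in> V \<and> P n i \<in> Q \<and>
             (\<forall>v\<in>V. L2_inner \<Omega> (U n i) v =
                L2_inner \<Omega> (u n) v + \<tau>\<^sub>n * (\<Sum>j=1..m. a i j * slope j v)) \<and>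
             (\<forall>q\<in>Q. b_h \<Omega> \<T> Kp (U n i) q = 0)) \<and>
          (\<forall>v\<in>V. L2_inner \<Omega> (u (Suc n)) v =
             L2_inner \<Omega> (u n) v + \<tau>\<^sub>n * (\<Sum>i=1..m. b i * slope i v)))"

end

theory Submission
  imports Defs
begin

text \<open>
  Tested with the stages, the scheme yields the energy identity of the symplectic Gauss method: the
  squared norm grows in one step by \<open>2 \<tau>\<^sub>n \<Sum>\<^sub>i b\<^sub>i\<close> times the \<open>i\<close>-th slope at the \<open>i\<close>-th stage. There the
  pressure drops out, the convective form is nonnegative by the divergence theorem, and the viscous
  form is coercive, so the force is absorbed by a discrete Poincare inequality. Both the divergence
  theorem on a simplex and the discrete trace inequality come from one formula for the integral over
  the cone with a given vertex of a polynomial that is homogeneous about that vertex.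
\<close>

section \<open>Gauss--Legendre collocation\<close>

text \<open>Two obstacles shape the proof. The first is that a slope is only a functional of the
  test function, while the energy argument needs products of slopes. Inverting the coefficient
  matrix writes each slope as an inner product with an element of the space; the terms quadratic in
  the step size then cancel by b_i a_ij + b_j a_ji = b_i b_j, and the forms are only ever evaluated
  at a stage tested with itself. The second is uniformity over the mesh family. Instead of scaling
  to a reference simplex, the radial derivative of a polynomial of degree at most r is written
  through r + 1 values on the same ray, so the trace constant depends on r and d alone. Shape
  regularity is spent once, on comparing the diameter of a face with the height above it. The
  Lipschitz condition excludes slits, so that a face inside the frontier belongs to one element
  only. For the deviatoric stress the diagonal derivatives are out of reach (in dimension three it
  vanishes on multiples of the identity), and the bound of case (c) stands in for the Poincare
  inequality. The constant is D / (2 \<nu> C0), with D from the Poincare inequality and C0 from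
  coercivity.\<close>

definition antideriv :: "real poly \<Rightarrow> real poly" where
  "antideriv p = (\<Sum>i\<le>degree p. monom (coeff p i / real (Suc i)) (Suc i))"

lemma pderiv_antideriv [simp]: "pderiv (antideriv p) = p"
proof -
  have "pderiv (antideriv p) = (\<Sum>i\<le>degree p. monom (coeff p i) i)"
    unfolding antideriv_def using higher_pderiv_sum[of 1 "\<lambda>i. monom (coeff p i / real (Suc i)) (Suc i)" "{..degree p}"]
    by (simp add: pderiv_monom del: of_nat_Suc)
  then show ?thesis by (simp add: poly_as_sum_of_monoms)
qed

lemma poly_antideriv_0 [simp]: "poly (antideriv p) 0 = 0"
  by (simp add: antideriv_def poly_sum poly_monom)

lemma degree_antideriv: "degree (antideriv p) \<le> Suc (degree p)"
  unfolding antideriv_def by (intro degree_sum_le) (auto intro: order.trans[OF degree_monom_le])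

lemma has_integral_poly_pderiv:
  fixes q :: "real poly"
  assumes "x \<le> y"
  shows "(poly (pderiv q) has_integral (poly q y - poly q x)) {x..y}"
  using assms
  by (intro fundamental_theorem_of_calculus)
    (auto simp flip: has_real_derivative_iff_has_vector_derivative intro!: has_field_derivative_at_within poly_DERIV)

lemma integral_poly_antideriv: "0 \<le> x \<Longrightarrow> integral {0..x} (poly p) = poly (antideriv p) x"
  using has_integral_poly_pderiv[of 0 x "antideriv p"] by (simp add: integral_unique)

lemma poly_integrable [simp]: "poly (p :: real poly) integrable_on {x..y}"
  by (intro integrable_continuous_interval continuous_intros)

lemma integral_poly_add:
  fixes p q :: "real poly"
  shows "integral {x..y} (poly (p + q)) = integral {x..y} (poly p) + integral {x..y} (poly q)"
proof -
  have "poly (p + q) = (\<lambda>x. poly p x + poly q x)" by (simp add: fun_eq_iff)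
  then show ?thesis using integral_add[OF poly_integrable[of p x y] poly_integrable[of q x y]] by simp
qed

text \<open>A nonnegative continuous integrand with zero integral vanishes on all of [0,1], and a
  nonzero polynomial has only finitely many zeros.\<close>

lemma integral_poly_nonneg_eq_0:
  fixes p :: "real poly"
  assumes "\<And>x. x \<in> {0..1} \<Longrightarrow> 0 \<le> poly p x" and "integral {0..1} (poly p) = 0"
  shows "p = 0"
proof (rule ccontr)
  assume "p \<noteq> 0"
  have "(poly p has_integral 0) (cbox 0 1)"
    using assms(2) by (metis box_real(2) has_integral_integral poly_integrable)
  then have "poly p x = 0" if "x \<in> cbox 0 1" for x
    by (rule has_integral_0_cbox_imp_0[rotated 2]) (use assms(1) that in \<open>auto intro: continuous_intros simp: box_real\<close>)
  then have "{0..1} \<subseteq> {x. poly p x = 0}" by auto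
  then have "finite {0..1::real}" using poly_roots_finite[OF \<open>p \<noteq> 0\<close>] by (rule finite_subset)
  then show False using infinite_Icc[of "0::real" 1] by simp
qed

section \<open>Orthogonality of the Legendre polynomial\<close>

lemma power_dvd_pderiv:
  fixes p q :: "real poly"
  assumes "p ^ Suc n dvd q"
  shows "p ^ n dvd pderiv q"
proof -
  obtain r where "q = p ^ Suc n * r" using assms by (auto simp: dvd_def)
  then have "pderiv q = p ^ n * (p * pderiv r + smult (of_nat (Suc n)) (r * pderiv p))"
    by (simp only: pderiv_mult pderiv_power_Suc) (simp add: distrib_left mult_ac)
  then show ?thesis by simp
qed

lemma power_dvd_iterated_pderiv:
  fixes p q :: "real poly"
  assumes "p ^ m dvd q" "j \<le> m"
  shows "p ^ (m - j) dvd (pderiv ^^ j) q"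
  using assms(2)
proof (induction j)
  case 0 then show ?case using assms(1) by simp
next
  case (Suc j)
  then have "p ^ Suc (m - Suc j) dvd (pderiv ^^ j) q" by (simp add: Suc_diff_Suc)
  then show ?case by (simp add: power_dvd_pderiv)
qed

text \<open>Rodrigues' formula: up to the sign and the factor m! this is the shifted Legendre
  polynomial of [0,1].\<close>

definition legendre_poly :: "nat \<Rightarrow> real poly" where
  "legendre_poly m = (pderiv ^^ m) ([:0, 1:] ^ m * [:1, -1:] ^ m)"

lemma degree_legendre_poly: "degree (legendre_poly m) \<le> m"
proof -
  have "degree ([:0, 1:] ^ m * [:1, -1:] ^ m :: real poly) \<le> degree ([:0,1:] ^ m :: real poly) + degree ([:1,-1:] ^ m :: real poly)"
    by (rule degree_mult_le)
  also have "\<dots> \<le> m + m" by (intro add_mono order.trans[OF degree_power_le]) auto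
  finally show ?thesis unfolding legendre_poly_def degree_higher_pderiv by simp
qed

text \<open>Integration by parts. The boundary terms vanish because s^m (1 - s)^m has zeros of order
  \<open>m\<close> at both ends, so its derivatives of order below \<open>m\<close> still vanish
  there.\<close>

lemma legendre_poly_orthogonal:
  assumes "degree g < m"
  shows "integral {0..1} (poly (legendre_poly m * g)) = 0"
proof -
  let ?W = "[:0, 1:] ^ m * [:1, -1:] ^ m :: real poly"
  have van: "poly ((pderiv ^^ j) ?W) 0 = 0" "poly ((pderiv ^^ j) ?W) 1 = 0" if "j < m" for j
  proof -
    have "[:0, 1:] ^ (m - j) dvd (pderiv ^^ j) ?W" "[:1, -1:] ^ (m - j) dvd (pderiv ^^ j) ?W"
      using that by (intro power_dvd_iterated_pderiv; simp)+
    then have "[:0, 1:] dvd (pderiv ^^ j) ?W" "[:1, -1:] dvd (pderiv ^^ j) ?W"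
      using that by (meson dvd_power dvd_trans zero_less_diff)+
    then obtain p q where pq: "(pderiv ^^ j) ?W = [:0, 1:] * p" "(pderiv ^^ j) ?W = [:1, -1:] * q"
      by (auto simp only: dvd_def)
    show "poly ((pderiv ^^ j) ?W) 0 = 0" unfolding pq(1) by simp
    show "poly ((pderiv ^^ j) ?W) 1 = 0" unfolding pq(2) by simp
  qed
  \<comment> \<open>Generalised over the number \<open>j\<close> of derivatives, since each
    integration by parts lowers both \<open>j\<close> and the degree of \<open>g\<close>.\<close>
  have "integral {0..1} (poly ((pderiv ^^ j) ?W * g)) = 0" if "j \<le> m" "degree g < j" for j g
    using that
  proof (induction j arbitrary: g)
    case 0 then show ?case by simp
  next
    case (Suc j)
    have "pderiv ((pderiv ^^ j) ?W * g) = (pderiv ^^ Suc j) ?W * g + (pderiv ^^ j) ?W * pderiv g"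
      by (simp add: pderiv_mult mult.commute)
    then have "integral {0..1} (poly ((pderiv ^^ Suc j) ?W * g + (pderiv ^^ j) ?W * pderiv g)) = 0"
      using has_integral_poly_pderiv[of 0 1 "(pderiv ^^ j) ?W * g"] van[of j] Suc.prems
      by (simp add: integral_unique)
    moreover have "integral {0..1} (poly ((pderiv ^^ j) ?W * pderiv g)) = 0"
    \<comment> \<open>A zero derivative is a case of its own: its degree is \<open>0\<close>, so the
      degree bound of the induction hypothesis would fail at \<open>j = 0\<close>.\<close>
    proof (cases "pderiv g = 0")
      case False
      then have "degree (pderiv g) < j" using Suc.prems by (auto simp: degree_pderiv pderiv_eq_0_iff)
      then show ?thesis using Suc.prems by (intro Suc.IH) auto
    qed (simp add: poly_0[abs_def])
    ultimately show ?case
      by (simp add: integral_poly_add del: poly_mult)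
  qed
  from this[of m g] assms show ?thesis by (simp add: legendre_poly_def)
qed

section \<open>Lagrange interpolation as an identity of polynomials\<close>

definition lagrange_poly :: "nat \<Rightarrow> (nat \<Rightarrow> real) \<Rightarrow> nat \<Rightarrow> real poly" where
  "lagrange_poly m c j = (\<Prod>k\<in>{1..m} - {j}. smult (1 / (c j - c k)) [:- c k, 1:])"

lemma poly_lagrange_poly: "poly (lagrange_poly m c j) = lagrange_basis m c j"
  by (rule ext) (simp add: lagrange_poly_def lagrange_basis_def poly_prod diff_divide_distrib)

lemma degree_lagrange_poly: "j \<in> {1..m} \<Longrightarrow> degree (lagrange_poly m c j) < m"
proof -
  assume j: "j \<in> {1..m}"
  have "degree (lagrange_poly m c j) \<le> (\<Sum>k\<in>{1..m} - {j}. degree (smult (1 / (c j - c k)) [:- c k, 1:]))"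
    unfolding lagrange_poly_def by (rule order.trans[OF degree_prod_sum_le]) auto
  also have "\<dots> \<le> (\<Sum>k\<in>{1..m} - {j}. 1)" by (intro sum_mono) (auto intro: order.trans[OF degree_smult_le])
  also have "\<dots> < m" using j by (simp add: card_Diff_subset)
  finally show ?thesis .
qed

lemma lagrange_poly_node:
  assumes "inj_on c {1..m}" "i \<in> {1..m}" "j \<in> {1..m}"
  shows "poly (lagrange_poly m c j) (c i) = (if i = j then 1 else 0)"
proof (cases "i = j")
  case True
  have "c j - c k \<noteq> 0" if "k \<in> {1..m} - {j}" for k using assms that by (auto dest: inj_onD)
  then show ?thesis using True by (simp add: lagrange_poly_def poly_prod diff_divide_distrib[symmetric])
next
  case False
  then show ?thesis using assms(2) by (auto simp: lagrange_poly_def poly_prod intro!: prod_zero bexI[of _ i])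
qed

lemma lagrange_interpolation:
  fixes p :: "real poly"
  assumes "inj_on c {1..m}" "degree p < m"
  shows "p = (\<Sum>j=1..m. smult (poly p (c j)) (lagrange_poly m c j))" (is "_ = ?q")
proof (rule poly_eqI_degree[of "c ` {1..m}"])
  show "degree ?q < card (c ` {1..m})"
    using assms degree_lagrange_poly
    by (auto simp: card_image intro!: degree_sum_less le_less_trans[OF degree_smult_le])
  fix x assume "x \<in> c ` {1..m}"
  then obtain i where i: "i \<in> {1..m}" "x = c i" by auto
  have "poly ?q x = (\<Sum>j=1..m. poly p (c j) * (if i = j then 1 else 0))"
    unfolding i poly_sum poly_smult using assms(1) i by (intro sum.cong refl) (simp add: lagrange_poly_node)
  also have "\<dots> = poly p x" using i by (simp add: if_distrib cong: if_cong)
  finally show "poly p x = poly ?q x" by simp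
qed (use assms in \<open>simp_all add: card_image\<close>)

section \<open>Nodes, weights and coefficients of the Gauss method\<close>

locale gauss =
  fixes m a b c
  assumes gl: "gauss_legendre m a b c" and m: "1 \<le> m"
begin

abbreviation "I \<equiv> {1..m}"

lemma nodes: "bij_betw c I {s. poly (legendre_poly m) s = 0}"
  using gl by (simp add: gauss_legendre_def legendre_poly_def)

lemma inj_c: "inj_on c I" using nodes by (rule bij_betw_imp_inj_on)

lemma legendre_poly_node: "i \<in> I \<Longrightarrow> poly (legendre_poly m) (c i) = 0"
  using bij_betw_apply[OF nodes] by simp

text \<open>The bijection in \<open>gauss_legendre\<close> already fixes the number of distinct real
  roots as \<open>m\<close>. That the polynomial is nonzero and, next, of degree exactly
  \<open>m\<close> is read off from this count and not from a leading coefficient.\<close>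

lemma legendre_poly_nonzero: "legendre_poly m \<noteq> 0"
proof
  assume "legendre_poly m = 0"
  then have "finite (UNIV :: real set)" using bij_betw_finite[OF nodes] by simp
  then show False using infinite_UNIV_char_0 by blast
qed

lemma degree_legendre: "degree (legendre_poly m) = m"
proof -
  have "m = card {s. poly (legendre_poly m) s = 0}" using bij_betw_same_card[OF nodes] by simp
  also have "\<dots> \<le> degree (legendre_poly m)" by (rule card_poly_roots_bound[OF legendre_poly_nonzero])
  finally show ?thesis using degree_legendre_poly[of m] by simp
qed

text \<open>With \<open>g\<close> the quotient of the Legendre polynomial by \<open>s - c\<^sub>i\<close>, orthogonality says that \<open>c\<^sub>i\<close> is
  the mean of \<open>s\<close> with respect to the density \<open>g\<^sup>2\<close>.\<close>

lemma node_range: assumes "i \<in> I" shows "0 < c i" "c i < 1"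
proof -
  let ?P = "legendre_poly m"
  obtain g where g: "?P = [:- c i, 1:] * g"
    using legendre_poly_node[OF assms] by (metis dvd_def poly_eq_0_iff_dvd)
  have g0: "g \<noteq> 0" using legendre_poly_nonzero g by auto
  have "degree ?P = 1 + degree g" using g0 unfolding g by (subst degree_mult_eq) auto
  then have "degree g < m" using degree_legendre by simp
  then have int: "integral {0..1} (poly (?P * g)) = 0" by (rule legendre_poly_orthogonal)
  have P: "poly (?P * g) x = (x - c i) * (poly g x)\<^sup>2" for x unfolding g by (simp add: power2_eq_square algebra_simps)
  have nz: "?P * g \<noteq> 0" "- (?P * g) \<noteq> 0" using g0 legendre_poly_nonzero by auto
  show "0 < c i"
  proof (rule ccontr)
    assume "\<not> 0 < c i"
    then have "0 \<le> poly (?P * g) x" if "x \<in> {0..1}" for x unfolding P using that by auto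
    then show False using integral_poly_nonneg_eq_0[OF _ int] nz by blast
  qed
  show "c i < 1"
  proof (rule ccontr)
    assume "\<not> c i < 1"
    then have "0 \<le> poly (- (?P * g)) x" if "x \<in> {0..1}" for x
      using that unfolding poly_minus P by (auto simp: mult_nonpos_nonneg)
    moreover have "integral {0..1} (poly (- (?P * g))) = 0"
      using int unfolding poly_minus by (simp only: integral_neg)
    ultimately show False using integral_poly_nonneg_eq_0 nz by blast
  qed
qed

text \<open>\<open>node_range\<close> is needed here: the integral over \<open>{0..c i}\<close> is a
  value of the antiderivative only when \<open>c i\<close> is nonnegative.\<close>

lemma a_eq: "i \<in> I \<Longrightarrow> j \<in> I \<Longrightarrow> a i j = poly (antideriv (lagrange_poly m c j)) (c i)"
  using gl node_range[of i]
  by (simp add: gauss_legendre_def integral_poly_antideriv flip: poly_lagrange_poly)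

lemma b_eq: "i \<in> I \<Longrightarrow> b i = poly (antideriv (lagrange_poly m c i)) 1"
  using gl by (simp add: gauss_legendre_def integral_poly_antideriv flip: poly_lagrange_poly)

lemma quadrature_low:
  assumes "degree p < m"
  shows "integral {0..1} (poly p) = (\<Sum>j=1..m. b j * poly p (c j))"
proof -
  have "poly p = (\<lambda>x. \<Sum>j=1..m. poly p (c j) * poly (lagrange_poly m c j) x)"
    by (subst lagrange_interpolation[OF inj_c assms]) (simp add: poly_sum fun_eq_iff)
  then have "integral {0..1} (poly p) = integral {0..1} (\<lambda>x. \<Sum>j=1..m. poly p (c j) * poly (lagrange_poly m c j) x)"
    by simp
  also have "\<dots> = (\<Sum>j=1..m. integral {0..1} (\<lambda>x. poly p (c j) * poly (lagrange_poly m c j) x))"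
    by (intro integral_sum integrable_continuous_interval continuous_intros) auto
  also have "\<dots> = (\<Sum>j=1..m. b j * poly p (c j))"
    by (intro sum.cong refl) (simp add: integral_poly_antideriv b_eq)
  finally show ?thesis .
qed

text \<open>Divide by the Legendre polynomial. The multiple of it integrates to zero by
  orthogonality and vanishes at the nodes, so only the remainder, of degree below \<open>m\<close>,
  counts on either side.\<close>

lemma quadrature:
  assumes "degree p < 2 * m"
  shows "integral {0..1} (poly p) = (\<Sum>j=1..m. b j * poly p (c j))"
proof -
  let ?P = "legendre_poly m"
  define s t where "s = p div ?P" and "t = p mod ?P"
  have p: "p = ?P * s + t" unfolding s_def t_def by simp
  have t: "degree t < m"
    unfolding t_def using degree_mod_less'[of ?P p] legendre_poly_nonzero degree_legendre m
    by (cases "p mod ?P = 0") auto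
  have s: "degree s < m"
  proof (cases "s = 0")
    case False
    show ?thesis
    proof (rule ccontr)
      assume "\<not> degree s < m"
      then have "degree (?P * s) \<ge> 2 * m"
        using False legendre_poly_nonzero degree_legendre by (simp add: degree_mult_eq)
      then show False using p t assms degree_add_eq_left[of t "?P * s"] m by simp
    qed
  qed (use m in simp)
  have "integral {0..1} (poly p) = integral {0..1} (poly (?P * s)) + integral {0..1} (poly t)"
    unfolding p by (rule integral_poly_add)
  also have "\<dots> = (\<Sum>j=1..m. b j * poly t (c j))"
    using legendre_poly_orthogonal[OF s] quadrature_low[OF t] by simp
  also have "\<dots> = (\<Sum>j=1..m. b j * poly p (c j))"
    by (intro sum.cong refl) (simp add: p legendre_poly_node)
  finally show ?thesis .
qed

lemma sum_delta: "i \<in> I \<Longrightarrow> (\<Sum>j=1..m. f j * poly (lagrange_poly m c i) (c j)) = f i"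
  using inj_c by (simp add: lagrange_poly_node if_distrib cong: if_cong)

text \<open>The square of a Lagrange polynomial has degree at most 2m - 2, so the quadrature is
  exact for it and returns \<open>b i\<close>, which is therefore a positive integral.\<close>

lemma b_pos: assumes "i \<in> I" shows "0 < b i"
proof -
  let ?l = "lagrange_poly m c i"
  have "degree (?l * ?l) < 2 * m"
    using degree_lagrange_poly[OF assms, of c] degree_mult_le[of ?l ?l] by simp
  then have "integral {0..1} (poly (?l * ?l)) = (\<Sum>j=1..m. b j * poly ?l (c j) * poly ?l (c j))"
    by (simp add: quadrature mult.assoc)
  also have "\<dots> = b i" by (subst sum_delta[OF assms]) (use assms inj_c in \<open>simp add: lagrange_poly_node\<close>)
  finally have "b i = integral {0..1} (poly (?l * ?l))" by simp
  moreover have "?l \<noteq> 0" using lagrange_poly_node[OF inj_c assms assms] by auto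
  then have "integral {0..1} (poly (?l * ?l)) \<noteq> 0"
    using integral_poly_nonneg_eq_0[of "?l * ?l"] by auto
  moreover have "0 \<le> integral {0..1} (poly (?l * ?l))"
    by (intro integral_nonneg poly_integrable) auto
  ultimately show ?thesis by simp
qed

text \<open>Let q_i be the antiderivative of the i-th Lagrange polynomial, so that q_i(c_j) = a_ji
  and q_i(1) = b_i. The derivative of q_i q_j has degree at most 2m - 1, and the quadrature gives
  its integral q_i(1) q_j(1) exactly.\<close>

lemma symplectic:
  assumes "i \<in> I" "j \<in> I"
  shows "b i * a i j + b j * a j i = b i * b j"
proof -
  let ?l = "lagrange_poly m c" and ?q = "\<lambda>i. antideriv (lagrange_poly m c i)"
  have "degree (?l i * ?q j + ?q i * ?l j) < 2 * m"
    using degree_lagrange_poly[OF assms(1), of c] degree_lagrange_poly[OF assms(2), of c]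
      degree_mult_le[of "?l i" "?q j"] degree_mult_le[of "?q i" "?l j"]
      degree_antideriv[of "?l i"] degree_antideriv[of "?l j"]
    by (intro degree_add_less) auto
  from quadrature[OF this]
  have "integral {0..1} (poly (?l i * ?q j + ?q i * ?l j))
      = (\<Sum>k=1..m. b k * poly (?q j) (c k) * poly (?l i) (c k)) + (\<Sum>k=1..m. b k * poly (?q i) (c k) * poly (?l j) (c k))"
    by (simp add: algebra_simps sum.distrib)
  also have "\<dots> = b i * a i j + b j * a j i" using assms by (simp only: sum_delta a_eq)
  also have "?l i * ?q j + ?q i * ?l j = pderiv (?q i * ?q j)" by (simp add: pderiv_mult algebra_simps)
  also have "integral {0..1} (poly (pderiv (?q i * ?q j))) = b i * b j"
    using has_integral_poly_pderiv[of 0 1 "?q i * ?q j"] assms by (simp add: integral_unique b_eq)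
  finally show ?thesis by simp
qed

text \<open>The inverse of the coefficient matrix differentiates, at the nodes, the polynomial of degree
  \<open>m\<close> that vanishes at \<open>0\<close> and takes given values at the nodes.\<close>

lemma coefficient_inverse:
  obtains e where "\<forall>i\<in>I. \<forall>j\<in>I. (\<Sum>k=1..m. e i k * a k j) = (if i = j then 1 else 0)"
proof -
  \<comment> \<open>The node \<open>0\<close> is appended at index \<open>Suc m\<close>; by
    \<open>node_range\<close> it differs from all the others.\<close>
  define c' where "c' k = (if k \<le> m then c k else 0)" for k
  let ?L = "lagrange_poly (Suc m) c'"
  have inj: "inj_on c' {1..Suc m}"
  proof (rule inj_onI)
    fix x y assume "x \<in> {1..Suc m}" "y \<in> {1..Suc m}" "c' x = c' y"
    then show "x = y" using node_range(1)[of x] node_range(1)[of y] inj_onD[OF inj_c, of x y]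
      unfolding c'_def by (auto split: if_splits simp: le_Suc_eq)
  qed
  show ?thesis
  proof (rule that, intro ballI)
    fix i j assume ij: "i \<in> I" "j \<in> I"
    let ?q = "antideriv (lagrange_poly m c j)"
    have "degree ?q < Suc m" using degree_antideriv[of "lagrange_poly m c j"] degree_lagrange_poly[OF ij(2), of c] by simp
    \<comment> \<open>The antiderivative vanishes at the appended node, so that node contributes no
      term and the sum ends at \<open>m\<close>.\<close>
    from lagrange_interpolation[OF inj this]
    have "?q = (\<Sum>k=1..m. smult (a k j) (?L k))"
      using ij by (simp add: c'_def a_eq)
    then have "pderiv ?q = (\<Sum>k=1..m. smult (a k j) (pderiv (?L k)))"
      using higher_pderiv_sum[of 1 "\<lambda>k. smult (a k j) (?L k)" I] by (simp add: pderiv_smult)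
    then have "poly (lagrange_poly m c j) (c i) = (\<Sum>k=1..m. poly (pderiv (?L k)) (c i) * a k j)"
      by (simp add: poly_sum mult.commute)
    then show "(\<Sum>k=1..m. poly (pderiv (?L k)) (c i) * a k j) = (if i = j then 1 else 0)"
      using ij inj_c by (simp add: lagrange_poly_node)
  qed
qed

end

section \<open>Change of variables\<close>

subsection \<open>Renaming coordinates\<close>

text \<open>The library proves the change of variables theorem only for vectors with a well-ordered index
  type. Every finite index type has a well-ordered copy.\<close>

typedef 'a wo = "UNIV :: 'a set" by simp

definition wo_index :: "'a::finite \<Rightarrow> nat" where
  "wo_index = (SOME f. inj f)"

lemma inj_wo_index: "inj (wo_index :: 'a::finite \<Rightarrow> nat)"
proof -
  have "\<exists>f :: 'a \<Rightarrow> nat. inj f"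
    using finite_imp_inj_to_nat_seg[of "UNIV :: 'a set"] by auto
  then show ?thesis unfolding wo_index_def by (rule someI_ex)
qed

instance wo :: (finite) finite
proof
  have "(UNIV :: 'a wo set) = range Abs_wo" by (metis Abs_wo_cases surjI)
  then show "finite (UNIV :: 'a wo set)" by (metis finite finite_imageI)
qed

instantiation wo :: (finite) wellorder
begin

definition less_eq_wo :: "'a wo \<Rightarrow> 'a wo \<Rightarrow> bool" where
  "x \<le> y \<longleftrightarrow> wo_index (Rep_wo x) \<le> wo_index (Rep_wo y)"

definition less_wo :: "'a wo \<Rightarrow> 'a wo \<Rightarrow> bool" where
  "x < y \<longleftrightarrow> wo_index (Rep_wo x) < wo_index (Rep_wo y)"

instance
proof
  fix x y :: "'a wo"
  show "x \<le> y \<Longrightarrow> y \<le> x \<Longrightarrow> x = y"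
    unfolding less_eq_wo_def by (metis antisym inj_wo_index injD Rep_wo_inject)
next
  fix P :: "'a wo \<Rightarrow> bool" and a
  assume step: "\<And>x. (\<And>y. y < x \<Longrightarrow> P y) \<Longrightarrow> P x"
  show "P a"
    by (induction a rule: measure_induct_rule[of "\<lambda>x. wo_index (Rep_wo x)"])
      (rule step, simp add: less_wo_def)
qed (auto simp: less_eq_wo_def less_wo_def)

end

definition reindex :: "('d::finite \<Rightarrow> 'e::finite) \<Rightarrow> real^'e \<Rightarrow> real^'d" where
  "reindex \<pi> x = (\<chi> i. x $ \<pi> i)"

lemma reindex_nth [simp]: "reindex \<pi> x $ i = x $ \<pi> i"
  by (simp add: reindex_def)

lemma linear_reindex: "linear (reindex \<pi>)"
  by (intro linearI) (simp_all add: vec_eq_iff)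

lemma bounded_linear_reindex: "bounded_linear (reindex \<pi> :: real^'e \<Rightarrow> real^'d)"
  using linear_reindex by (rule linear_conv_bounded_linear[THEN iffD1])

lemma reindex_inner:
  assumes "bij \<pi>"
  shows "reindex \<pi> x \<bullet> reindex \<pi> y = x \<bullet> (y :: real^'e)"
  unfolding inner_vec_def using sum.reindex_bij_betw[OF assms, of "\<lambda>i. x $ i \<bullet> y $ i"] by simp

lemma Basis_cart: "(Basis :: (real^'n) set) = range (\<lambda>i. axis i 1)"
  by (auto simp: Basis_vec_def)

lemma prod_Basis_cart: "(\<Prod>b\<in>Basis. f b) = (\<Prod>i\<in>UNIV. f (axis i 1 :: real^'n))"
  unfolding Basis_cart by (subst prod.reindex) (auto simp: inj_def axis_eq_axis)

text \<open>Boxes pull back to boxes with the same side lengths in another order, and the values on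
  boxes determine the measure.\<close>

lemma lborel_reindex:
  fixes \<pi> :: "'d::finite \<Rightarrow> 'e::finite"
  assumes "bij \<pi>"
  shows "lborel = distr lborel borel (reindex \<pi> :: real^'e \<Rightarrow> real^'d)"
proof (rule lborel_eqI)
  have [measurable]: "(reindex \<pi> :: real^'e \<Rightarrow> real^'d) \<in> borel_measurable borel"
    by (intro borel_measurable_continuous_onI linear_continuous_on bounded_linear_reindex)
  fix l u :: "real^'d" assume lu: "\<And>b. b \<in> Basis \<Longrightarrow> l \<bullet> b \<le> u \<bullet> b"
  then have le: "l $ i \<le> u $ i" for i by (metis axis_in_Basis_iff Basis_real_def cart_eq_inner_axis insertI1)
  let ?r = "reindex (inv \<pi>) :: real^'d \<Rightarrow> real^'e"
  have "i \<in> range \<pi>" for i using assms by (simp add: bij_is_surj)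
  then have vim: "reindex \<pi> -` box l u = box (?r l) (?r u)"
    using assms by (auto simp: mem_box_cart) (metis bij_inv_eq_iff)+
  have le': "(?r l) \<bullet> b \<le> (?r u) \<bullet> b" if "b \<in> Basis" for b
    using that le by (auto simp: Basis_cart inner_axis)
  have "emeasure (distr lborel borel (reindex \<pi>)) (box l u) = emeasure lborel (box (?r l) (?r u))"
    by (subst emeasure_distr) (simp_all add: vim)
  also have "\<dots> = (\<Prod>b\<in>Basis. (?r u - ?r l) \<bullet> b)" using le' by (rule emeasure_lborel_box)
  also have "(\<Prod>b\<in>Basis. (?r u - ?r l) \<bullet> b) = (\<Prod>i\<in>UNIV. u $ inv \<pi> i - l $ inv \<pi> i)"
    by (simp add: prod_Basis_cart inner_axis)
  also have "\<dots> = (\<Prod>i\<in>UNIV. u $ i - l $ i)"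
    using prod.reindex_bij_betw[OF bij_imp_bij_inv[OF assms], of "\<lambda>i. u $ i - l $ i"] by simp
  also have "\<dots> = (\<Prod>b\<in>Basis. (u - l) \<bullet> b)" by (simp add: prod_Basis_cart inner_axis)
  finally show "emeasure (distr lborel borel (reindex \<pi>)) (box l u) = (\<Prod>b\<in>Basis. (u - l) \<bullet> b)" .
qed simp

text \<open>Since \<open>lborel\<close> is preserved, null sets pull back to null sets, which
  carries the result over to the completion used in all volume integrals.\<close>

lemma lebesgue_reindex:
  fixes \<pi> :: "'d::finite \<Rightarrow> 'e::finite"
  assumes "bij \<pi>"
  shows "(reindex \<pi> :: real^'e \<Rightarrow> real^'d) \<in> lebesgue \<rightarrow>\<^sub>M lebesgue"
    and "lebesgue = distr lebesgue lebesgue (reindex \<pi> :: real^'e \<Rightarrow> real^'d)"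
proof -
  let ?r = "reindex \<pi> :: real^'e \<Rightarrow> real^'d"
  have [measurable]: "?r \<in> borel \<rightarrow>\<^sub>M borel"
    by (intro borel_measurable_continuous_onI linear_continuous_on bounded_linear_reindex)
  have eq: "lborel = distr lborel borel ?r" by (rule lborel_reindex[OF assms])
  have eq': "distr lborel lborel ?r = lborel" by (metis eq distr_cong sets_lborel)
  have m: "?r \<in> lebesgue \<rightarrow>\<^sub>M lborel" by (intro measurable_completion) simp
  have "distr lebesgue lborel ?r = distr lborel lborel ?r" by (rule distr_completion) simp
  then have d: "distr lebesgue lborel ?r = lborel" using eq' by simp
  show "?r \<in> lebesgue \<rightarrow>\<^sub>M lebesgue"
    by (rule completion.measurable_completion2[OF m]) (simp add: d)
  have "completion (distr lebesgue lborel ?r) = distr lebesgue lebesgue ?r"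
    by (rule completion.completion_distr_eq[OF m]) (simp add: d)
  then show "lebesgue = distr lebesgue lebesgue ?r" by (simp add: d)
qed

lemma absolutely_integrable_reindex:
  fixes F :: "real^'d \<Rightarrow> real" and \<pi> :: "'d::finite \<Rightarrow> 'e::finite"
  assumes "bij \<pi>" "F absolutely_integrable_on A"
  shows "(\<lambda>y. F (reindex \<pi> y)) absolutely_integrable_on (reindex \<pi> -` A)"
    and "integral (reindex \<pi> -` A) (\<lambda>y. F (reindex \<pi> y)) = integral A F"
proof -
  let ?r = "reindex \<pi> :: real^'e \<Rightarrow> real^'d" and ?F = "\<lambda>x. indicator A x *\<^sub>R F x"
  have i: "integrable lebesgue ?F" using assms(2) by (simp add: set_integrable_def)
  then have "integrable (distr lebesgue lebesgue ?r) ?F" using lebesgue_reindex(2)[OF assms(1)] by simp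
  then have "integrable lebesgue (\<lambda>y. ?F (?r y))" by (rule integrable_distr[OF lebesgue_reindex(1)[OF assms(1)]])
  then show *: "(\<lambda>y. F (?r y)) absolutely_integrable_on (?r -` A)"
    by (simp add: set_integrable_def indicator_def vimage_def)
  have "integral A F = integral\<^sup>L lebesgue ?F"
    using set_lebesgue_integral_eq_integral(2)[OF assms(2)] by (simp add: set_lebesgue_integral_def)
  also have "\<dots> = integral\<^sup>L (distr lebesgue lebesgue ?r) ?F" using lebesgue_reindex(2)[OF assms(1)] by simp
  also have "\<dots> = integral\<^sup>L lebesgue (\<lambda>y. ?F (?r y))"
    by (rule integral_distr[OF lebesgue_reindex(1)[OF assms(1)]]) (use i in auto)
  also have "\<dots> = integral (?r -` A) (\<lambda>y. F (?r y))"
    using set_lebesgue_integral_eq_integral(2)[OF *] by (simp add: set_lebesgue_integral_def indicator_def vimage_def)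
  finally show "integral (?r -` A) (\<lambda>y. F (?r y)) = integral A F" by simp
qed

subsection \<open>Maps whose derivative is a rank-one perturbation of a scaling\<close>

text \<open>An orthogonal change of basis turns \<open>n\<close> into a coordinate axis. There the
  map differs from the scaling in a single column, and Cramer's rule evaluates the determinant with
  that column replaced.\<close>

lemma det_scaling_plus_rank_one:
  fixes n w :: "real^'n::{finite,wellorder}"
  assumes "\<rho> \<noteq> 0" "norm n = 1"
  shows "det (matrix (\<lambda>v. \<rho> *\<^sub>R v + (n \<bullet> v) *\<^sub>R w)) = \<rho> ^ (CARD('n) - 1) * (\<rho> + n \<bullet> w)"
proof -
  define k :: 'n where "k = undefined"
  obtain Q :: "real^'n::_ \<Rightarrow> real^'n::_" where Q: "orthogonal_transformation Q" "Q (axis k 1) = n"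
    using orthogonal_transformation_exists_1[of "axis k 1" n] assms(2) norm_axis_1[of k] by metis
  have lQ: "linear Q" using Q(1) by (rule orthogonal_transformation_linear)
  define R where "R = inv Q"
  have lR: "linear R"
    unfolding R_def by (intro orthogonal_transformation_linear orthogonal_transformation_inv Q(1))
  have QR: "Q (R x) = x" "R (Q x) = x" for x
    unfolding R_def using orthogonal_transformation_bij[OF Q(1)]
    by (simp_all add: bij_is_surj bij_is_inj surj_f_inv_f)
  let ?L = "\<lambda>v. \<rho> *\<^sub>R v + (n \<bullet> v) *\<^sub>R w" and ?L' = "\<lambda>v. \<rho> *\<^sub>R v + (v $ k) *\<^sub>R R w"
  have lL: "linear ?L" by (intro linearI) (auto simp: algebra_simps inner_add_right)
  have nQ: "n \<bullet> Q v = v $ k" for v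
  proof -
    have "n \<bullet> Q v = axis k 1 \<bullet> v" using Q by (metis orthogonal_transformation_def)
    then show ?thesis by (simp add: inner_axis')
  qed
  have "?L' v = R (?L (Q v))" for v
    using lR by (simp add: nQ linear_add linear_scale QR)
  then have "?L' = R \<circ> (?L \<circ> Q)" by (simp add: fun_eq_iff)
  moreover have "matrix (R \<circ> (?L \<circ> Q)) = matrix R ** (matrix ?L ** matrix Q)"
    using matrix_compose[OF linear_compose[OF lQ lL] lR] matrix_compose[OF lQ lL] by simp
  ultimately have "det (matrix ?L') = det (matrix R) * (det (matrix ?L) * det (matrix Q))"
    by (simp only: det_mul)
  moreover have "det (matrix R) * det (matrix Q) = 1"
  proof -
    have "matrix R ** matrix Q = matrix (R \<circ> Q)" using lR lQ by (simp add: matrix_compose)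
    also have "R \<circ> Q = id" by (simp add: fun_eq_iff QR)
    finally have "det (matrix R ** matrix Q) = 1" by (simp only: matrix_id_mat_1 det_I)
    then show ?thesis by (simp only: det_mul)
  qed
  ultimately have 1: "det (matrix ?L') = det (matrix ?L)"
    by (simp only: mult.left_commute[of "det (matrix R)"] mult_1_right)
  define A :: "real^'n::_^'n::_" where "A = mat \<rho>"
  \<comment> \<open>Chosen so that \<open>A *v x\<close> is the one column in which the rotated map
    differs from the scaling.\<close>
  define x where "x = axis k 1 + (1 / \<rho>) *\<^sub>R R w"
  have A: "A *v y = \<rho> *\<^sub>R y" for y
    unfolding A_def by (simp add: vec_eq_iff matrix_vector_mult_def mat_def if_distrib[of "\<lambda>x. x * _"] cong: if_cong)
  have "matrix ?L' = (\<chi> i j. if j = k then (A *v x) $ i else A $ i $ j)"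
    unfolding A using assms(1)
    by (auto simp: vec_eq_iff matrix_def x_def A_def mat_def axis_def distrib_left)
  then have 2: "det (matrix ?L') = x $ k * det A" by (simp only: cramer_lemma)
  have 3: "det A = \<rho> ^ CARD('n)"
    unfolding A_def by (subst det_diagonal) (auto simp: mat_def)
  have 4: "n \<bullet> w = R w $ k" using nQ[of "R w"] by (simp add: QR)
  have "CARD('n) = Suc (CARD('n) - 1)" by simp
  then have "\<rho> ^ CARD('n) = \<rho> * \<rho> ^ (CARD('n) - 1)" by (metis power_Suc)
  then have "det (matrix ?L) = (1 + R w $ k / \<rho>) * (\<rho> * \<rho> ^ (CARD('n) - 1))"
    using 1 2 3 by (simp add: x_def)
  also have "\<dots> = \<rho> ^ (CARD('n) - 1) * (\<rho> + n \<bullet> w)"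
    unfolding 4 using assms(1) by (simp add: distrib_left distrib_right mult_ac)
  finally show ?thesis .
qed

text \<open>The change of variables theorem speaks about integrands with values in
  \<open>real^'n\<close>; scalar ones pass through it as multiples of
  \<open>1 :: real^1\<close>.\<close>

lemma absolutely_integrable_vec1:
  fixes F :: "real^'d \<Rightarrow> real"
  assumes F: "F absolutely_integrable_on A"
  shows "(\<lambda>y. F y *\<^sub>R (1::real^1)) absolutely_integrable_on A"
    and "integral A (\<lambda>y. F y *\<^sub>R (1::real^1)) = integral A F *\<^sub>R 1"
proof -
  have bl: "bounded_linear (\<lambda>t. t *\<^sub>R (1::real^1))" by (rule bounded_linear_scaleR_left)
  have eq: "(\<lambda>t. t *\<^sub>R (1::real^1)) \<circ> F = (\<lambda>y. F y *\<^sub>R 1)" by (rule ext) (rule o_apply)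
  show "(\<lambda>y. F y *\<^sub>R (1::real^1)) absolutely_integrable_on A"
    using absolutely_integrable_linear[OF F bl] unfolding eq .
  show "integral A (\<lambda>y. F y *\<^sub>R (1::real^1)) = integral A F *\<^sub>R 1"
    using integral_linear[OF set_lebesgue_integral_eq_integral(1)[OF F] bl] unfolding eq .
qed

lemma absolutely_integrable_vec1_D:
  fixes F :: "real^'d \<Rightarrow> real"
  assumes F: "(\<lambda>y. F y *\<^sub>R (1::real^1)) absolutely_integrable_on A"
  shows "F absolutely_integrable_on A"
    and "integral A (\<lambda>y. F y *\<^sub>R (1::real^1)) = b *\<^sub>R 1 \<Longrightarrow> integral A F = b"
proof -
  have bl: "bounded_linear (\<lambda>x::real^1. x $ 1)" by (rule bounded_linear_vec_nth)
  have "(\<lambda>x::real^1. x $ 1) \<circ> (\<lambda>y. F y *\<^sub>R (1::real^1)) = F" by (rule ext) simp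
  then show *: "F absolutely_integrable_on A"
    using absolutely_integrable_linear[OF F bl] by (simp only:)
  assume "integral A (\<lambda>y. F y *\<^sub>R (1::real^1)) = b *\<^sub>R 1"
  then have "integral A F *\<^sub>R (1::real^1) = b *\<^sub>R 1" by (simp only: absolutely_integrable_vec1(2)[OF *])
  then have "(integral A F *\<^sub>R (1::real^1)) $ 1 = (b *\<^sub>R (1::real^1)) $ 1"
    by (rule arg_cong[where f = "\<lambda>x. x $ 1"])
  then show "integral A F = b" by simp
qed

text \<open>Tailored to the cone formula: there rays are stretched by a factor that depends on
  \<open>n \<bullet> x\<close> alone, which is why the derivative is a scaling plus a rank-one term.
  The theorem is applied in the renamed coordinates; renaming is an isometry, so the derivative
  keeps this form.\<close>

lemma change_of_variables_rank_one:
  fixes g w :: "real^'d \<Rightarrow> real^'d" and h \<rho> :: "real^'d \<Rightarrow> real"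
  assumes "S \<in> sets lebesgue" "inj_on g S" "norm n = 1"
    and der: "\<And>x. x \<in> S \<Longrightarrow> (g has_derivative (\<lambda>v. \<rho> x *\<^sub>R v + (n \<bullet> v) *\<^sub>R w x)) (at x within S)"
    and "\<And>x. x \<in> S \<Longrightarrow> \<rho> x \<noteq> 0"
    and J: "\<And>x. x \<in> S \<Longrightarrow> J x = \<bar>\<rho> x ^ (CARD('d) - 1) * (\<rho> x + n \<bullet> w x)\<bar> * h (g x)"
    and int: "h absolutely_integrable_on (g ` S)"
  shows "J absolutely_integrable_on S" "integral S J = integral (g ` S) h"
proof -
  define r :: "real^'d wo \<Rightarrow> real^'d" where "r = reindex Abs_wo"
  define r' :: "real^'d \<Rightarrow> real^'d wo" where "r' = reindex Rep_wo"
  have "bij (Abs_wo :: 'd \<Rightarrow> 'd wo)"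
    by (rule o_bij[of Rep_wo]) (simp_all add: fun_eq_iff Abs_wo_inverse Rep_wo_inverse)
  moreover have "bij (Rep_wo :: 'd wo \<Rightarrow> 'd)"
    by (rule o_bij[of Abs_wo]) (simp_all add: fun_eq_iff Abs_wo_inverse Rep_wo_inverse)
  ultimately have bij: "bij (Abs_wo :: 'd \<Rightarrow> 'd wo)" "bij (Rep_wo :: 'd wo \<Rightarrow> 'd)" .
  have rr': "r (r' x) = x" "r' (r y) = y" for x y
    unfolding r_def r'_def by (simp_all add: vec_eq_iff Abs_wo_inverse Rep_wo_inverse)
  have lr: "bounded_linear r" "bounded_linear r'" unfolding r_def r'_def by (rule bounded_linear_reindex)+
  have inner_r: "r x \<bullet> r y = x \<bullet> y" "r' u \<bullet> r' v = u \<bullet> v" for x y u v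
    unfolding r_def r'_def by (rule reindex_inner bij)+
  let ?S = "r -` S" and ?g = "\<lambda>y. r' (g (r y))" and ?h = "\<lambda>y. h (r y)"
  let ?g' = "\<lambda>y v. \<rho> (r y) *\<^sub>R v + (r' n \<bullet> v) *\<^sub>R r' (w (r y))"
  have vim: "r -` X = r' ` X" for X
  proof (intro subset_antisym subsetI)
    fix y assume "y \<in> r -` X"
    then show "y \<in> r' ` X" by (intro image_eqI[of _ _ "r y"]) (auto simp: rr')
  qed (auto simp: rr')
  then have "r ` ?S = S" by (simp add: image_image rr')
  moreover have "?g ` ?S = r' ` g ` (r ` ?S)" by (simp only: image_image)
  ultimately have gS: "?g ` ?S = r -` (g ` S)" by (simp only: vim[of "g ` S"])
  have Sl: "?S \<in> sets lebesgue"
    using measurable_sets[OF lebesgue_reindex(1)[OF bij(1)] assms(1)]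
    unfolding r_def by (simp only: space_completion space_lborel space_borel Int_UNIV_right)
  have inj: "inj_on ?g ?S" 
  proof (rule inj_onI)
    fix x y assume xy: "x \<in> ?S" "y \<in> ?S" "?g x = ?g y"
    from xy(3) have "r (?g x) = r (?g y)" by (rule arg_cong)
    then have "g (r x) = g (r y)" by (simp only: rr')
    then have "r x = r y" by (rule inj_onD[OF assms(2)]) (use xy in auto)
    then have "r' (r x) = r' (r y)" by (rule arg_cong)
    then show "x = y" by (simp only: rr')
  qed
  have dg: "(?g has_derivative ?g' y) (at y within ?S)" if "y \<in> ?S" for y
  proof -
    have "((\<lambda>y. g (r y)) has_derivative (\<lambda>v. \<rho> (r y) *\<^sub>R r v + (n \<bullet> r v) *\<^sub>R w (r y))) (at y within ?S)"
      by (rule has_derivative_in_compose2[OF der _ that bounded_linear_imp_has_derivative[OF lr(1)]]) auto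
    from bounded_linear.has_derivative[OF lr(2) this]
    have "(?g has_derivative (\<lambda>v. r' (\<rho> (r y) *\<^sub>R r v + (n \<bullet> r v) *\<^sub>R w (r y)))) (at y within ?S)" .
    moreover have "r' (\<rho> (r y) *\<^sub>R r v + (n \<bullet> r v) *\<^sub>R w (r y)) = ?g' y v" for v
      using inner_r(2)[of n "r v"] lr(2)
      by (simp add: rr' linear_add linear_scale bounded_linear.linear)
    ultimately show ?thesis by simp
  qed
  have det: "\<bar>det (matrix (?g' y))\<bar> * ?h (?g y) = J (r y)" if "y \<in> ?S" for y
  proof -
    have "norm (r' n) = 1" using assms(3) inner_r(2)[of n n] by (simp add: norm_eq_sqrt_inner)
    moreover have "CARD('d wo) = CARD('d)" using bij_betw_same_card[OF bij(2)] .
    ultimately show ?thesis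
      using that assms(5)[of "r y"] J[of "r y"] inner_r(2)[of n "w (r y)"]
      by (simp add: det_scaling_plus_rank_one rr')
  qed
  have hint: "?h absolutely_integrable_on (r -` (g ` S))" "integral (r -` (g ` S)) ?h = integral (g ` S) h"
    unfolding r_def by (rule absolutely_integrable_reindex[OF bij(1) int])+
  have V: "(\<lambda>y. \<bar>det (matrix (?g' y))\<bar> *\<^sub>R (?h (?g y) *\<^sub>R (1::real^1))) absolutely_integrable_on ?S
     \<and> integral ?S (\<lambda>y. \<bar>det (matrix (?g' y))\<bar> *\<^sub>R (?h (?g y) *\<^sub>R (1::real^1))) = b
     \<longleftrightarrow> (\<lambda>y. ?h y *\<^sub>R (1::real^1)) absolutely_integrable_on (?g ` ?S) \<and> integral (?g ` ?S) (\<lambda>y. ?h y *\<^sub>R (1::real^1)) = b" for b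
    by (rule has_absolute_integral_change_of_variables[OF Sl dg inj])
  have Jeq: "(\<lambda>y. \<bar>det (matrix (?g' y))\<bar> *\<^sub>R (?h (?g y) *\<^sub>R (1::real^1))) absolutely_integrable_on ?S
      \<longleftrightarrow> (\<lambda>y. J (r y) *\<^sub>R (1::real^1)) absolutely_integrable_on ?S"
    by (intro set_integrable_cong refl) (simp add: det)
  have Jeq': "integral ?S (\<lambda>y. \<bar>det (matrix (?g' y))\<bar> *\<^sub>R (?h (?g y) *\<^sub>R (1::real^1)))
      = integral ?S (\<lambda>y. J (r y) *\<^sub>R (1::real^1))"
    by (intro integral_cong) (simp add: det)
  have "(\<lambda>y. ?h y *\<^sub>R (1::real^1)) absolutely_integrable_on (?g ` ?S)"
    "integral (?g ` ?S) (\<lambda>y. ?h y *\<^sub>R (1::real^1)) = integral (g ` S) h *\<^sub>R 1"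
    unfolding gS using absolutely_integrable_vec1[OF hint(1)] hint(2) by simp_all
  then have q: "(\<lambda>y. J (r y) *\<^sub>R (1::real^1)) absolutely_integrable_on ?S"
    "integral ?S (\<lambda>y. J (r y) *\<^sub>R (1::real^1)) = integral (g ` S) h *\<^sub>R 1"
    using V[of "integral (g ` S) h *\<^sub>R 1"] unfolding Jeq Jeq' by blast+
  note Jr = absolutely_integrable_vec1_D(1)[OF q(1)] absolutely_integrable_vec1_D(2)[OF q]
  have "r' -` ?S = S" by (auto simp: rr')
  then show "J absolutely_integrable_on S" "integral S J = integral (g ` S) h"
    using absolutely_integrable_reindex[OF bij(2) Jr(1)] Jr(2) unfolding r'_def[symmetric] by (simp_all add: rr')
qed

section \<open>Geometry of a simplex\<close>

locale full_simplex =
  fixes S :: "(real^'d) set"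
  assumes indep: "\<not> affine_dependent S" and card_S: "card S = Suc CARD('d)"
begin

lemma finite_S [simp, intro]: "finite S" using indep by (rule aff_independent_finite)

text \<open>The edges leaving \<open>v\<close> are independent, so some linear \<phi> equals one on
  all of them; x -> 1 - \<phi>(x - v) is then one at \<open>v\<close> and zero at the other
  vertices.\<close>

lemma dual_exists: "\<exists>G \<kappa>. \<forall>v\<in>S. \<forall>w\<in>S. G v \<bullet> w + \<kappa> v = (if v = w then 1 else 0 :: real)"
proof -
  have "\<exists>g k. \<forall>w\<in>S. g \<bullet> w + k = (if v = w then 1 else 0 :: real)" if "v \<in> S" for v
  proof -
    let ?B = "(\<lambda>x. x - v) ` (S - {v})"
    have "insert v (S - {v}) = S" using that by auto
    then have "independent ?B"
      using affine_dependent_iff_dependent[of v "S - {v}"] indep by (simp add: image_def)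
    from linear_independent_extend[OF this, of "\<lambda>_. 1::real"]
    obtain \<phi> :: "real^'d \<Rightarrow> real" where \<phi>: "linear \<phi>" "\<And>x. x \<in> ?B \<Longrightarrow> \<phi> x = 1" by auto
    let ?a = "adjoint \<phi> 1"
    have "x \<bullet> ?a = \<phi> x" for x using adjoint_works[OF \<phi>(1), of x 1] by simp
    then have eq: "(- ?a) \<bullet> w + (1 + v \<bullet> ?a) = 1 - \<phi> (w - v)" for w
      by (metis (no_types) add.commute add_diff_eq diff_conv_add_uminus diff_diff_eq2 inner_commute
          inner_diff_left inner_minus_left)
    have "(- ?a) \<bullet> w + (1 + v \<bullet> ?a) = (if v = w then 1 else 0)" if "w \<in> S" for w
      unfolding eq using \<phi>(2)[of "w - v"] linear_0[OF \<phi>(1)] that by auto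
    then show ?thesis by blast
  qed
  then show ?thesis by metis
qed

text \<open>Gradient of the barycentric coordinate \<open>lam v\<close>, with \<kappa> its constant
  term; all vertices are chosen at once.\<close>

definition G :: "real^'d \<Rightarrow> real^'d" where
  "G = (SOME G. \<exists>\<kappa>. \<forall>v\<in>S. \<forall>w\<in>S. G v \<bullet> w + \<kappa> v = (if v = w then 1 else 0 :: real))"

definition \<kappa> :: "real^'d \<Rightarrow> real" where
  "\<kappa> = (SOME \<kappa>. \<forall>v\<in>S. \<forall>w\<in>S. G v \<bullet> w + \<kappa> v = (if v = w then 1 else 0 :: real))"

definition lam :: "real^'d \<Rightarrow> real^'d \<Rightarrow> real" where
  "lam v x = G v \<bullet> x + \<kappa> v"

abbreviation "K \<equiv> convex hull S"

definition face :: "real^'d \<Rightarrow> (real^'d) set" where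
  "face v = convex hull (S - {v})"

lemma lam_vertex: "v \<in> S \<Longrightarrow> w \<in> S \<Longrightarrow> lam v w = (if v = w then 1 else 0)"
proof -
  have "\<exists>\<kappa>. \<forall>v\<in>S. \<forall>w\<in>S. G v \<bullet> w + \<kappa> v = (if v = w then 1 else 0 :: real)"
    unfolding G_def by (rule someI_ex[OF dual_exists])
  then have "\<forall>v\<in>S. \<forall>w\<in>S. G v \<bullet> w + \<kappa> v = (if v = w then 1 else 0 :: real)"
    unfolding \<kappa>_def by (rule someI_ex)
  then show "v \<in> S \<Longrightarrow> w \<in> S \<Longrightarrow> lam v w = (if v = w then 1 else 0)" by (simp add: lam_def)
qed

lemma lam_diff: "lam v x - lam v y = G v \<bullet> (x - y)"
  by (simp add: lam_def inner_diff_right)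

lemma lam_affine: "lam v (x + s *\<^sub>R (y - x)) = lam v x + s * (lam v y - lam v x)"
  by (simp add: lam_def inner_add_right inner_diff_right)

lemma lam_sum:
  assumes "v \<in> S" "sum u S = 1"
  shows "lam v (\<Sum>w\<in>S. u w *\<^sub>R w) = u v"
proof -
  have "lam v (\<Sum>w\<in>S. u w *\<^sub>R w) = (\<Sum>w\<in>S. u w * (G v \<bullet> w)) + (\<Sum>w\<in>S. u w) * \<kappa> v"
    using assms by (simp add: lam_def inner_sum_right)
  also have "\<dots> = (\<Sum>w\<in>S. u w * lam v w)"
    unfolding sum_distrib_right sum.distrib[symmetric] by (simp add: lam_def algebra_simps)
  also have "\<dots> = (\<Sum>w\<in>S. if w = v then u w else 0)" using assms(1) by (intro sum.cong) (auto simp: lam_vertex)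
  also have "\<dots> = u v" using assms(1) by simp
  finally show ?thesis .
qed

lemma lam_repr: "(\<Sum>v\<in>S. lam v x) = 1" "(\<Sum>v\<in>S. lam v x *\<^sub>R v) = x"
proof -
  have "affine hull S = UNIV"
    using indep card_S by (intro affine_independent_span_eq) auto
  then obtain u where u: "sum u S = 1" "(\<Sum>v\<in>S. u v *\<^sub>R v) = x"
    using affine_hull_finite[of S] by auto
  have "lam v x = u v" if "v \<in> S" for v using lam_sum[OF that u(1)] u(2) by simp
  then show "(\<Sum>v\<in>S. lam v x) = 1" "(\<Sum>v\<in>S. lam v x *\<^sub>R v) = x" using u by simp_all
qed

lemma K_eq: "K = {x. \<forall>v\<in>S. 0 \<le> lam v x}"
proof (intro subset_antisym subsetI)
  fix x assume "x \<in> K"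
  then obtain u where u: "\<forall>v\<in>S. 0 \<le> u v" "sum u S = 1" "(\<Sum>v\<in>S. u v *\<^sub>R v) = x"
    by (auto simp: convex_hull_finite)
  then show "x \<in> {x. \<forall>v\<in>S. 0 \<le> lam v x}" using lam_sum[OF _ u(2)] by auto
next
  fix x assume "x \<in> {x. \<forall>v\<in>S. 0 \<le> lam v x}"
  then show "x \<in> K" using lam_repr[of x] by (auto simp: convex_hull_finite intro!: exI[of _ "\<lambda>v. lam v x"])
qed

lemma face_eq: assumes "v \<in> S" shows "face v = {x \<in> K. lam v x = 0}"
proof (intro subset_antisym subsetI)
  fix x assume "x \<in> face v"
  then obtain u where u: "\<forall>w\<in>S - {v}. 0 \<le> u w" "sum u (S - {v}) = 1" "(\<Sum>w\<in>S - {v}. u w *\<^sub>R w) = x"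
    by (auto simp: convex_hull_finite face_def)
  let ?u = "u(v := 0)"
  have "sum ?u S = 1" "(\<Sum>w\<in>S. ?u w *\<^sub>R w) = x"
    using assms u(2,3) by (simp_all add: sum.remove[OF finite_S assms])
  then have "lam w x = ?u w" if "w \<in> S" for w using lam_sum[OF that, of ?u] by simp
  then show "x \<in> {x \<in> K. lam v x = 0}" using u(1) assms by (auto simp: K_eq)
next
  fix x assume x: "x \<in> {x \<in> K. lam v x = 0}"
  have "(\<Sum>w\<in>S - {v}. lam w x) = 1" "(\<Sum>w\<in>S - {v}. lam w x *\<^sub>R w) = x"
    using lam_repr[of x] x by (simp_all add: sum.remove[OF finite_S assms])
  then show "x \<in> face v"
    using x by (auto simp: convex_hull_finite face_def K_eq intro!: exI[of _ "\<lambda>v. lam v x"])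
qed

lemma face_subset: "v \<in> S \<Longrightarrow> face v \<subseteq> K" by (auto simp: face_eq)

lemma other_vertex: obtains w where "w \<in> S" "w \<noteq> v"
proof -
  have "\<not> S \<subseteq> {v}" using card_S card_mono[of "{v}" S] by auto
  then show ?thesis using that by auto
qed

lemma vertex_in_face: "v \<in> S \<Longrightarrow> w \<in> S \<Longrightarrow> w \<in> face v \<longleftrightarrow> w \<noteq> v"
  by (auto simp: face_eq lam_vertex hull_inc)

lemma facet_iff: "F facet_of K \<longleftrightarrow> (\<exists>v\<in>S. F = face v)"
proof -
  have "face v \<noteq> {}" if "v \<in> S" for v using other_vertex[of v] vertex_in_face[OF that] by blast
  then show ?thesis
    unfolding facet_of_convex_hull_affine_independent[OF indep, of F] face_def by metis
qed

lemma facets: "{F. F facet_of K} = face ` S"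
  using facet_iff by auto

lemma inj_face: "inj_on face S"
  by (intro inj_onI) (metis vertex_in_face)

lemma compact_K: "compact K" using finite_imp_compact_convex_hull by blast

lemma compact_face: "compact (face v)"
  unfolding face_def using finite_imp_compact_convex_hull[of "S - {v}"] by auto

lemma G_nonzero: "v \<in> S \<Longrightarrow> G v \<noteq> 0"
  using lam_diff[of v v] lam_vertex other_vertex[of v] by (metis diff_zero inner_zero_left zero_neq_one)

lemma continuous_lam: "continuous_on A (lam v)"
  unfolding lam_def[abs_def] by (intro continuous_intros)

text \<open>These are the identities of \<open>lam_repr\<close> differentiated in the direction
  \<open>e\<close>.\<close>

lemma G_sum: "(\<Sum>v\<in>S. G v \<bullet> e) = 0" "(\<Sum>v\<in>S. (G v \<bullet> e) *\<^sub>R v) = e"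
proof -
  have e: "G v \<bullet> e = lam v e - lam v 0" for v by (simp add: lam_def)
  show "(\<Sum>v\<in>S. G v \<bullet> e) = 0" unfolding e sum_subtractf by (simp add: lam_repr)
  show "(\<Sum>v\<in>S. (G v \<bullet> e) *\<^sub>R v) = e" unfolding e by (simp add: scaleR_diff_left sum_subtractf lam_repr)
qed

text \<open>Expand an arbitrary \<open>e\<close> over the vertices by \<open>G_sum\<close>. All
  vertices but \<open>v\<close> have the same product with \<open>n\<close>, and the coefficients
  sum to zero, so only the term of \<open>v\<close> survives.\<close>

lemma normal_to_face:
  assumes v: "v \<in> S" and w: "w \<in> face v" and n: "\<And>x y. x \<in> face v \<Longrightarrow> y \<in> face v \<Longrightarrow> n \<bullet> (y - x) = 0"
  shows "n = (n \<bullet> (v - w)) *\<^sub>R G v"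
proof -
  have "n \<bullet> e = (n \<bullet> (v - w)) *\<^sub>R G v \<bullet> e" for e
  proof -
    have "n \<bullet> e = (\<Sum>u\<in>S. (G u \<bullet> e) * (n \<bullet> u))"
      by (subst G_sum(2)[of e, symmetric]) (simp add: inner_sum_right)
    also have "\<dots> = (\<Sum>u\<in>S. (G u \<bullet> e) * (n \<bullet> (u - w)) + (G u \<bullet> e) * (n \<bullet> w))"
      by (intro sum.cong refl) (simp add: inner_diff_right right_diff_distrib)
    also have "\<dots> = (\<Sum>u\<in>S. (G u \<bullet> e) * (n \<bullet> (u - w))) + (\<Sum>u\<in>S. G u \<bullet> e) * (n \<bullet> w)"
      by (simp only: sum_distrib_right sum.distrib)
    also have "\<dots> = (\<Sum>u\<in>S. if u = v then (G v \<bullet> e) * (n \<bullet> (v - w)) else 0)"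
      unfolding G_sum mult_zero_left add_0_right using n[OF w] v
      by (intro sum.cong refl) (auto simp: vertex_in_face)
    also have "\<dots> = (n \<bullet> (v - w)) *\<^sub>R G v \<bullet> e" using v by simp
    finally show ?thesis .
  qed
  then show ?thesis by (metis vector_eq_rdot)
qed

text \<open>\<open>lam v\<close> rises from \<open>0\<close> on the opposite face to
  \<open>1\<close> at \<open>v\<close> with slope \<open>norm (G v)\<close>; hence this is the
  distance of \<open>v\<close> from the plane of that face.\<close>

definition height :: "real^'d \<Rightarrow> real" where "height v = 1 / norm (G v)"

definition nrm :: "real^'d \<Rightarrow> real^'d" where "nrm v = - (height v *\<^sub>R G v)"

lemma height_pos: "v \<in> S \<Longrightarrow> 0 < height v" by (simp add: height_def G_nonzero)

lemma unit_normal_to_face: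
  assumes v: "v \<in> S" and w: "w \<in> face v" and n: "\<And>x y. x \<in> face v \<Longrightarrow> y \<in> face v \<Longrightarrow> n \<bullet> (y - x) = 0"
    and "norm n = 1"
  shows "\<bar>n \<bullet> (v - w)\<bar> = height v"
proof -
  have "norm n = \<bar>n \<bullet> (v - w)\<bar> * norm (G v)" by (subst normal_to_face[OF v w n]) auto
  then show ?thesis using assms(4) G_nonzero[OF v] by (simp add: height_def field_simps)
qed

lemma norm_nrm: "v \<in> S \<Longrightarrow> norm (nrm v) = 1" by (simp add: nrm_def height_def G_nonzero)

lemma G_nrm: "v \<in> S \<Longrightarrow> G v \<bullet> nrm v = - norm (G v)"
  by (simp add: nrm_def height_def G_nonzero power2_norm_eq_inner[symmetric] power2_eq_square)

lemma nrm_diff: "v \<in> S \<Longrightarrow> x \<in> face v \<Longrightarrow> nrm v \<bullet> (y - x) = - height v * lam v y"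
  using lam_diff[of v y x] by (simp add: nrm_def face_eq)

text \<open>Any candidate is orthogonal to the face, hence one of the two unit multiples of
  \<open>G v\<close>; that \<open>v\<close> lies on its inner side fixes the sign.\<close>

lemma outward_normal_face: assumes v: "v \<in> S" shows "outward_normal K (face v) = nrm v"
  unfolding outward_normal_def
proof (rule the_equality)
  show "norm (nrm v) = 1 \<and> (\<forall>x\<in>face v. \<forall>y\<in>K. nrm v \<bullet> (y - x) \<le> 0)"
    using v height_pos[OF v] by (auto simp: norm_nrm nrm_diff K_eq)
  fix n assume n: "norm n = 1 \<and> (\<forall>x\<in>face v. \<forall>y\<in>K. n \<bullet> (y - x) \<le> 0)"
  obtain w where w: "w \<in> face v" using other_vertex vertex_in_face[OF v] by metis
  have n0: "n \<bullet> (y - x) = 0" if "x \<in> face v" "y \<in> face v" for x y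
  proof -
    have "n \<bullet> (y - x) \<le> 0" "n \<bullet> (x - y) \<le> 0" using n that face_subset[OF v] by auto
    then show ?thesis by (simp add: inner_diff_right)
  qed
  have "n \<bullet> (v - w) \<le> 0" using n w v by (auto simp: hull_inc)
  then have "n \<bullet> (v - w) = - height v"
    using unit_normal_to_face[OF v w n0] n by linarith
  then show "n = nrm v" using normal_to_face[OF v w n0] by (simp add: nrm_def)
qed

text \<open>Along the diameter of an inscribed ball normal to the face, \<open>lam v\<close> changes
  by \<open>2 * \<rho> * norm (G v)\<close>, yet on the simplex it stays between \<open>0\<close>
  and \<open>1\<close>.\<close>

lemma inball_le_height: assumes v: "v \<in> S" shows "inball_diameter K \<le> height v"
  unfolding inball_diameter_def
proof (rule cSup_least)
  have "v \<in> K" using v by (rule hull_inc)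
  then show "{2 * \<rho> |\<rho>. 0 \<le> \<rho> \<and> (\<exists>x. cball x \<rho> \<subseteq> K)} \<noteq> {}" by (auto intro!: exI[of _ 0] exI[of _ v])
  fix a assume "a \<in> {2 * \<rho> |\<rho>. 0 \<le> \<rho> \<and> (\<exists>x. cball x \<rho> \<subseteq> K)}"
  then obtain \<rho> x where a: "a = 2 * \<rho>" "0 \<le> \<rho>" and sub: "cball x \<rho> \<subseteq> K" by auto
  let ?y = "x - \<rho> *\<^sub>R nrm v" and ?z = "x + \<rho> *\<^sub>R nrm v"
  have "?y \<in> K" "?z \<in> K" using sub a(2) norm_nrm[OF v] by (auto intro!: subsetD[OF sub] simp: dist_norm)
  then have "lam v ?y \<le> 1" "0 \<le> lam v ?z"
    using lam_repr(1)[of ?y] sum_nonneg[of "S - {v}" "\<lambda>w. lam w ?y"] v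
    by (auto simp: K_eq sum.remove[OF finite_S v])
  then have "G v \<bullet> (?y - ?z) \<le> 1" unfolding lam_diff[symmetric] by simp
  moreover have "G v \<bullet> (?y - ?z) = 2 * \<rho> * norm (G v)"
    by (simp only: inner_diff_right inner_add_right inner_scaleR_right G_nrm[OF v])
  ultimately have "2 * \<rho> * (norm (G v)) \<le> 1" by simp
  then show "a \<le> height v" using G_nonzero[OF v] by (simp add: a height_def field_simps)
qed

end

section \<open>Polynomial functions\<close>

abbreviation "polyfun \<equiv> real_polynomial_function"

definition grad :: "(real^'d \<Rightarrow> real) \<Rightarrow> real^'d \<Rightarrow> real^'d" where
  "grad p x = (\<chi> i. frechet_derivative p (at x) (axis i 1))"

lemma grad_eqI:
  assumes "(p has_derivative (\<lambda>h. D \<bullet> h)) (at x)"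
  shows "grad p x = D"
  unfolding grad_def frechet_derivative_at[OF assms, symmetric] by (simp add: vec_eq_iff inner_axis)

lemma polyfun_has_grad:
  fixes p :: "real^'d \<Rightarrow> real"
  assumes "polyfun p"
  shows "(p has_derivative (\<lambda>h. grad p x \<bullet> h)) (at x)" "polyfun (\<lambda>x. grad p x \<bullet> e)"
proof -
  have "\<exists>D. (\<forall>x. (p has_derivative (\<lambda>h. D x \<bullet> h)) (at x)) \<and> (\<forall>e. polyfun (\<lambda>x. D x \<bullet> e))"
    using assms
  proof (induction p rule: real_polynomial_function.induct)
    case (linear f)
    have "f h = adjoint f 1 \<bullet> h" for h
      using adjoint_works[OF bounded_linear.linear[OF linear], of h 1] by (simp add: inner_commute)
    then have "f = (\<lambda>h. adjoint f 1 \<bullet> h)" by (rule ext)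
    then have "(f has_derivative (\<lambda>h. adjoint f 1 \<bullet> h)) (at x)" for x
      using bounded_linear_imp_has_derivative[OF linear] by metis
    then show ?case by (intro exI[of _ "\<lambda>_. adjoint f 1"]) auto
  next
    case (const c)
    show ?case by (intro exI[of _ "\<lambda>_. 0"]) auto
  next
    case (add f g)
    then obtain D E where "\<forall>x. (f has_derivative (\<lambda>h. D x \<bullet> h)) (at x)" "\<forall>e. polyfun (\<lambda>x. D x \<bullet> e)"
      "\<forall>x. (g has_derivative (\<lambda>h. E x \<bullet> h)) (at x)" "\<forall>e. polyfun (\<lambda>x. E x \<bullet> e)" by blast
    then show ?case
      by (intro exI[of _ "\<lambda>x. D x + E x"]) (auto simp: inner_add_left intro: has_derivative_add)
  next
    case (mult f g)
    then obtain D E where DE: "\<forall>x. (f has_derivative (\<lambda>h. D x \<bullet> h)) (at x)" "\<forall>e. polyfun (\<lambda>x. D x \<bullet> e)"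
      "\<forall>x. (g has_derivative (\<lambda>h. E x \<bullet> h)) (at x)" "\<forall>e. polyfun (\<lambda>x. E x \<bullet> e)" by blast
    have "((\<lambda>x. f x * g x) has_derivative (\<lambda>h. (f x *\<^sub>R E x + g x *\<^sub>R D x) \<bullet> h)) (at x)" for x
      using has_derivative_mult[OF DE(1)[rule_format, of x] DE(3)[rule_format, of x]]
      by (simp add: inner_add_left mult.commute)
    moreover have "polyfun (\<lambda>x. (f x *\<^sub>R E x + g x *\<^sub>R D x) \<bullet> e)" for e
      using DE(2,4) mult.hyps by (auto simp: inner_add_left intro!: real_polynomial_function.intros(3,4))
    ultimately show ?case by (intro exI[of _ "\<lambda>x. f x *\<^sub>R E x + g x *\<^sub>R D x"]) blast
  qed
  then obtain D where D: "\<And>x. (p has_derivative (\<lambda>h. D x \<bullet> h)) (at x)" "\<And>e. polyfun (\<lambda>x. D x \<bullet> e)" by blast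
  then have "grad p x = D x" for x by (intro grad_eqI)
  then show "(p has_derivative (\<lambda>h. grad p x \<bullet> h)) (at x)" "polyfun (\<lambda>x. grad p x \<bullet> e)" using D by simp_all
qed

lemma grad_add: "polyfun p \<Longrightarrow> polyfun q \<Longrightarrow> grad (\<lambda>x. p x + q x) x = grad p x + grad q x"
  using has_derivative_add[OF polyfun_has_grad(1) polyfun_has_grad(1), of p q x]
  by (intro grad_eqI) (simp add: inner_add_left)

lemma grad_mult:
  assumes "polyfun p" "polyfun q"
  shows "grad (\<lambda>x. p x * q x) x = p x *\<^sub>R grad q x + q x *\<^sub>R grad p x"
  using has_derivative_mult[OF polyfun_has_grad(1)[OF assms(1), of x] polyfun_has_grad(1)[OF assms(2), of x]]
  by (intro grad_eqI) (simp add: inner_add_left mult.commute)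

lemma grad_nth: "grad (\<lambda>x. x $ i) x = axis i 1"
  by (intro grad_eqI) (simp add: inner_axis' bounded_linear_imp_has_derivative bounded_linear_vec_nth)

lemma polyfun_nth [simp, intro]: "polyfun (\<lambda>x::real^'d. x $ i)"
  by (intro real_polynomial_function.intros(1) bounded_linear_vec_nth)

lemma polyfun_continuous: "polyfun p \<Longrightarrow> continuous_on A p"
  by (simp add: continuous_at_imp_continuous_on continuous_real_polymonial_function)

lemma polyfun_scaled: "polyfun p \<Longrightarrow> polyfun (\<lambda>x. c * p x)"
  by (rule real_polynomial_function.intros(4)[OF real_polynomial_function.intros(2)])

section \<open>Decomposition of polynomials into parts homogeneous about a point\<close>

definition homogeneous_about :: "real^'d \<Rightarrow> nat \<Rightarrow> (real^'d \<Rightarrow> real) \<Rightarrow> bool" where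
  "homogeneous_about v k q \<longleftrightarrow> (\<forall>s x. q (v + s *\<^sub>R (x - v)) = s ^ k * q x)"

text \<open>Serves as the induction principle for the cone formula, which is additive and is
  computed on homogeneous polynomials.\<close>

inductive hom_sum :: "real^'d \<Rightarrow> (real^'d \<Rightarrow> real) \<Rightarrow> bool" for v where
  base: "polyfun q \<Longrightarrow> homogeneous_about v k q \<Longrightarrow> hom_sum v q"
| add: "hom_sum v p \<Longrightarrow> hom_sum v q \<Longrightarrow> hom_sum v (\<lambda>x. p x + q x)"

lemma hom_sum_polyfun: "hom_sum v p \<Longrightarrow> polyfun p"
  by (induction rule: hom_sum.induct) auto

lemma hom_sum_mult:
  assumes "hom_sum v p" "hom_sum v q"
  shows "hom_sum v (\<lambda>x. p x * q x)"
  using assms(1)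
proof (induction rule: hom_sum.induct)
  case (base p k)
  show ?case using assms(2)
  proof (induction rule: hom_sum.induct)
    case (base q l)
    then have "homogeneous_about v (k + l) (\<lambda>x. p x * q x)"
      using \<open>homogeneous_about v k p\<close> by (simp add: homogeneous_about_def power_add)
    then show ?case using base \<open>polyfun p\<close> by (intro hom_sum.base) auto
  next
    case (add q r)
    then show ?case using hom_sum.add[of v "\<lambda>x. p x * q x" "\<lambda>x. p x * r x"] by (simp add: distrib_left)
  qed
next
  case (add p r)
  then show ?case using hom_sum.add[of v "\<lambda>x. p x * q x" "\<lambda>x. r x * q x"] by (simp add: distrib_right)
qed

text \<open>A linear \<open>f\<close> splits into \<open>f (x - v)\<close>, homogeneous of degree
  one about \<open>v\<close>, and the constant \<open>f v\<close>; sums and products stay in the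
  class.\<close>

lemma polyfun_hom_sum:
  fixes p :: "real^'d \<Rightarrow> real"
  assumes "polyfun p" shows "hom_sum v p"
  using assms
proof (induction p rule: real_polynomial_function.induct)
  case (linear f)
  interpret bounded_linear f by fact
  have "polyfun (\<lambda>x. f x - f v)"
    using real_polynomial_function.intros(1)[OF bounded_linear_axioms] real_polynomial_function.intros(2)
    by (rule real_polynomial_function_diff)
  moreover have "homogeneous_about v 1 (\<lambda>x. f (x - v))"
    by (simp add: homogeneous_about_def scale)
  ultimately have 1: "hom_sum v (\<lambda>x. f (x - v))"
    by (intro hom_sum.base[of _ _ 1]) (simp_all add: diff)
  have 2: "hom_sum v (\<lambda>x. f v)" by (intro hom_sum.base[of _ _ 0]) (auto simp: homogeneous_about_def)
  show ?case using hom_sum.add[OF 1 2] by (simp add: diff)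
next
  case (const c)
  show ?case by (intro hom_sum.base[of _ _ 0]) (auto simp: homogeneous_about_def)
qed (auto intro: hom_sum.add hom_sum_mult)

lemma has_derivative_ray:
  assumes "polyfun (p :: real^'d \<Rightarrow> real)"
  shows "((\<lambda>s. p (v + s *\<^sub>R (x - v))) has_real_derivative grad p (v + s *\<^sub>R (x - v)) \<bullet> (x - v)) (at s)"
proof -
  have "((\<lambda>s. v + s *\<^sub>R (x - v)) has_derivative (\<lambda>h. h *\<^sub>R (x - v))) (at s)"
    by (auto intro!: derivative_eq_intros)
  from has_derivative_compose[OF this polyfun_has_grad(1)[OF assms]]
  show ?thesis by (simp add: has_field_derivative_def mult.commute[of _ "_ \<bullet> _"] o_def)
qed

lemma euler:
  assumes "polyfun q" "homogeneous_about v k q"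
  shows "grad q x \<bullet> (x - v) = k * q x"
proof -
  have "((\<lambda>s. q (v + s *\<^sub>R (x - v))) has_real_derivative grad q x \<bullet> (x - v)) (at 1)"
    using has_derivative_ray[OF assms(1), of v x 1] by simp
  moreover have "(\<lambda>s. q (v + s *\<^sub>R (x - v))) = (\<lambda>s. s ^ k * q x)"
    using assms(2) by (simp add: homogeneous_about_def)
  moreover have "((\<lambda>s::real. s ^ k * q x) has_real_derivative k * q x) (at 1)"
    by (auto intro!: derivative_eq_intros)
  ultimately show ?thesis by (metis DERIV_unique)
qed

section \<open>Integration over faces\<close>

text \<open>All that the rules of integration need to know about \<open>face_integral\<close>: it is
  an integral over a compact set of the integrand pulled back along a continuous map into the face.
  So continuous integrands are integrable, and values off the face do not matter.\<close>

definition flat_face :: "(real^'d) set \<Rightarrow> bool" where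
  "flat_face F \<longleftrightarrow> (\<exists>(A :: (real^'d) set) \<pi>. compact A \<and> continuous_on A \<pi> \<and> \<pi> ` A \<subseteq> F \<and>
     (\<forall>g. face_integral F g = (LINT x:A|lebesgue. g (\<pi> x))))"

lemma flat_faceE:
  fixes F :: "(real^'d) set"
  assumes "flat_face F"
  obtains A :: "(real^'d) set" and \<pi> where "compact A" "continuous_on A \<pi>" "\<pi> ` A \<subseteq> F"
    "\<forall>g. face_integral F g = (LINT x:A|lebesgue. g (\<pi> x))"
  using assms unfolding flat_face_def by (elim exE conjE)

lemma continuous_set_integrable:
  fixes g :: "real^'d \<Rightarrow> real"
  assumes "compact A" "continuous_on A g"
  shows "set_integrable lebesgue A g"
  unfolding set_integrable_def
  using borel_integrable_compact[OF assms] by (subst integrable_completion) auto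

lemma face_integral_cong:
  fixes F :: "(real^'d) set"
  assumes "flat_face F" "\<And>x. x \<in> F \<Longrightarrow> g x = h x"
  shows "face_integral F g = face_integral F h"
proof -
  obtain A :: "(real^'d) set" and \<pi> where A: "compact A" "continuous_on A \<pi>" "\<pi> ` A \<subseteq> F"
    "\<forall>g. face_integral F g = (LINT x:A|lebesgue. g (\<pi> x))" by (rule flat_faceE[OF assms(1)])
  then have "A \<in> sets lebesgue" by (simp add: compact_imp_closed)
  moreover have "\<forall>x. x \<in> A \<longrightarrow> g (\<pi> x) = h (\<pi> x)" using A(3) assms(2) by blast
  ultimately show ?thesis unfolding A(4)[rule_format] by (rule set_lebesgue_integral_cong)
qed

lemma face_integral_mult: "flat_face F \<Longrightarrow> face_integral F (\<lambda>x. c * g x) = c * face_integral F g"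
  by (erule flat_faceE) simp

lemma
  fixes F :: "(real^'d) set"
  assumes F: "flat_face F" and g: "continuous_on F g" and h: "continuous_on F h"
  shows face_integral_add: "face_integral F (\<lambda>x. g x + h x) = face_integral F g + face_integral F h"
    and face_integral_diff: "face_integral F (\<lambda>x. g x - h x) = face_integral F g - face_integral F h"
    and face_integral_mono: "(\<And>x. x \<in> F \<Longrightarrow> g x \<le> h x) \<Longrightarrow> face_integral F g \<le> face_integral F h"
proof -
  obtain A :: "(real^'d) set" and \<pi> where A: "compact A" "continuous_on A \<pi>" "\<pi> ` A \<subseteq> F"
    "\<forall>g. face_integral F g = (LINT x:A|lebesgue. g (\<pi> x))" by (rule flat_faceE[OF F])
  have gi: "set_integrable lebesgue A (\<lambda>x. g (\<pi> x))" if "continuous_on F g" for g :: "real^'d \<Rightarrow> real"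
    by (intro continuous_set_integrable A(1) continuous_on_compose2[OF that A(2,3)])
  show "face_integral F (\<lambda>x. g x + h x) = face_integral F g + face_integral F h"
    unfolding A(4)[rule_format] by (rule set_integral_add(2)[OF gi[OF g] gi[OF h]])
  show "face_integral F (\<lambda>x. g x - h x) = face_integral F g - face_integral F h"
    unfolding A(4)[rule_format] by (rule set_integral_diff(2)[OF gi[OF g] gi[OF h]])
  assume "\<And>x. x \<in> F \<Longrightarrow> g x \<le> h x"
  then have "\<And>x. x \<in> A \<Longrightarrow> g (\<pi> x) \<le> h (\<pi> x)" using A(3) by blast
  then show "face_integral F g \<le> face_integral F h"
    unfolding A(4)[rule_format] by (rule set_integral_mono[OF gi[OF g] gi[OF h]])
qed

lemma face_integral_nonneg:
  assumes "flat_face F" "continuous_on F g" "\<And>x. x \<in> F \<Longrightarrow> 0 \<le> g x"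
  shows "0 \<le> face_integral F g"
  using face_integral_mono[OF assms(1) continuous_on_const[of F 0] assms(2)]
    face_integral_mult[OF assms(1), of 0] assms(3) by simp

context full_simplex
begin

text \<open>Replaces the closest point in \<open>face_integral\<close> by the orthogonal projection
  along \<open>n\<close>, with the height in the prism as coordinate along \<open>n\<close>. The
  vector \<open>n\<close> is the one that \<open>face_integral\<close> selects, so its sign is left
  open.\<close>

lemma face_prism:
  assumes v: "v \<in> S"
  obtains n A w where "norm n = 1" "w \<in> face v" "\<forall>x\<in>face v. \<forall>y\<in>face v. n \<bullet> (y - x) = 0"
    "A = (\<lambda>(y, s). y + s *\<^sub>R n) ` (face v \<times> {0..1})"
    "\<forall>g. face_integral (face v) g = (LINT x:A|lebesgue. g (x - (n \<bullet> (x - w)) *\<^sub>R n))"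
    "\<forall>y\<in>face v. \<forall>s. n \<bullet> (y + s *\<^sub>R n - w) = s"
proof -
  define n where "n = (SOME n. norm n = 1 \<and> (\<forall>x\<in>face v. \<forall>y\<in>face v. n \<bullet> (y - x) = 0))"
  have "\<exists>n. norm n = 1 \<and> (\<forall>x\<in>face v. \<forall>y\<in>face v. n \<bullet> (y - x) = 0)"
    using v by (intro exI[of _ "nrm v"]) (auto simp: norm_nrm nrm_diff face_eq)
  then have "norm n = 1 \<and> (\<forall>x\<in>face v. \<forall>y\<in>face v. n \<bullet> (y - x) = 0)"
    unfolding n_def by (rule someI_ex)
  then have n: "norm n = 1" "\<And>x y. x \<in> face v \<Longrightarrow> y \<in> face v \<Longrightarrow> n \<bullet> (y - x) = 0" by auto
  obtain w where w: "w \<in> face v" using other_vertex vertex_in_face[OF v] by metis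
  define A where "A = (\<lambda>(y, s). y + s *\<^sub>R n) ` (face v \<times> {0..1})"
  have nn: "n \<bullet> n = 1" using n(1) by (simp add: norm_eq_1)
  have s: "n \<bullet> (y + s *\<^sub>R n - w) = s" if "y \<in> face v" for y s
    using n(2)[OF w that] nn by (simp add: inner_diff_right inner_add_right)
  \<comment> \<open>Pythagoras: the affine hull lies in the hyperplane through \<open>y\<close>
    orthogonal to \<open>n\<close>.\<close>
  have cp: "closest_point (affine hull face v) (y + s *\<^sub>R n) = y" if y: "y \<in> face v" for y s
  proof (rule closest_point_unique[symmetric])
    have "affine {z. n \<bullet> (z - y) = 0}" by (simp add: inner_diff_right affine_hyperplane)
    then have sub: "affine hull face v \<subseteq> {z. n \<bullet> (z - y) = 0}"
      using n(2)[OF y] by (intro hull_minimal) auto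
    show "\<forall>z\<in>affine hull face v. dist (y + s *\<^sub>R n) y \<le> dist (y + s *\<^sub>R n) z"
    proof
      fix z assume "z \<in> affine hull face v"
      then have z: "n \<bullet> (z - y) = 0" using sub by auto
      have "(norm (a - b))\<^sup>2 = (norm a)\<^sup>2 + (norm b)\<^sup>2" if "a \<bullet> b = 0" for a b :: "real^'d"
        using that inner_commute[of b a]
        by (simp add: power2_norm_eq_inner inner_diff_left inner_diff_right)
      moreover have "(s *\<^sub>R n) \<bullet> (z - y) = 0" unfolding inner_scaleR_left z by (rule mult_zero_right)
      ultimately have "(norm (s *\<^sub>R n - (z - y)))\<^sup>2 = (norm (s *\<^sub>R n))\<^sup>2 + (norm (z - y))\<^sup>2" .
      then have "(norm (s *\<^sub>R n))\<^sup>2 \<le> (norm (s *\<^sub>R n - (z - y)))\<^sup>2" by (simp only: le_add_same_cancel1 zero_le_power2)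
      then have "norm (s *\<^sub>R n) \<le> norm (s *\<^sub>R n - (z - y))" by (rule power2_le_imp_le) (rule norm_ge_zero)
      moreover have "y + s *\<^sub>R n - y = s *\<^sub>R n" "y + s *\<^sub>R n - z = s *\<^sub>R n - (z - y)" by simp_all
      ultimately show "dist (y + s *\<^sub>R n) y \<le> dist (y + s *\<^sub>R n) z" by (simp only: dist_norm)
    qed
    show "convex (affine hull face v)" by (intro affine_imp_convex affine_affine_hull)
    show "closed (affine hull face v)" by (rule closed_affine_hull)
    show "y \<in> affine hull face v" using y by (rule hull_inc)
  qed
  have Aset: "{y + s *\<^sub>R n |y s. y \<in> face v \<and> 0 \<le> s \<and> s \<le> 1} = A"
    unfolding A_def by (auto simp: image_iff) blast
  have "compact A" unfolding A_def
    by (intro compact_continuous_image compact_Times compact_face compact_Icc) (auto intro!: continuous_intros simp: split_def)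
  then have Am: "A \<in> sets lebesgue" by (simp add: compact_imp_closed)
  have fi: "face_integral (face v) g = (LINT x:A|lebesgue. g (x - (n \<bullet> (x - w)) *\<^sub>R n))" for g
    unfolding face_integral_def Let_def n_def[symmetric] Aset
  proof (intro set_lebesgue_integral_cong Am allI impI)
    fix x assume "x \<in> A"
    then obtain y s where x: "x = y + s *\<^sub>R n" "y \<in> face v" unfolding A_def by auto
    show "g (closest_point (affine hull face v) x) = g (x - (n \<bullet> (x - w)) *\<^sub>R n)"
      unfolding x(1) cp[OF x(2)] s[OF x(2)] by simp
  qed
  show thesis
  proof (rule that[OF n(1) w _ A_def])
    show "\<forall>x\<in>face v. \<forall>y\<in>face v. n \<bullet> (y - x) = 0" using n(2) by blast
    show "\<forall>g. face_integral (face v) g = (LINT x:A|lebesgue. g (x - (n \<bullet> (x - w)) *\<^sub>R n))"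
      by (rule allI) (rule fi)
    show "\<forall>y\<in>face v. \<forall>s. n \<bullet> (y + s *\<^sub>R n - w) = s" using s by blast
  qed
qed

lemma flat_face_face: assumes v: "v \<in> S" shows "flat_face (face v)"
proof -
  obtain n A w where "norm n = 1" "w \<in> face v" "\<forall>x\<in>face v. \<forall>y\<in>face v. n \<bullet> (y - x) = 0"
    and A: "A = (\<lambda>(y, s). y + s *\<^sub>R n) ` (face v \<times> {0..1})"
    and g: "\<forall>g. face_integral (face v) g = (LINT x:A|lebesgue. g (x - (n \<bullet> (x - w)) *\<^sub>R n))"
    and s: "\<forall>y\<in>face v. \<forall>s. n \<bullet> (y + s *\<^sub>R n - w) = s" by (rule face_prism[OF v])
  have "compact A" unfolding A
    by (intro compact_continuous_image compact_Times compact_face compact_Icc) (auto intro!: continuous_intros simp: split_def)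
  then show ?thesis unfolding flat_face_def
    using g s by (intro exI[of _ A] exI[of _ "\<lambda>x. x - (n \<bullet> (x - w)) *\<^sub>R n"]) (auto simp: A intro!: continuous_intros)
qed

end

section \<open>The cone formula and the divergence theorem on a simplex\<close>

context full_simplex
begin

lemma lam_le_1: assumes "x \<in> K" "v \<in> S" shows "lam v x \<le> 1" "lam v x = 1 \<Longrightarrow> x = v"
proof -
  have sum: "lam v x + (\<Sum>u\<in>S - {v}. lam u x) = 1"
    using lam_repr(1)[of x] by (simp add: sum.remove[OF finite_S assms(2)])
  have nn: "\<And>u. u \<in> S - {v} \<Longrightarrow> 0 \<le> lam u x" using assms(1) by (auto simp: K_eq)
  then have "0 \<le> (\<Sum>u\<in>S - {v}. lam u x)" by (rule sum_nonneg)
  then show "lam v x \<le> 1" using sum by linarith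
  assume 1: "lam v x = 1"
  then have "(\<Sum>u\<in>S - {v}. lam u x) = 0" using sum by simp
  then have 0: "\<forall>u\<in>S - {v}. lam u x = 0" using nn by (subst (asm) sum_nonneg_eq_0_iff) auto
  have "x = lam v x *\<^sub>R v + (\<Sum>u\<in>S - {v}. lam u x *\<^sub>R u)"
    using lam_repr(2)[of x] by (simp add: sum.remove[OF finite_S assms(2)])
  then show "x = v" using 0 1 by simp
qed

text \<open>For a function that is homogeneous about the vertex \<open>v\<close>, the substitution
  \<open>x = v + s\<^sup>1\<^sup>/\<^sup>N (y - v)\<close> with \<open>N = d + k\<close> maps the prism over the opposite face to the
  simplex and turns the integrand into a multiple of its value at \<open>y\<close>.\<close>

lemma cone_homogeneous:
  assumes v: "v \<in> S" and q: "polyfun q" "homogeneous_about v k q"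
  shows "real (CARD('d) + k) * integral K q = height v * face_integral (face v) q"
proof -
  obtain n A w where nn: "norm n = 1" and w: "w \<in> face v" and n0: "\<forall>x\<in>face v. \<forall>y\<in>face v. n \<bullet> (y - x) = 0"
    and A: "A = (\<lambda>(y, s). y + s *\<^sub>R n) ` (face v \<times> {0..1})"
    and fi: "\<forall>g. face_integral (face v) g = (LINT x:A|lebesgue. g (x - (n \<bullet> (x - w)) *\<^sub>R n))"
    and s: "\<forall>y\<in>face v. \<forall>s. n \<bullet> (y + s *\<^sub>R n - w) = s" by (rule face_prism[OF v])
  define N where "N = CARD('d) + k"
  have N: "N > 0" by (simp add: N_def)
  define sx where "sx x = n \<bullet> (x - w)" for x
  define yx where "yx x = x - sx x *\<^sub>R n" for x
  \<comment> \<open>The base of the prism is cut off: the map would collapse it to \<open>v\<close>,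
    and the root need not be differentiable there.\<close>
  define A' where "A' = A \<inter> {x. 0 < sx x}"
  define \<rho> where "\<rho> x = sx x powr (1 / N)" for x
  define \<rho>' where "\<rho>' x = (1 / N) * sx x powr (1 / N - 1)" for x
  \<comment> \<open>A move along \<open>n\<close> keeps the foot point \<open>yx x\<close>, so the
    derivative of \<open>g\<close> in that direction is
    \<open>\<rho>' x *\<^sub>R (yx x - v)\<close>. \<open>W\<close> is what this adds to the
    scaling.\<close>
  define W where "W x = \<rho>' x *\<^sub>R (yx x - v) - \<rho> x *\<^sub>R n" for x
  define g where "g x = v + \<rho> x *\<^sub>R (yx x - v)" for x
  have Apt: "sx (y + t *\<^sub>R n) = t" "yx (y + t *\<^sub>R n) = y" if "y \<in> face v" for y t
    using s that by (simp_all add: sx_def yx_def)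
  have A'pt: "0 < sx x" "sx x \<le> 1" "yx x \<in> face v" "x = yx x + sx x *\<^sub>R n" if "x \<in> A'" for x
  proof -
    have "x \<in> (\<lambda>(y, s). y + s *\<^sub>R n) ` (face v \<times> {0..1})" "0 < sx x"
      using that unfolding A'_def A by auto
    then obtain y t where "x = y + t *\<^sub>R n" "y \<in> face v" "t \<le> 1" by auto
    then show "0 < sx x" "sx x \<le> 1" "yx x \<in> face v" "x = yx x + sx x *\<^sub>R n"
      using Apt \<open>0 < sx x\<close> by auto
  qed
  have A'I: "y + t *\<^sub>R n \<in> A'" if "y \<in> face v" "0 < t" "t \<le> 1" for y t
    using that Apt[OF that(1)] unfolding A'_def A by (auto intro!: image_eqI[of _ _ "(y, t)"])
  have cA: "compact A" unfolding A
    by (intro compact_continuous_image compact_Times compact_face compact_Icc) (auto intro!: continuous_intros simp: split_def)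
  have "open {x. 0 < sx x}" unfolding sx_def by (intro open_Collect_less continuous_intros)
  then have A'm: "A' \<in> sets lebesgue"
    unfolding A'_def using compact_imp_closed[OF cA] by (intro sets.Int) auto
  have \<rho>: "0 < \<rho> x" "\<rho> x \<le> 1" "\<rho> x ^ N = sx x" if "x \<in> A'" for x
    using A'pt[OF that] N by (auto simp: \<rho>_def powr_le1 powr_power)
  have lamg: "lam u (g x) = lam u v + \<rho> x * (lam u (yx x) - lam u v)" for u x
    unfolding g_def by (rule lam_affine)
  have lamvg: "lam v (g x) = 1 - \<rho> x" if "x \<in> A'" for x
    using A'pt(3)[OF that] v unfolding lamg by (simp add: lam_vertex face_eq)
  have inj: "inj_on g A'"
  proof (rule inj_onI)
    fix x y assume xy: "x \<in> A'" "y \<in> A'" "g x = g y"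
    then have r: "\<rho> x = \<rho> y" using lamvg[of x] lamvg[of y] by simp
    then have "sx x = sx y" using \<rho>(3)[OF xy(1)] \<rho>(3)[OF xy(2)] by simp
    moreover have "yx x = yx y" using xy(3) r \<rho>(1)[OF xy(2)] by (simp add: g_def)
    ultimately show "x = y" using A'pt(4)[OF xy(1)] A'pt(4)[OF xy(2)] by simp
  qed
  have img: "g ` A' = K - {v}"
  proof (intro subset_antisym subsetI)
    fix z assume "z \<in> g ` A'"
    then obtain x where x: "x \<in> A'" "z = g x" by auto
    have "0 \<le> lam u z" if u: "u \<in> S" for u
    proof -
      have "0 \<le> lam u (yx x)" using A'pt(3)[OF x(1)] face_subset[OF v] u unfolding K_eq by blast
      moreover have "0 \<le> lam u v" using u v by (simp add: lam_vertex)
      moreover have "lam u z = (1 - \<rho> x) * lam u v + \<rho> x * lam u (yx x)"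
        unfolding x(2) lamg by (simp add: algebra_simps)
      ultimately show ?thesis using \<rho>[OF x(1)] by simp
    qed
    moreover have "z \<noteq> v" using lamvg[OF x(1)] \<rho>(1)[OF x(1)] v x(2) by (auto simp: lam_vertex)
    ultimately show "z \<in> K - {v}" by (simp add: K_eq)
  next
    fix z assume z: "z \<in> K - {v}"
    \<comment> \<open>The ray parameter of \<open>z\<close>: on a ray from \<open>v\<close>,
      \<open>lam v\<close> falls linearly from \<open>1\<close> to the value \<open>0\<close> on the
      face.\<close>
    define \<sigma> where "\<sigma> = 1 - lam v z"
    have \<sigma>: "0 < \<sigma>" "\<sigma> \<le> 1" using lam_le_1[of z v] z v by (auto simp: \<sigma>_def K_eq less_le)
    define y where "y = v + (1 / \<sigma>) *\<^sub>R (z - v)"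
    have lamy: "lam u y = lam u v + (1 / \<sigma>) * (lam u z - lam u v)" for u
      unfolding y_def by (rule lam_affine)
    have lvy: "lam v y = 0" unfolding lamy using v \<sigma> by (simp add: lam_vertex \<sigma>_def field_simps)
    have "0 \<le> lam u y" if u: "u \<in> S" for u
    proof (cases "u = v")
      case False
      then show ?thesis unfolding lamy using u v z \<sigma> by (auto simp: lam_vertex K_eq)
    qed (simp add: lvy)
    then have y: "y \<in> face v" using lvy v by (simp add: face_eq K_eq)
    have t: "0 < \<sigma> ^ N" "\<sigma> ^ N \<le> 1" using \<sigma> by (simp_all add: power_le_one)
    have "(\<sigma> ^ N) powr (1 / N) = \<sigma>" using \<sigma> N by (simp add: powr_powr flip: powr_realpow)
    then have "g (y + (\<sigma> ^ N) *\<^sub>R n) = v + \<sigma> *\<^sub>R (y - v)"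
      using Apt[OF y] by (simp add: g_def \<rho>_def)
    also have "\<dots> = z" using \<sigma> by (simp add: y_def)
    finally show "z \<in> g ` A'" using A'I[OF y t] by (metis image_eqI)
  qed
  have der: "(g has_derivative (\<lambda>h. \<rho> x *\<^sub>R h + (n \<bullet> h) *\<^sub>R W x)) (at x within A')" if "x \<in> A'" for x
  proof -
    have ds: "(sx has_derivative (\<lambda>h. n \<bullet> h)) (at x within A')"
      unfolding sx_def[abs_def] by (auto intro!: derivative_eq_intros)
    have dy: "(yx has_derivative (\<lambda>h. h - (n \<bullet> h) *\<^sub>R n)) (at x within A')"
      unfolding yx_def[abs_def] by (auto intro!: derivative_eq_intros ds)
    have "((\<lambda>z. z powr (1 / N)) has_real_derivative \<rho>' x) (at (sx x))"
      unfolding \<rho>'_def by (rule has_real_derivative_powr) (rule A'pt(1)[OF that])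
    from DERIV_compose_FDERIV[OF this ds]
    have dr: "(\<rho> has_derivative (\<lambda>h. (n \<bullet> h) * \<rho>' x)) (at x within A')"
      unfolding \<rho>_def[abs_def] .
    have "(g has_derivative (\<lambda>h. \<rho> x *\<^sub>R (h - (n \<bullet> h) *\<^sub>R n) + ((n \<bullet> h) * \<rho>' x) *\<^sub>R (yx x - v))) (at x within A')"
      unfolding g_def[abs_def] by (auto intro!: derivative_eq_intros dr dy)
    moreover have "\<rho> x *\<^sub>R (h - (n \<bullet> h) *\<^sub>R n) + ((n \<bullet> h) * \<rho>' x) *\<^sub>R (yx x - v)
        = \<rho> x *\<^sub>R h + (n \<bullet> h) *\<^sub>R W x" for h
      unfolding W_def by (simp add: scaleR_diff_right mult.commute)
    ultimately show ?thesis by simp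
  qed
  have J: "q (yx x) * (height v / N) = \<bar>\<rho> x ^ (CARD('d) - 1) * (\<rho> x + n \<bullet> W x)\<bar> * q (g x)" if x: "x \<in> A'" for x
  proof -
    have n1: "n \<bullet> n = 1" using nn by (simp add: norm_eq_1)
    have "\<bar>n \<bullet> (v - yx x)\<bar> = height v"
      using n0 by (intro unit_normal_to_face[OF v A'pt(3)[OF x] _ nn]) auto
    then have h: "\<bar>n \<bullet> (yx x - v)\<bar> = height v" by (metis abs_minus_commute inner_diff_right)
    have "\<rho> x + n \<bullet> W x = \<rho>' x * (n \<bullet> (yx x - v))" by (simp add: W_def inner_diff_right n1)
    moreover have "0 \<le> \<rho>' x" by (simp add: \<rho>'_def)
    ultimately have 1: "\<bar>\<rho> x ^ (CARD('d) - 1) * (\<rho> x + n \<bullet> W x)\<bar> = \<rho> x ^ (CARD('d) - 1) * \<rho>' x * height v"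
      using \<rho>(1)[OF x] h by (simp add: abs_mult)
    have 2: "q (g x) = \<rho> x ^ k * q (yx x)"
      unfolding g_def using q(2) by (simp add: homogeneous_about_def)
    have "\<rho> x ^ (CARD('d) - 1) * \<rho> x ^ k = \<rho> x ^ (N - 1)"
      unfolding power_add[symmetric] by (simp add: N_def Suc_leI)
    also have "\<dots> = sx x powr (real (N - 1) * (1 / N))"
      unfolding \<rho>_def using A'pt(1)[OF x] by (subst powr_power) auto
    finally have "\<rho> x ^ (CARD('d) - 1) * \<rho> x ^ k * \<rho>' x = (1 / N) * (sx x powr (real (N - 1) * (1 / N)) * sx x powr (1 / N - 1))"
      by (simp add: \<rho>'_def)
    also have "\<dots> = (1 / N) * sx x powr (real (N - 1) * (1 / N) + (1 / N - 1))" by (simp only: powr_add)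
    \<comment> \<open>The powers of the height cancel. This is what the root of order
      \<open>N\<close> is for: the Jacobian times the integrand depends on the foot point
      alone.\<close>
    also have "real (N - 1) * (1 / N) + (1 / N - 1) = 0" using N by (simp add: of_nat_diff field_simps)
    finally have 3: "\<rho> x ^ (CARD('d) - 1) * \<rho> x ^ k * \<rho>' x = 1 / N" using A'pt(1)[OF x] by simp
    have "\<bar>\<rho> x ^ (CARD('d) - 1) * (\<rho> x + n \<bullet> W x)\<bar> * q (g x)
        = (\<rho> x ^ (CARD('d) - 1) * \<rho> x ^ k * \<rho>' x) * height v * q (yx x)"
      unfolding 1 2 by (simp only: mult_ac)
    then show ?thesis unfolding 3 by simp
  qed
  have qK: "q absolutely_integrable_on K"
    by (intro continuous_set_integrable compact_K polyfun_continuous q)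
  then have qKv: "q absolutely_integrable_on (g ` A')"
    unfolding img by (rule set_integrable_subset) (use compact_imp_closed[OF compact_K] in auto)
  have "\<rho> x \<noteq> 0" if "x \<in> A'" for x using \<rho>(1)[OF that] by simp
  note cv = change_of_variables_rank_one[OF A'm inj nn der this J qKv]
  have "integral K q = integral (K - {v}) q"
    by (rule integral_spike_set) (auto intro: negligible_subset[OF negligible_sing[of v]])
  also have "\<dots> = integral A' (\<lambda>x. q (yx x) * (height v / N))" using cv(2) unfolding img by simp
  also have "\<dots> = integral A' (\<lambda>x. q (yx x)) * (height v / N)" by (rule integral_mult_left)
  finally have "real N * integral K q = height v * integral A' (\<lambda>x. q (yx x))" using N by simp
  also have "integral A' (\<lambda>x. q (yx x)) = integral A (\<lambda>x. q (yx x))"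
  proof (rule integral_spike_set)
    have sub: "{x \<in> A - A'. q (yx x) \<noteq> 0} \<subseteq> {x. n \<bullet> x = n \<bullet> w}"
    proof
      fix x assume x: "x \<in> {x \<in> A - A'. q (yx x) \<noteq> 0}"
      then obtain y t where "x = y + t *\<^sub>R n" "y \<in> face v" "0 \<le> t" unfolding A by auto
      then have "0 \<le> sx x" using Apt by simp
      moreover have "\<not> 0 < sx x" using x by (simp add: A'_def)
      ultimately have "sx x = 0" by simp
      then show "x \<in> {x. n \<bullet> x = n \<bullet> w}" by (simp add: sx_def inner_diff_right)
    qed
    have "n \<noteq> 0" using nn by auto
    then have "negligible {x. n \<bullet> x = n \<bullet> w}" by (intro negligible_hyperplane) blast
    then show "negligible {x \<in> A - A'. q (yx x) \<noteq> 0}" by (rule negligible_subset[OF _ sub])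
    have "{x \<in> A' - A. q (yx x) \<noteq> 0} = {}" unfolding A'_def by blast
    then show "negligible {x \<in> A' - A. q (yx x) \<noteq> 0}" by (simp only: negligible_empty)
  qed
  also have "\<dots> = face_integral (face v) q"
  proof -
    have "continuous_on A (\<lambda>x. q (yx x))"
      unfolding yx_def sx_def
      by (rule continuous_on_compose2[OF polyfun_continuous[OF q(1), of UNIV]]) (auto intro!: continuous_intros)
    from set_lebesgue_integral_eq_integral(2)[OF continuous_set_integrable[OF cA this]]
    show ?thesis unfolding fi[rule_format] yx_def sx_def by simp
  qed
  finally show ?thesis by (simp add: N_def)
qed

lemma polyfun_K_integrable: "polyfun p \<Longrightarrow> p integrable_on K" "polyfun p \<Longrightarrow> p absolutely_integrable_on K"
  using continuous_set_integrable[OF compact_K] polyfun_continuous set_lebesgue_integral_eq_integral(1) by blast+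

lemma polyfun_ray: "polyfun p \<Longrightarrow> polyfun (\<lambda>x. grad p x \<bullet> (x - v))"
proof -
  assume p: "polyfun p"
  have "polyfun (\<lambda>x. grad p x \<bullet> axis i 1 * (x $ i - v $ i))" for i
    by (intro real_polynomial_function.intros(4) polyfun_has_grad(2)[OF p] real_polynomial_function_diff
        polyfun_nth real_polynomial_function.intros(2))
  then have "polyfun (\<lambda>x. \<Sum>i\<in>UNIV. grad p x \<bullet> axis i 1 * (x $ i - v $ i))"
    by (intro real_polynomial_function_sum) auto
  then show ?thesis by (simp add: inner_vec_def[of "grad p _"] inner_axis)
qed

text \<open>The integrand is the divergence of (x - v) p. For a part homogeneous of degree
  \<open>k\<close> about \<open>v\<close>, Euler's identity turns it into (d + k) q, which is the
  case of \<open>cone_homogeneous\<close>; both sides are additive.\<close>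

lemma cone_divergence:
  assumes v: "v \<in> S" and p: "polyfun p"
  shows "integral K (\<lambda>x. real CARD('d) * p x + grad p x \<bullet> (x - v)) = height v * face_integral (face v) p"
  using polyfun_hom_sum[OF p, of v]
proof (induction rule: hom_sum.induct)
  case (base q k)
  have "integral K (\<lambda>x. real CARD('d) * q x + grad q x \<bullet> (x - v)) = integral K (\<lambda>x. real (CARD('d) + k) * q x)"
    by (intro integral_cong) (simp add: euler[OF base] distrib_right)
  then show ?case using cone_homogeneous[OF v base] by (simp only: integral_mult_right)
next
  case (add p q)
  then have pq: "polyfun p" "polyfun q" by (auto intro: hom_sum_polyfun)
  have i: "(\<lambda>x. real CARD('d) * p x + grad p x \<bullet> (x - v)) integrable_on K" if "polyfun p" for p
    by (intro polyfun_K_integrable(1) real_polynomial_function.intros(3) polyfun_scaled polyfun_ray that)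
  have "integral K (\<lambda>x. real CARD('d) * (p x + q x) + grad (\<lambda>x. p x + q x) x \<bullet> (x - v))
      = integral K (\<lambda>x. (real CARD('d) * p x + grad p x \<bullet> (x - v)) + (real CARD('d) * q x + grad q x \<bullet> (x - v)))"
    by (intro integral_cong) (simp add: grad_add[OF pq] inner_add_left algebra_simps)
  also have "\<dots> = height v * face_integral (face v) p + height v * face_integral (face v) q"
    by (subst integral_add) (use i pq add.IH in auto)
  also have "\<dots> = height v * face_integral (face v) (\<lambda>x. p x + q x)"
    by (subst face_integral_add[OF flat_face_face[OF v]])
      (use pq in \<open>auto simp: distrib_left intro: polyfun_continuous\<close>)
  finally show ?case .
qed

text \<open>The fields \<open>(x - v) p\<close>, \<open>v\<close> a vertex, have a flux through the opposite face only, and every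
  constant vector is a combination of the \<open>x - v\<close>.\<close>

theorem divergence_theorem:
  assumes p: "polyfun p"
  shows "integral K (\<lambda>x. grad p x \<bullet> e) = (\<Sum>v\<in>S. (nrm v \<bullet> e) * face_integral (face v) p)"
proof -
  let ?f = "\<lambda>v x. real CARD('d) * p x + grad p x \<bullet> (x - v)"
  have i: "?f v integrable_on K" for v
    by (intro polyfun_K_integrable(1) real_polynomial_function.intros(3) polyfun_scaled polyfun_ray p)
  \<comment> \<open>The coefficients sum to zero, which removes everything that does not depend on
    \<open>v\<close>, and they represent \<open>e\<close> as a combination of the vertices.\<close>
  have "(\<Sum>v\<in>S. - (G v \<bullet> e) * ?f v x) = grad p x \<bullet> e" for x
  proof -
    have "(\<Sum>v\<in>S. - (G v \<bullet> e) * ?f v x)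
        = (\<Sum>v\<in>S. (G v \<bullet> e) * (grad p x \<bullet> v) - (G v \<bullet> e) * (real CARD('d) * p x + grad p x \<bullet> x))"
      by (intro sum.cong refl) (simp add: inner_diff_right algebra_simps)
    also have "\<dots> = grad p x \<bullet> (\<Sum>v\<in>S. (G v \<bullet> e) *\<^sub>R v) - (\<Sum>v\<in>S. (G v \<bullet> e)) * (real CARD('d) * p x + grad p x \<bullet> x)"
      by (simp only: sum_subtractf sum_distrib_right inner_sum_right inner_scaleR_right)
    also have "\<dots> = grad p x \<bullet> e" by (simp only: G_sum mult_zero_left diff_zero)
    finally show ?thesis .
  qed
  then have "integral K (\<lambda>x. grad p x \<bullet> e) = integral K (\<lambda>x. \<Sum>v\<in>S. - (G v \<bullet> e) * ?f v x)" by simp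
  also have "\<dots> = (\<Sum>v\<in>S. integral K (\<lambda>x. - (G v \<bullet> e) * ?f v x))"
    by (intro integral_sum finite_S integrable_on_mult_right i)
  also have "\<dots> = (\<Sum>v\<in>S. - (G v \<bullet> e) * (height v * face_integral (face v) p))"
    by (intro sum.cong refl) (simp only: integral_mult_right cone_divergence[OF _ p])
  also have "\<dots> = (\<Sum>v\<in>S. (nrm v \<bullet> e) * face_integral (face v) p)"
    by (intro sum.cong refl) (simp add: nrm_def)
  finally show ?thesis .
qed

end

section \<open>The discrete trace inequality\<close>

lemma polys_upto_polyfun: assumes "p \<in> polys_upto r" shows "polyfun (p :: real^'d \<Rightarrow> real)"
proof -
  obtain c where p: "p = (\<lambda>x. \<Sum>\<alpha> | (\<Sum>i\<in>UNIV. \<alpha> i) \<le> r. c \<alpha> * (\<Prod>i\<in>UNIV. x $ i ^ \<alpha> i))"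
    using assms unfolding polys_upto_def by blast
  show ?thesis
  \<comment> \<open>The split spares a count of the exponents: over an infinite index set the sum
    would be zero, again a polynomial.\<close>
  proof (cases "finite {\<alpha> :: 'd \<Rightarrow> nat. (\<Sum>i\<in>UNIV. \<alpha> i) \<le> r}")
    case True
    then show ?thesis unfolding p
      by (intro real_polynomial_function_sum polyfun_scaled real_polynomial_function_prod
          real_polynomial_function_power polyfun_nth) auto
  next
    case False
    then show ?thesis unfolding p by (simp add: real_polynomial_function.intros(2))
  qed
qed

lemma polys_upto_ray:
  fixes p :: "real^'d \<Rightarrow> real"
  assumes "p \<in> polys_upto r"
  obtains Q :: "real poly" where "degree Q \<le> r" "\<forall>t. p (v + t *\<^sub>R (x - v)) = poly Q t"
proof -
  obtain c where p: "p = (\<lambda>x. \<Sum>\<alpha> | (\<Sum>i\<in>UNIV. \<alpha> i) \<le> r. c \<alpha> * (\<Prod>i\<in>UNIV. x $ i ^ \<alpha> i))"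
    using assms unfolding polys_upto_def by blast
  let ?A = "{\<alpha> :: 'd \<Rightarrow> nat. (\<Sum>i\<in>UNIV. \<alpha> i) \<le> r}"
  let ?m = "\<lambda>\<alpha> :: 'd \<Rightarrow> nat. \<Prod>i\<in>UNIV. [:v $ i, x $ i - v $ i:] ^ \<alpha> i"
  let ?Q = "\<Sum>\<alpha>\<in>?A. smult (c \<alpha>) (?m \<alpha>)"
  have deg: "degree (smult (c \<alpha>) (?m \<alpha>)) \<le> r" if "\<alpha> \<in> ?A" for \<alpha>
  proof -
    have "degree (?m \<alpha>) \<le> (\<Sum>i\<in>UNIV. degree ([:v $ i, x $ i - v $ i:] ^ \<alpha> i))"
      by (rule order.trans[OF degree_prod_sum_le]) auto
    also have "\<dots> \<le> (\<Sum>i\<in>UNIV. \<alpha> i)"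
    proof (rule sum_mono)
      fix i
      have "degree ([:v $ i, x $ i - v $ i:] ^ \<alpha> i) \<le> degree [:v $ i, x $ i - v $ i:] * \<alpha> i" by (rule degree_power_le)
      also have "\<dots> \<le> 1 * \<alpha> i" by (intro mult_right_mono) auto
      finally show "degree ([:v $ i, x $ i - v $ i:] ^ \<alpha> i) \<le> \<alpha> i" by simp
    qed
    also have "\<dots> \<le> r" using that by simp
    finally show ?thesis using degree_smult_le[of "c \<alpha>" "?m \<alpha>"] by linarith
  qed
  have "degree ?Q \<le> r"
  proof (cases "finite ?A")
    case True then show ?thesis using deg by (intro degree_sum_le) auto
  next
    case False then show ?thesis by simp
  qed
  moreover have "\<forall>t. p (v + t *\<^sub>R (x - v)) = poly ?Q t"
    unfolding p by (simp add: poly_sum poly_prod)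
  ultimately show thesis by (rule that)
qed

text \<open>\<open>Suc r\<close> distinct points, as many as determine a polynomial of degree
  \<open>r\<close>. They stay above one half so that a contraction by such a factor shrinks volumes
  by no more than 2^d. \<open>ray_weight\<close> holds the weights of numerical differentiation at
  \<open>1\<close> for these points.\<close>

definition ray_node :: "nat \<Rightarrow> nat \<Rightarrow> real" where
  "ray_node r j = 1/2 + real j / (2 * real (Suc r))"

definition ray_weight :: "nat \<Rightarrow> nat \<Rightarrow> real" where
  "ray_weight r j = poly (pderiv (lagrange_poly (Suc r) (ray_node r) j)) 1"

lemma ray_node: "j \<in> {1..Suc r} \<Longrightarrow> 1/2 \<le> ray_node r j \<and> ray_node r j \<le> 1"
  by (simp add: ray_node_def field_simps del: of_nat_Suc)

lemma inj_ray_node: "inj_on (ray_node r) A"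
  by (auto simp: inj_on_def ray_node_def simp del: of_nat_Suc)

text \<open>The weights depend on the degree only. This takes the place of the inverse inequality on a
  reference simplex and gives a constant that is independent of the shape.\<close>

lemma radial_derivative:
  fixes p :: "real^'d \<Rightarrow> real"
  assumes p: "p \<in> polys_upto r"
  shows "grad p x \<bullet> (x - v) = (\<Sum>j=1..Suc r. ray_weight r j * p (v + ray_node r j *\<^sub>R (x - v)))"
proof -
  obtain Q :: "real poly" where Q: "degree Q \<le> r" "\<forall>t. p (v + t *\<^sub>R (x - v)) = poly Q t"
    by (rule polys_upto_ray[OF p])
  have "((\<lambda>s. p (v + s *\<^sub>R (x - v))) has_real_derivative grad p x \<bullet> (x - v)) (at 1)"
    using has_derivative_ray[OF polys_upto_polyfun[OF p], of v x 1] by simp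
  then have "(poly Q has_real_derivative grad p x \<bullet> (x - v)) (at 1)" using Q(2) by simp
  then have "grad p x \<bullet> (x - v) = poly (pderiv Q) 1" using poly_DERIV by (rule DERIV_unique)
  moreover have "Q = (\<Sum>j=1..Suc r. smult (poly Q (ray_node r j)) (lagrange_poly (Suc r) (ray_node r) j))"
    by (rule lagrange_interpolation[OF inj_ray_node]) (use Q(1) in simp)
  then have "pderiv Q = (\<Sum>j=1..Suc r. smult (poly Q (ray_node r j)) (pderiv (lagrange_poly (Suc r) (ray_node r) j)))"
    using higher_pderiv_sum[of 1 "\<lambda>j. smult (poly Q (ray_node r j)) (lagrange_poly (Suc r) (ray_node r) j)" "{1..Suc r}"]
    by (simp add: pderiv_smult del: sum.cl_ivl_Suc)
  then have "poly (pderiv Q) 1 = (\<Sum>j=1..Suc r. poly Q (ray_node r j) * ray_weight r j)"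
    by (simp only: poly_sum poly_smult ray_weight_def)
  ultimately show ?thesis using Q(2) by (simp only: mult.commute)
qed

text \<open>d comes from the divergence of x - v, the added one from 2ab \<le> a^2 + b^2, the sum of
  squares with its factor \<open>Suc r\<close> from Cauchy-Schwarz over the ray nodes, and 2^d from
  the contractions.\<close>

definition trace_constant :: "nat \<Rightarrow> nat \<Rightarrow> real" where
  "trace_constant r d = real d + 1 + real (Suc r) * (\<Sum>j=1..Suc r. (ray_weight r j)\<^sup>2) * 2 ^ d"

lemma trace_constant_pos: "0 < trace_constant r d"
  unfolding trace_constant_def by (intro add_nonneg_pos add_pos_nonneg mult_nonneg_nonneg sum_nonneg) auto

context full_simplex
begin

text \<open>The contraction towards \<open>v\<close> maps the convex simplex into itself with
  Jacobian t^d, which is at least 2^(-d).\<close>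

lemma contraction_integral_le:
  fixes p :: "real^'d \<Rightarrow> real"
  assumes v: "v \<in> S" and p: "polyfun p" and t: "1/2 \<le> t" "t \<le> 1"
  shows "integral K (\<lambda>x. (p (v + t *\<^sub>R (x - v)))\<^sup>2) \<le> 2 ^ CARD('d) * integral K (\<lambda>x. (p x)\<^sup>2)"
proof -
  let ?g = "\<lambda>x. v + t *\<^sub>R (x - v)" and ?n = "axis undefined 1 :: real^'d" and ?h = "\<lambda>x. (p x)\<^sup>2"
  let ?I = "integral K (\<lambda>x. (p (v + t *\<^sub>R (x - v)))\<^sup>2)"
  have sub: "?g ` K \<subseteq> K"
  proof
    fix y assume "y \<in> ?g ` K"
    then obtain x where x: "x \<in> K" "y = (1 - t) *\<^sub>R v + t *\<^sub>R x" by (auto simp: algebra_simps)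
    have "v \<in> K" using v by (rule hull_inc)
    then show "y \<in> K" unfolding x(2) using t x(1) by (intro convexD[OF convex_convex_hull]) auto
  qed
  have h: "?h absolutely_integrable_on K" by (intro polyfun_K_integrable(2) real_polynomial_function_power p)
  have Km: "K \<in> sets lebesgue" using compact_imp_closed[OF compact_K] by simp
  have "compact (?g ` K)" by (intro compact_continuous_image compact_K continuous_intros)
  then have hg: "?h absolutely_integrable_on (?g ` K)"
    by (intro continuous_set_integrable polyfun_continuous real_polynomial_function_power p)
  have inj: "inj_on ?g K" using t by (auto simp: inj_on_def)
  \<comment> \<open>A pure scaling: the rank-one part is zero, so any unit vector serves as
    \<open>?n\<close>.\<close>
  have der: "(?g has_derivative (\<lambda>u. t *\<^sub>R u + (?n \<bullet> u) *\<^sub>R 0)) (at x within K)" for x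
    by (auto intro!: derivative_eq_intros)
  have J: "t ^ CARD('d) * ?h (?g x) = \<bar>t ^ (CARD('d) - 1) * (t + ?n \<bullet> 0)\<bar> * ?h (?g x)" for x
  proof -
    have "CARD('d) = Suc (CARD('d) - 1)" by simp
    then have "t ^ CARD('d) = t ^ (CARD('d) - 1) * t" by (metis power_Suc2)
    then show ?thesis using t by simp
  qed
  have t0: "t \<noteq> 0" using t by auto
  have n1: "norm ?n = 1" by (rule norm_axis_1)
  have "integral K (\<lambda>x. t ^ CARD('d) * ?h (?g x)) = integral (?g ` K) ?h"
    by (rule change_of_variables_rank_one(2)[OF Km inj n1 der t0 J hg])
  also have "\<dots> \<le> integral K ?h"
    using sub hg h by (intro integral_subset_le set_lebesgue_integral_eq_integral(1)) auto
  finally have le: "t ^ CARD('d) * ?I \<le> integral K ?h" by (simp only: integral_mult_right)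
  have "continuous_on K (\<lambda>x. (p (?g x))\<^sup>2)"
    by (intro continuous_on_power continuous_on_compose2[OF polyfun_continuous[OF p, of UNIV]] continuous_intros) auto
  then have I0: "0 \<le> ?I"
    by (intro integral_nonneg set_lebesgue_integral_eq_integral(1) continuous_set_integrable compact_K) auto
  have "(1/2) ^ CARD('d) * ?I \<le> t ^ CARD('d) * ?I" using t I0 by (intro mult_right_mono power_mono) auto
  with le have "(1/2) ^ CARD('d) * ?I \<le> integral K ?h" by linarith
  then show ?thesis by (simp add: power_one_over field_simps)
qed

text \<open>The cone formula for the square of \<open>p\<close> leaves a product of \<open>p\<close>
  with its radial derivative. The latter is a combination of values of \<open>p\<close> at points
  contracted towards \<open>v\<close>, whose squares are brought back to the whole simplex by
  \<open>contraction_integral_le\<close>.\<close>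

theorem trace_inequality:
  fixes p :: "real^'d \<Rightarrow> real"
  assumes v: "v \<in> S" and p: "p \<in> polys_upto r"
  shows "height v * face_integral (face v) (\<lambda>x. (p x)\<^sup>2) \<le> trace_constant r CARD('d) * integral K (\<lambda>x. (p x)\<^sup>2)"
proof -
  have pp: "polyfun p" by (rule polys_upto_polyfun[OF p])
  let ?t = "ray_node r" and ?w = "ray_weight r" and ?h = "\<lambda>x. (p x)\<^sup>2"
  let ?q = "\<lambda>j x. (p (v + ?t j *\<^sub>R (x - v)))\<^sup>2"
  have h: "polyfun ?h" by (intro real_polynomial_function_power pp)
  have hi: "?h integrable_on K" by (rule polyfun_K_integrable(1)[OF h])
  have qi: "?q j integrable_on K" for j
  proof -
    have "continuous_on K (?q j)"
      by (intro continuous_on_power continuous_on_compose2[OF polyfun_continuous[OF pp, of UNIV]] continuous_intros) auto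
    then show ?thesis by (rule set_lebesgue_integral_eq_integral(1)[OF continuous_set_integrable[OF compact_K]])
  qed
  have "height v * face_integral (face v) ?h = integral K (\<lambda>x. real CARD('d) * ?h x + grad ?h x \<bullet> (x - v))"
    by (rule cone_divergence[OF v h, symmetric])
  also have "\<dots> \<le> integral K (\<lambda>x. (real CARD('d) + 1) * ?h x + real (Suc r) * (\<Sum>j=1..Suc r. (?w j)\<^sup>2 * ?q j x))"
  proof (rule integral_le)
    show "(\<lambda>x. real CARD('d) * ?h x + grad ?h x \<bullet> (x - v)) integrable_on K"
      by (intro polyfun_K_integrable(1) real_polynomial_function.intros(3) polyfun_scaled polyfun_ray h)
    show "(\<lambda>x. (real CARD('d) + 1) * ?h x + real (Suc r) * (\<Sum>j=1..Suc r. (?w j)\<^sup>2 * ?q j x)) integrable_on K"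
      by (intro integrable_add integrable_on_mult_right integrable_sum hi qi finite_atLeastAtMost)
    fix x
    let ?E = "grad p x \<bullet> (x - v)"
    have "grad ?h x = (2 * p x) *\<^sub>R grad p x"
      using grad_mult[OF pp pp, of x] by (simp add: power2_eq_square scaleR_2[symmetric] flip: scaleR_left_distrib)
    then have "grad ?h x \<bullet> (x - v) = 2 * p x * ?E" by simp
    also have "\<dots> \<le> (p x)\<^sup>2 + ?E\<^sup>2" using sum_squares_bound[of "p x" ?E] by (simp add: mult_ac)
    finally have 1: "grad ?h x \<bullet> (x - v) \<le> (p x)\<^sup>2 + ?E\<^sup>2" .
    have "?E\<^sup>2 \<le> (\<Sum>j=1..Suc r. (?w j * p (v + ?t j *\<^sub>R (x - v)))\<^sup>2) * card {1..Suc r}"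
      unfolding radial_derivative[OF p, of x v] by (rule sum_squared_le_sum_of_squares)
    also have "\<dots> = real (Suc r) * (\<Sum>j=1..Suc r. (?w j)\<^sup>2 * ?q j x)"
      by (simp only: power_mult_distrib card_atLeastAtMost diff_Suc_1 mult.commute)
    finally have 2: "?E\<^sup>2 \<le> real (Suc r) * (\<Sum>j=1..Suc r. (?w j)\<^sup>2 * ?q j x)" .
    show "real CARD('d) * ?h x + grad ?h x \<bullet> (x - v)
        \<le> (real CARD('d) + 1) * ?h x + real (Suc r) * (\<Sum>j=1..Suc r. (?w j)\<^sup>2 * ?q j x)"
      using 1 2 unfolding distrib_right mult_1_left by linarith
  qed
  also have "\<dots> = (real CARD('d) + 1) * integral K ?h + real (Suc r) * (\<Sum>j=1..Suc r. (?w j)\<^sup>2 * integral K (?q j))"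
    by (subst integral_add)
      (simp_all only: integral_mult_right integral_sum integrable_on_mult_right integrable_sum hi qi finite_atLeastAtMost)
  also have "\<dots> \<le> (real CARD('d) + 1) * integral K ?h
      + real (Suc r) * (\<Sum>j=1..Suc r. (?w j)\<^sup>2 * (2 ^ CARD('d) * integral K ?h))"
    using ray_node[of _ r]
    by (intro add_left_mono mult_left_mono sum_mono contraction_integral_le[OF v pp]) auto
  also have "\<dots> = trace_constant r CARD('d) * integral K ?h"
    unfolding trace_constant_def sum_distrib_right[symmetric] by (simp only: distrib_right mult_1_left mult.assoc)
  finally show ?thesis .
qed

end

section \<open>Simplicial meshes\<close>

context full_simplex
begin

text \<open>The segment from \<open>u\<close> to \<open>x\<close> can be prolonged a little beyond
  \<open>x\<close> within the face; if \<open>lam u\<close> were not positive at \<open>x\<close>,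
  it would become negative there.\<close>

lemma rel_interior_face_lam:
  assumes v: "v \<in> S" and x: "x \<in> rel_interior (face v)" and u: "u \<in> S" "u \<noteq> v"
  shows "0 < lam u x"
proof (rule ccontr)
  assume neg: "\<not> 0 < lam u x"
  have xf: "x \<in> face v" using x rel_interior_subset by blast
  have uf: "u \<in> face v" using vertex_in_face[OF v u(1)] u(2) by simp
  have "convex (face v)" unfolding face_def by (rule convex_convex_hull)
  then have "\<forall>z\<in>affine hull face v. \<exists>e>1. (1 - e) *\<^sub>R z + e *\<^sub>R x \<in> face v"
    using x by (rule convex_rel_interior_if2)
  then obtain e where e: "e > 1" "(1 - e) *\<^sub>R u + e *\<^sub>R x \<in> face v" using hull_inc[OF uf] by blast
  have "(1 - e) *\<^sub>R u + e *\<^sub>R x = u + e *\<^sub>R (x - u)" by (simp add: algebra_simps)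
  then have "lam u ((1 - e) *\<^sub>R u + e *\<^sub>R x) = 1 + e * (lam u x - 1)"
    using u by (simp add: lam_affine lam_vertex)
  moreover have "e * (lam u x - 1) \<le> e * (-1)" using e(1) neg by (intro mult_left_mono) auto
  ultimately have "lam u ((1 - e) *\<^sub>R u + e *\<^sub>R x) < 0" using e(1) by simp
  moreover have "(1 - e) *\<^sub>R u + e *\<^sub>R x \<in> K" using e(2) face_subset[OF v] by blast
  then have "0 \<le> lam u ((1 - e) *\<^sub>R u + e *\<^sub>R x)" using u(1) unfolding K_eq by blast
  ultimately show False by linarith
qed

text \<open>Near a relative interior point of the face the other barycentric coordinates stay
  positive, so the sign of \<open>lam v\<close> alone decides membership. This local picture is what
  lets two elements at a common face be compared.\<close>

lemma half_ball:
  assumes v: "v \<in> S" and x: "x \<in> rel_interior (face v)"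
  obtains e where "e > 0" "\<forall>y\<in>ball x e. nrm v \<bullet> (y - x) \<le> 0 \<longrightarrow> y \<in> K"
proof -
  have xf: "x \<in> face v" using x rel_interior_subset by blast
  have "open (\<Inter>u\<in>S - {v}. {y. 0 < lam u y})"
    by (intro open_INT finite_Diff finite_S ballI open_Collect_less continuous_lam continuous_on_const)
  moreover have "x \<in> (\<Inter>u\<in>S - {v}. {y. 0 < lam u y})" using rel_interior_face_lam[OF v x] by auto
  ultimately obtain e where e: "e > 0" "ball x e \<subseteq> (\<Inter>u\<in>S - {v}. {y. 0 < lam u y})"
    by (rule openE)
  have "y \<in> K" if y: "y \<in> ball x e" "nrm v \<bullet> (y - x) \<le> 0" for y
  proof -
    have "0 \<le> lam v y" using y(2) height_pos[OF v] unfolding nrm_diff[OF v xf] by (simp add: zero_le_mult_iff)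
    moreover have "0 \<le> lam u y" if "u \<in> S" "u \<noteq> v" for u
    proof -
      have "y \<in> (\<Inter>u\<in>S - {v}. {y. 0 < lam u y})" using e(2) y(1) by blast
      then show ?thesis using that by (auto intro: less_imp_le)
    qed
    ultimately show ?thesis unfolding K_eq by blast
  qed
  then show thesis using that[OF e(1)] by blast
qed

text \<open>From dimension two on, a face has two distinct vertices; in dimension one it would be a
  point and the penalty weight a division by zero.\<close>

lemma diameter_face: assumes v: "v \<in> S" and d: "CARD('d) \<ge> 2" shows "0 < diameter (face v)"
proof -
  obtain a where a: "a \<in> S" "a \<noteq> v" using other_vertex by blast
  have "card S > 2" using card_S d by simp
  then have "\<not> S \<subseteq> {v, a}" using card_mono[of "{v, a}" S] a(2) by auto
  then obtain b where "b \<in> S" "b \<noteq> v" "b \<noteq> a" by blast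
  then have ab: "a \<in> S - {v}" "b \<in> S - {v}" "a \<noteq> b" using a by auto
  then have "dist a b \<le> diameter (face v)"
    using compact_face[of v] vertex_in_face[OF v] by (intro diameter_bounded_bound compact_imp_bounded) auto
  moreover have "0 < dist a b" using ab(3) by simp
  ultimately show ?thesis by linarith
qed

lemma diameter_face_le: "v \<in> S \<Longrightarrow> diameter (face v) \<le> diameter K"
  by (intro diameter_subset face_subset compact_imp_bounded compact_K)

lemma interior_nonempty: "interior K \<noteq> {}"
proof -
  have "aff_dim K = int CARD('d)"
    using aff_dim_convex_hull[of S] aff_dim_affine_independent[OF indep] card_S by simp
  then show ?thesis using interior_rel_interior_gen[of K] rel_interior_eq_empty[of K] by auto
qed

end

section \<open>Incidence of elements and faces in a conforming mesh\<close>

locale mesh =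
  fixes \<Omega> :: "(real^'d) set" and \<T> :: "(real^'d) set set" and Kp :: "(real^'d) set \<Rightarrow> (real^'d) set"
  assumes sm: "simplicial_mesh \<Omega> \<T>" and lip: "lipschitz_domain \<Omega>"
    and orient: "face_orientation \<T> Kp" and dim2: "CARD('d) \<ge> 2"
begin

lemma finite_mesh: "finite \<T>" and inter_face: "\<And>K K'. K \<in> \<T> \<Longrightarrow> K' \<in> \<T> \<Longrightarrow> (K \<inter> K') face_of K"
  and mesh_union: "\<Union>\<T> = closure \<Omega>"
  using sm by (auto simp: simplicial_mesh_def triangulation_def)

lemma element:
  assumes "K \<in> \<T>" obtains S where "full_simplex S" "K = convex hull S"
proof -
  have "int CARD('d) simplex K" using assms sm by (auto simp: simplicial_mesh_def)
  then obtain S where S: "\<not> affine_dependent S" "int (card S) = int CARD('d) + 1" "K = convex hull S"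
    unfolding simplex_def by auto
  then have "full_simplex S" by unfold_locales auto
  then show thesis using S(3) by (rule that)
qed

lemma element_facets:
  assumes "K \<in> \<T>"
  obtains S where "full_simplex S" "K = convex hull S" "{F. F facet_of K} = full_simplex.face S ` S"
proof -
  obtain S where S: "full_simplex S" "K = convex hull S" by (rule element[OF assms])
  then interpret full_simplex S by simp
  show thesis using facets S by (intro that) auto
qed

lemma element_compact: "K \<in> \<T> \<Longrightarrow> compact K"
  using element full_simplex.compact_K by metis

lemma element_convex: "K \<in> \<T> \<Longrightarrow> convex K"
  using element convex_convex_hull by metis

lemma element_interior: "K \<in> \<T> \<Longrightarrow> interior K \<noteq> {}"
  using element full_simplex.interior_nonempty by metis

lemma finite_facets: "K \<in> \<T> \<Longrightarrow> finite {F. F facet_of K}"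
  using element_facets full_simplex.finite_S by (metis finite_imageI)

lemma facet_vertex:
  assumes "K \<in> \<T>" "F facet_of K"
  obtains S v where "full_simplex S" "K = convex hull S" "v \<in> S" "F = full_simplex.face S v"
proof -
  obtain S where S: "full_simplex S" "K = convex hull S" "{F. F facet_of K} = full_simplex.face S ` S"
    by (rule element_facets[OF assms(1)])
  then have "F \<in> full_simplex.face S ` S" using assms(2) by auto
  then show thesis using S that by auto
qed

text \<open>Translates the vertex picture of a simplex into properties of a face and its normal; the
  incidence arguments below use nothing else about the shape of an element.\<close>

lemma facet_props:
  assumes "K \<in> \<T>" "F facet_of K"
  shows facet_flat: "flat_face F" and facet_diameter: "0 < diameter F"
    and facet_norm: "norm (outward_normal K F) = 1"
    and facet_sub: "F \<subseteq> K" and facet_rel_interior: "rel_interior F \<noteq> {}"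
    and facet_convex: "convex F" and facet_compact: "compact F"
    and facet_orth: "\<And>x y. x \<in> F \<Longrightarrow> y \<in> K \<Longrightarrow> outward_normal K F \<bullet> (y - x) \<le> 0"
    and facet_half_ball: "\<And>x. x \<in> rel_interior F \<Longrightarrow> \<exists>e>0. \<forall>y\<in>ball x e. outward_normal K F \<bullet> (y - x) \<le> 0 \<longrightarrow> y \<in> K"
    and facet_normal_unique: "\<And>n. norm n = 1 \<Longrightarrow> (\<And>x y. x \<in> F \<Longrightarrow> y \<in> F \<Longrightarrow> n \<bullet> (y - x) = 0) \<Longrightarrow>
      n = outward_normal K F \<or> n = - outward_normal K F"
proof -
  obtain S v where S: "full_simplex S" "K = convex hull S" and v: "v \<in> S" "F = full_simplex.face S v"
    by (rule facet_vertex[OF assms])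
  interpret full_simplex S by fact
  have F: "F = face v" by (simp add: v)
  have n: "outward_normal K F = nrm v" unfolding S(2) F by (rule outward_normal_face[OF v(1)])
  show "flat_face F" unfolding F by (rule flat_face_face[OF v(1)])
  show "0 < diameter F" unfolding F by (rule diameter_face[OF v(1) dim2])
  show "norm (outward_normal K F) = 1" unfolding n by (rule norm_nrm[OF v(1)])
  show "F \<subseteq> K" unfolding S(2) F by (rule face_subset[OF v(1)])
  show cF: "convex F" unfolding F face_def by (rule convex_convex_hull)
  show "rel_interior F \<noteq> {}" unfolding rel_interior_eq_empty[OF cF] using assms(2) by (simp add: facet_of_def)
  show "compact F" unfolding F by (rule compact_face)
  show "outward_normal K F \<bullet> (y - x) \<le> 0" if "x \<in> F" "y \<in> K" for x y
  proof -
    have "0 \<le> lam v y" using that(2) v(1) unfolding S(2) K_eq by blast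
    moreover have "x \<in> face v" using that(1) F by simp
    ultimately show ?thesis unfolding n using height_pos[OF v(1)] by (simp add: nrm_diff[OF v(1)])
  qed
  show "\<exists>e>0. \<forall>y\<in>ball x e. outward_normal K F \<bullet> (y - x) \<le> 0 \<longrightarrow> y \<in> K" if "x \<in> rel_interior F" for x
  proof -
    have "x \<in> rel_interior (face v)" using that unfolding F .
    then obtain e where e: "e > 0" "\<forall>y\<in>ball x e. nrm v \<bullet> (y - x) \<le> 0 \<longrightarrow> y \<in> convex hull S"
      by (rule half_ball[OF v(1)])
    show ?thesis unfolding n unfolding S(2) by (rule exI[of _ e]) (rule conjI[OF e])
  qed
  fix n' assume nn: "norm n' = 1" and n0: "\<And>x y. x \<in> F \<Longrightarrow> y \<in> F \<Longrightarrow> n' \<bullet> (y - x) = 0"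
  obtain w where w: "w \<in> face v" using other_vertex vertex_in_face[OF v(1)] by metis
  have n0': "n' \<bullet> (y - x) = 0" if "x \<in> face v" "y \<in> face v" for x y using n0 that F by simp
  define c where "c = n' \<bullet> (v - w)"
  have "\<bar>c\<bar> = height v" unfolding c_def by (rule unit_normal_to_face[OF v(1) w n0' nn])
  then have c: "c = height v \<or> c = - height v" by linarith
  have nc: "n' = c *\<^sub>R G v" unfolding c_def by (rule normal_to_face[OF v(1) w n0'])
  show "n' = outward_normal K F \<or> n' = - outward_normal K F"
    using c unfolding n nrm_def nc by (elim disjE) simp_all
qed

lemma facet_orth_eq:
  assumes "K \<in> \<T>" "F facet_of K" "x \<in> F" "y \<in> F"
  shows "outward_normal K F \<bullet> (y - x) = 0"
proof -
  have "outward_normal K F \<bullet> (y - x) \<le> 0" "outward_normal K F \<bullet> (x - y) \<le> 0"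
    using facet_orth[OF assms(1,2)] facet_sub[OF assms(1,2)] assms(3,4) by auto
  then show ?thesis by (simp add: inner_diff_right)
qed

text \<open>By conformity the intersection is a face of both elements, and a face that meets the
  interior is the whole element.\<close>

lemma overlap_imp_eq:
  assumes "K \<in> \<T>" "K' \<in> \<T>" "open U" "U \<noteq> {}" "U \<subseteq> K" "U \<subseteq> K'"
  shows "K = K'"
proof -
  have "U \<subseteq> interior K" "U \<subseteq> interior K'" using assms by (simp_all add: interior_maximal)
  then obtain z where z: "z \<in> interior K" "z \<in> interior K'" "z \<in> K \<inter> K'" using assms(4-6) by blast
  have "K \<inter> K' = K"
    using face_of_disjoint_interior[OF inter_face[OF assms(1,2)]] z(1,3) by blast
  moreover have "K' \<inter> K = K'"
    using face_of_disjoint_interior[OF inter_face[OF assms(2,1)]] z(2,3) by blast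
  ultimately show ?thesis by blast
qed

text \<open>At a relative interior point of \<open>F\<close> both elements contain a half ball on
  the same side, hence a common open set.\<close>

lemma same_side_imp_eq:
  assumes K: "K \<in> \<T>" "F facet_of K" and K': "K' \<in> \<T>" "F facet_of K'"
    and n: "outward_normal K F = outward_normal K' F"
  shows "K = K'"
proof -
  let ?n = "outward_normal K F"
  obtain x where x: "x \<in> rel_interior F" using facet_rel_interior[OF K] by blast
  obtain e e' where e: "e > 0" "\<forall>y\<in>ball x e. ?n \<bullet> (y - x) \<le> 0 \<longrightarrow> y \<in> K"
    and e': "e' > 0" "\<forall>y\<in>ball x e'. ?n \<bullet> (y - x) \<le> 0 \<longrightarrow> y \<in> K'"
    using facet_half_ball[OF K x] facet_half_ball[OF K' x] n by auto
  let ?U = "ball x (min e e') \<inter> {y. ?n \<bullet> (y - x) < 0}"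
  have oU: "open ?U" by (intro open_Int open_ball open_Collect_less continuous_intros)
  have "x - (min e e' / 2) *\<^sub>R ?n \<in> ?U"
  proof -
    define m where "m = min e e' / 2"
    have m: "0 < m" "m < min e e'" using e(1) e'(1) by (auto simp: m_def)
    have "?n \<bullet> ?n = 1" using facet_norm[OF K] by (simp add: norm_eq_1)
    then have "?n \<bullet> (x - m *\<^sub>R ?n - x) < 0" using m(1) by simp
    moreover have "dist x (x - m *\<^sub>R ?n) = m" using m(1) facet_norm[OF K] by (simp add: dist_norm)
    ultimately show ?thesis using m(2) unfolding m_def[symmetric] by (simp only: Int_iff mem_ball mem_Collect_eq)
  qed
  then have "?U \<noteq> {}" by blast
  moreover note oU
  moreover have "?U \<subseteq> K" "?U \<subseteq> K'" using e(2) e'(2) by auto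
  ultimately show ?thesis by (intro overlap_imp_eq[OF K(1) K'(1)])
qed

lemma opposite_normal:
  assumes K: "K \<in> \<T>" "F facet_of K" and K': "K' \<in> \<T>" "F facet_of K'" and "K \<noteq> K'"
  shows "outward_normal K' F = - outward_normal K F"
  using facet_normal_unique[OF K facet_norm[OF K'] facet_orth_eq[OF K']] same_side_imp_eq[OF K K'] assms(5) by metis

text \<open>The second and the third element both have the normal opposite to that of the
  first.\<close>

lemma at_most_two:
  assumes "K1 \<in> \<T>" "F facet_of K1" "K2 \<in> \<T>" "F facet_of K2" "K3 \<in> \<T>" "F facet_of K3" "K1 \<noteq> K2" "K1 \<noteq> K3"
  shows "K2 = K3"
  using opposite_normal[OF assms(1-4,7)] opposite_normal[OF assms(1,2,5,6,8)]
  by (intro same_side_imp_eq[OF assms(3-6)]) simp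

text \<open>This excludes slits: near a frontier point the domain lies strictly above a continuous
  graph, so there are points arbitrarily close below the graph that its closure misses.\<close>

lemma frontier_lower:
  assumes "x \<in> frontier \<Omega>" shows "x \<notin> interior (closure \<Omega>)"
proof
  assume xi: "x \<in> interior (closure \<Omega>)"
  have op: "open \<Omega>" using lip by (simp add: lipschitz_domain_def)
  have "\<exists>e \<rho> \<phi> L. norm e = 1 \<and> 0 < \<rho> \<and> L-lipschitz_on {z. z \<bullet> e = 0} \<phi> \<and>
        (\<forall>y\<in>ball x \<rho>. y \<in> \<Omega> \<longleftrightarrow> \<phi> (y - (y \<bullet> e) *\<^sub>R e) < y \<bullet> e)"
    using lip assms unfolding lipschitz_domain_def by (elim conjE) (erule bspec)
  then obtain e \<rho> \<phi> L where e: "norm e = 1" "0 < \<rho>" "L-lipschitz_on {z. z \<bullet> e = 0} \<phi>"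
    and gr: "\<forall>y\<in>ball x \<rho>. y \<in> \<Omega> \<longleftrightarrow> \<phi> (y - (y \<bullet> e) *\<^sub>R e) < y \<bullet> e"
    by (elim exE conjE)
  let ?P = "\<lambda>y. y - (y \<bullet> e) *\<^sub>R e"
  have ee: "e \<bullet> e = 1" using e(1) by (simp add: norm_eq_1)
  have "continuous_on {z. z \<bullet> e = 0} \<phi>" using e(3) by (rule lipschitz_on_continuous_on)
  then have cont: "continuous_on UNIV (\<lambda>y. \<phi> (?P y))"
    by (rule continuous_on_compose2) (auto intro!: continuous_intros simp: inner_diff_left ee)
  have "x \<notin> \<Omega>" using assms op by (simp add: frontier_def interior_open)
  moreover have "x \<in> ball x \<rho>" using e(2) by simp
  ultimately have ge: "x \<bullet> e \<le> \<phi> (?P x)" using gr by (meson not_less)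
  obtain r where r: "r > 0" "ball x r \<subseteq> closure \<Omega>" using xi by (auto simp: mem_interior)
  define s where "s = min r \<rho> / 2"
  have s: "0 < s" "s < r" "s < \<rho>" using r(1) e(2) by (auto simp: s_def)
  let ?y = "x - s *\<^sub>R e"
  \<comment> \<open>The part of the ball strictly below the graph: open, disjoint from the domain,
    and reached from \<open>x\<close> by a small move along \<open>- e\<close>.\<close>
  let ?U = "ball x \<rho> \<inter> {y. y \<bullet> e < \<phi> (?P y)}"
  have oU: "open ?U" by (intro open_Int open_ball open_Collect_less continuous_intros cont)
  have P: "?P ?y = ?P x" by (simp add: inner_diff_left ee algebra_simps)
  have "?y \<bullet> e < \<phi> (?P ?y)" unfolding P using ge s by (simp add: inner_diff_left ee)
  then have "?y \<in> ?U" using s e(1) by (simp add: dist_norm)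
  moreover have "?U \<inter> \<Omega> = {}"
  proof (rule equals0I)
    fix y assume y: "y \<in> ?U \<inter> \<Omega>"
    then have "\<phi> (?P y) < y \<bullet> e" using gr by blast
    then show False using y by simp
  qed
  then have "?U \<inter> closure \<Omega> = {}" using open_Int_closure_eq_empty[OF oU] by blast
  ultimately have "?y \<notin> closure \<Omega>" by blast
  moreover have "?y \<in> ball x r" using s e(1) by (simp add: dist_norm)
  ultimately show False using r(2) by blast
qed

lemma interior_closure: "interior (closure \<Omega>) = \<Omega>"
proof -
  have op: "open \<Omega>" using lip by (simp add: lipschitz_domain_def)
  then have "\<Omega> \<subseteq> interior (closure \<Omega>)" by (intro interior_maximal closure_subset)
  moreover have "interior (closure \<Omega>) \<subseteq> \<Omega>"
    using frontier_lower interior_subset[of "closure \<Omega>"] op by (auto simp: frontier_def interior_open)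
  ultimately show ?thesis by blast
qed

text \<open>Two elements would contribute opposite half balls at a relative interior point of
  \<open>F\<close>, and this frontier point would be interior to the closure.\<close>

lemma boundary_face_unique:
  assumes K: "K \<in> \<T>" "F facet_of K" and K': "K' \<in> \<T>" "F facet_of K'" and F: "F \<subseteq> frontier \<Omega>"
  shows "K = K'"
proof (rule ccontr)
  assume ne: "K \<noteq> K'"
  let ?n = "outward_normal K F"
  obtain x where x: "x \<in> rel_interior F" using facet_rel_interior[OF K] by blast
  obtain e e' where e: "e > 0" "\<forall>y\<in>ball x e. ?n \<bullet> (y - x) \<le> 0 \<longrightarrow> y \<in> K"
    and e': "e' > 0" "\<forall>y\<in>ball x e'. - ?n \<bullet> (y - x) \<le> 0 \<longrightarrow> y \<in> K'"
    using facet_half_ball[OF K x] facet_half_ball[OF K' x] opposite_normal[OF K K' ne] by auto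
  have "ball x (min e e') \<subseteq> K \<union> K'"
  proof
    fix y assume y: "y \<in> ball x (min e e')"
    show "y \<in> K \<union> K'"
    proof (cases "?n \<bullet> (y - x) \<le> 0")
      case True then show ?thesis using e(2) y by simp
    next
      case False then show ?thesis using e'(2) y by (simp add: inner_minus_left)
    qed
  qed
  also have "\<dots> \<subseteq> closure \<Omega>" using K(1) K'(1) mesh_union by blast
  finally have "x \<in> interior (closure \<Omega>)" using e(1) e'(1) by (intro interiorI[of "ball x (min e e')"]) auto
  moreover have "x \<in> frontier \<Omega>" using F x rel_interior_subset by blast
  ultimately show False using frontier_lower by blast
qed

lemma interior_face_neighbour:
  assumes K: "K \<in> \<T>" "F facet_of K" and F: "\<not> F \<subseteq> frontier \<Omega>"
  obtains K' where "K' \<in> \<T>" "F facet_of K'" "K' \<noteq> K"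
proof -
  let ?n = "outward_normal K F"
  have op: "open \<Omega>" using lip by (simp add: lipschitz_domain_def)
  obtain x0 where x0: "x0 \<in> F" "x0 \<notin> frontier \<Omega>" using F by blast
  then have "x0 \<in> closure \<Omega>" using facet_sub[OF K] K(1) mesh_union by blast
  then have "x0 \<in> \<Omega>" using x0(2) op by (simp add: frontier_def interior_open)
  \<comment> \<open>The relative interior is dense in \<open>F\<close> and the domain is open, so a
    point of \<open>F\<close> in the domain can be moved into the relative interior.\<close>
  moreover have "x0 \<in> closure (rel_interior F)"
    unfolding convex_closure_rel_interior[OF facet_convex[OF K]] using x0(1) closure_subset[of F] by blast
  ultimately have "\<Omega> \<inter> rel_interior F \<noteq> {}"
    unfolding open_Int_closure_eq_empty[OF op, of "rel_interior F", symmetric] by blast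
  then obtain x where x: "x \<in> rel_interior F" "x \<in> \<Omega>" by blast
  have xF: "x \<in> F" using x(1) rel_interior_subset by blast
  let ?U = "\<Union>(\<T> - {K})"
  have cU: "closed ?U" 
  proof (rule closed_Union)
    show "finite (\<T> - {K})" using finite_mesh by simp
    show "\<forall>S\<in>\<T> - {K}. closed S" using element_compact compact_imp_closed by blast
  qed
  \<comment> \<open>If \<open>K\<close> alone covered a neighbourhood of \<open>x\<close>, a step
    along its outward normal would remain in \<open>K\<close>.\<close>
  have "x \<in> ?U"
  proof (rule ccontr)
    assume "x \<notin> ?U"
    then have xd: "x \<in> \<Omega> - ?U" using x(2) by (rule DiffI[rotated])
    obtain r where r: "r > 0" "ball x r \<subseteq> \<Omega> - ?U" by (rule openE[OF open_Diff[OF op cU] xd])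
    let ?y = "x + (r / 2) *\<^sub>R ?n"
    have "?y \<in> ball x r" using r(1) facet_norm[OF K] by (simp add: dist_norm)
    then have y: "?y \<in> \<Omega> - ?U" using r(2) by (rule subsetD[rotated])
    then have "?y \<in> \<Union>\<T>" unfolding mesh_union using closure_subset[of \<Omega>] by blast
    then obtain K'' where "K'' \<in> \<T>" "?y \<in> K''" by (rule UnionE)
    moreover from calculation have "K'' = K" using y by blast
    ultimately have "?y \<in> K" by simp
    then have "?n \<bullet> (?y - x) \<le> 0" by (rule facet_orth[OF K xF])
    moreover have "?n \<bullet> ?n = 1" using facet_norm[OF K] by (simp add: norm_eq_1)
    ultimately show False using r(1) by (simp add: zero_less_mult_iff)
  qed
  then obtain K' where K': "K' \<in> \<T>" "K' \<noteq> K" "x \<in> K'" by blast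
  let ?G = "K \<inter> K'"
  have G: "?G face_of K" "?G face_of K'"
    using inter_face[OF K(1) K'(1)] inter_face[OF K'(1) K(1)] unfolding Int_commute[of K' K] .
  have xG: "x \<in> ?G" using xF facet_sub[OF K] K'(3) by blast
  \<comment> \<open>The intersection is a face by conformity. It contains \<open>F\<close> because
    it meets the relative interior of \<open>F\<close>; being a proper face of \<open>K\<close>, it
    cannot have a larger dimension than the facet \<open>F\<close>.\<close>
  have FG: "F \<subseteq> ?G" by (rule subset_of_face_of[OF G(1) facet_sub[OF K]]) (use xG x(1) in blast)
  have GK: "?G \<noteq> K"
  proof
    assume "?G = K"
    then have "interior K \<subseteq> K'" using interior_subset[of K] by blast
    then have "K = K'"
      by (rule overlap_imp_eq[OF K(1) K'(1) open_interior element_interior[OF K(1)] interior_subset])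
    then show False using K'(2) by simp
  qed
  have Fface: "F face_of ?G"
    using K(2)[unfolded facet_of_def, THEN conjunct1] FG Int_lower1 by (rule face_of_subset)
  have dims: "aff_dim K = int CARD('d)" "aff_dim K' = int CARD('d)"
    using sm K(1) K'(1) unfolding simplicial_mesh_def by (blast intro: aff_dim_simplex)+
  have lt: "aff_dim ?G < aff_dim K" by (rule face_of_aff_dim_lt[OF element_convex[OF K(1)] G(1) GK])
  have "F = ?G"
  proof (rule ccontr)
    assume "F \<noteq> ?G"
    then have "aff_dim F < aff_dim ?G"
      by (intro face_of_aff_dim_lt Fface convex_Int element_convex K(1) K'(1))
    then show False using lt K(2) by (simp add: facet_of_def)
  qed
  then have "F face_of K'" using G(2) by (rule ssubst)
  then have "F facet_of K'" using K(2) dims unfolding facet_of_def by simp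
  then show thesis by (rule that[OF K'(1) _ K'(2)])
qed

end

section \<open>Sums over faces, integrals over the domain, and traces\<close>

context mesh
begin

abbreviation "facets K \<equiv> {F. F facet_of K}"
abbreviation "interior_face F \<equiv> F \<in> interior_faces \<Omega> \<T>"
abbreviation "Km \<equiv> K_minus \<T> Kp"

lemma Kp_facet: assumes "F \<in> mesh_faces \<T>" shows "Kp F \<in> \<T>" "F facet_of Kp F"
  using orient assms unfolding face_orientation_def by blast+

lemma interior_face_elements:
  assumes F: "interior_face F"
  shows "Km F \<in> \<T>" "F facet_of Km F" "Km F \<noteq> Kp F"
    and "{K \<in> \<T>. F facet_of K} = {Kp F, Km F}"
proof -
  have Fm: "F \<in> mesh_faces \<T>" and nF: "\<not> F \<subseteq> frontier \<Omega>"
    using F unfolding interior_faces_def boundary_faces_def by blast+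
  note K = Kp_facet[OF Fm]
  obtain K' where K': "K' \<in> \<T>" "F facet_of K'" "K' \<noteq> Kp F" by (rule interior_face_neighbour[OF K nF])
  have uniq: "K'' = K'" if "K'' \<in> \<T>" "F facet_of K''" "K'' \<noteq> Kp F" for K''
    by (rule at_most_two[OF K that(1,2) K'(1,2) that(3)[symmetric] K'(3)[symmetric]])
  have km: "Km F = K'"
    unfolding K_minus_def
  proof (rule the_equality)
    show "K' \<in> \<T> \<and> F facet_of K' \<and> K' \<noteq> Kp F" using K' by blast
    show "\<And>K. K \<in> \<T> \<and> F facet_of K \<and> K \<noteq> Kp F \<Longrightarrow> K = K'" using uniq by blast
  qed
  show "Km F \<in> \<T>" "F facet_of Km F" "Km F \<noteq> Kp F"
    unfolding km by (rule K')+
  show "{K \<in> \<T>. F facet_of K} = {Kp F, Km F}"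
    unfolding km using K K' uniq by blast
qed

lemma boundary_face_elements:
  assumes "F \<in> mesh_faces \<T>" "F \<notin> interior_faces \<Omega> \<T>"
  shows "{K \<in> \<T>. F facet_of K} = {Kp F}"
proof -
  have "F \<subseteq> frontier \<Omega>" using assms unfolding interior_faces_def boundary_faces_def by blast
  then have "K = Kp F" if "K \<in> \<T>" "F facet_of K" for K
    using boundary_face_unique[OF that Kp_facet[OF assms(1)]] by blast
  then show ?thesis using Kp_facet[OF assms(1)] by blast
qed

lemma minus_normal:
  assumes F: "interior_face F"
  shows "outward_normal (Km F) F = - face_normal Kp F"
proof -
  have Fm: "F \<in> mesh_faces \<T>" using F unfolding interior_faces_def by blast
  show ?thesis unfolding face_normal_def
    by (rule opposite_normal[OF Kp_facet[OF Fm] interior_face_elements(1,2)[OF F] interior_face_elements(3)[OF F, symmetric]])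
qed

lemma finite_mesh_faces: "finite (mesh_faces \<T>)"
proof -
  have "mesh_faces \<T> = (\<Union>K\<in>\<T>. facets K)" unfolding mesh_faces_def by blast
  moreover have "finite (\<Union>K\<in>\<T>. facets K)" by (intro finite_UN_I finite_mesh finite_facets)
  ultimately show ?thesis by simp
qed

definition face_sum :: "((real^'d) set \<Rightarrow> (real^'d) set \<Rightarrow> real) \<Rightarrow> (real^'d) set \<Rightarrow> real" where
  "face_sum g F = (if interior_face F then g (Kp F) F + g (Km F) F else g (Kp F) F)"

text \<open>Regrouping by faces brings the contributions of the two neighbours together, where they
  cancel or combine into jumps.\<close>

lemma sum_over_elements:
  "(\<Sum>K\<in>\<T>. \<Sum>F\<in>facets K. g K F) = (\<Sum>F\<in>mesh_faces \<T>. face_sum g F)"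
proof -
  have "facets K = {F \<in> mesh_faces \<T>. F facet_of K}" if "K \<in> \<T>" for K
    using that unfolding mesh_faces_def by blast
  then have "(\<Sum>K\<in>\<T>. \<Sum>F\<in>facets K. g K F) = (\<Sum>K\<in>\<T>. \<Sum>F\<in>{F \<in> mesh_faces \<T>. F facet_of K}. g K F)"
    by (intro sum.cong refl) blast
  also have "\<dots> = (\<Sum>F\<in>mesh_faces \<T>. \<Sum>K\<in>{K \<in> \<T>. F facet_of K}. g K F)"
    by (rule sum.swap_restrict[OF finite_mesh finite_mesh_faces])
  also have "\<dots> = (\<Sum>F\<in>mesh_faces \<T>. face_sum g F)"
  proof (rule sum.cong[OF refl])
    fix F assume F: "F \<in> mesh_faces \<T>"
    show "(\<Sum>K\<in>{K \<in> \<T>. F facet_of K}. g K F) = face_sum g F"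
    proof (cases "interior_face F")
      case True
      show ?thesis unfolding interior_face_elements(4)[OF True]
        using True interior_face_elements(3)[OF True] by (simp add: face_sum_def)
    next
      case False
      show ?thesis unfolding boundary_face_elements[OF F False] using False by (simp add: face_sum_def)
    qed
  qed
  finally show ?thesis .
qed

lemma sum_over_elements_interior:
  "(\<Sum>K\<in>\<T>. \<Sum>F\<in>facets K - boundary_faces \<Omega> \<T>. g K F)
    = (\<Sum>K\<in>\<T>. \<Sum>F\<in>facets K. if interior_face F then g K F else 0)"
proof (rule sum.cong[OF refl])
  fix K assume K: "K \<in> \<T>"
  have "interior_face F \<longleftrightarrow> F \<notin> boundary_faces \<Omega> \<T>" if "F facet_of K" for F
    using that K unfolding interior_faces_def mesh_faces_def by blast
  then show "(\<Sum>F\<in>facets K - boundary_faces \<Omega> \<T>. g K F)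
      = (\<Sum>F\<in>facets K. if interior_face F then g K F else 0)"
    by (intro sum.mono_neutral_cong_left finite_facets[OF K]) auto
qed

lemma
  assumes eq: "\<forall>K\<in>\<T>. \<forall>F. F facet_of K \<longrightarrow> (\<forall>x\<in>F. g K F x = h K F x)"
  shows sum_element_boundaries_eq: "sum_element_boundaries \<T> g
      = (\<Sum>K\<in>\<T>. \<Sum>F\<in>facets K. face_integral F (h K F))"
    and sum_interior_element_boundaries_eq: "sum_interior_element_boundaries \<Omega> \<T> g
      = (\<Sum>K\<in>\<T>. \<Sum>F\<in>facets K. if interior_face F then face_integral F (h K F) else 0)"
proof -
  have "face_integral F (g K F) = face_integral F (h K F)" if "K \<in> \<T>" "F \<in> facets K" for K F
    using that eq by (intro face_integral_cong facet_flat[of K]) auto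
  then show "sum_element_boundaries \<T> g = (\<Sum>K\<in>\<T>. \<Sum>F\<in>facets K. face_integral F (h K F))"
    "sum_interior_element_boundaries \<Omega> \<T> g
      = (\<Sum>K\<in>\<T>. \<Sum>F\<in>facets K. if interior_face F then face_integral F (h K F) else 0)"
    unfolding sum_element_boundaries_def sum_interior_element_boundaries_def sum_over_elements_interior
    by (intro sum.cong refl if_cong; blast)+
qed

lemma element_frontier: "K \<in> \<T> \<Longrightarrow> K - interior K \<subseteq> frontier K" 
  unfolding frontier_def using closure_subset by blast

lemma negligible_skeleton: "negligible (\<Union>K\<in>\<T>. frontier K)"
  by (intro negligible_Union finite_imageI finite_mesh) (auto intro: negligible_convex_frontier element_convex)

lemma interiors_subset: "(\<Union>K\<in>\<T>. interior K) \<subseteq> \<Omega>"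
proof
  fix x assume "x \<in> (\<Union>K\<in>\<T>. interior K)"
  then obtain K where K: "K \<in> \<T>" "x \<in> interior K" by blast
  then have "K \<subseteq> closure \<Omega>" using mesh_union by blast
  from interior_mono[OF this] show "x \<in> \<Omega>" using K(2) interior_closure by blast
qed

text \<open>The domain and the union of the element interiors differ by part of the skeleton, a null
  set, so the values that a representative takes there do not count. The interiors lie inside the
  domain because it is the interior of its closure.\<close>

lemma integral_Omega:
  fixes h :: "real^'d \<Rightarrow> real"
  assumes cont: "\<And>K. K \<in> \<T> \<Longrightarrow> continuous_on K (hK K)"
    and eq: "\<And>K x. K \<in> \<T> \<Longrightarrow> x \<in> interior K \<Longrightarrow> h x = hK K x"
  shows "set_integrable lebesgue \<Omega> h"
    and "(LINT x:\<Omega>|lebesgue. h x) = (\<Sum>K\<in>\<T>. integral K (hK K))"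
proof -
  let ?W = "\<Union>K\<in>\<T>. interior K"
  have i: "set_integrable lebesgue (interior K) h" and ie: "integral (interior K) h = integral K (hK K)" if K: "K \<in> \<T>" for K
  proof -
    have hK: "set_integrable lebesgue K (hK K)"
      by (rule continuous_set_integrable[OF element_compact[OF K] cont[OF K]])
    have "set_integrable lebesgue (interior K) (hK K)"
      by (rule set_integrable_subset[OF hK]) (simp_all add: interior_subset)
    moreover have "set_integrable lebesgue (interior K) h = set_integrable lebesgue (interior K) (hK K)"
      by (rule set_integrable_cong[OF refl refl]) (rule eq[OF K])
    ultimately show "set_integrable lebesgue (interior K) h" by simp
    have n: "negligible (K - interior K)"
      by (rule negligible_subset[OF negligible_convex_frontier[OF element_convex[OF K]] element_frontier[OF K]])
    have "integral (interior K) h = integral (interior K) (hK K)" by (intro integral_cong eq K)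
    also have "\<dots> = integral K (hK K)"
    proof (rule integral_spike_set)
      have "{x \<in> interior K - K. hK K x \<noteq> 0} = {}" using interior_subset[of K] by blast
      then show "negligible {x \<in> interior K - K. hK K x \<noteq> 0}" by (simp only: negligible_empty)
      show "negligible {x \<in> K - interior K. hK K x \<noteq> 0}" by (rule negligible_subset[OF n]) blast
    qed
    finally show "integral (interior K) h = integral K (hK K)" .
  qed
  have disj: "interior K \<inter> interior K' = {}" if "K \<in> \<T>" "K' \<in> \<T>" "K \<noteq> K'" for K K'
  proof (rule ccontr)
    assume ne: "interior K \<inter> interior K' \<noteq> {}"
    have sub: "interior K \<inter> interior K' \<subseteq> K" "interior K \<inter> interior K' \<subseteq> K'"
      using interior_subset[of K] interior_subset[of K'] by blast+
    have "K = K'" by (rule overlap_imp_eq[OF that(1,2) open_Int[OF open_interior open_interior] ne sub])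
    then show False using that(3) by simp
  qed
  have iW: "set_integrable lebesgue ?W h" by (intro set_integrable_UN finite_mesh i) auto
  have "(h has_integral (\<Sum>K\<in>\<T>. integral (interior K) h)) ?W"
  proof (rule has_integral_UN[OF finite_mesh])
    show "(h has_integral integral (interior K) h) (interior K)" if "K \<in> \<T>" for K
      using set_lebesgue_integral_eq_integral(1)[OF i[OF that]] by (rule integrable_integral)
    show "pairwise (\<lambda>i i'. negligible (interior i \<inter> interior i')) \<T>"
      by (rule pairwiseI) (simp add: disj)
  qed
  then have W: "integral ?W h = (\<Sum>K\<in>\<T>. integral K (hK K))"
    using ie by (simp add: integral_unique)
  have "\<Omega> - ?W \<subseteq> (\<Union>K\<in>\<T>. frontier K)"
  proof
    fix x assume x: "x \<in> \<Omega> - ?W"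
    then have "x \<in> \<Union>\<T>" unfolding mesh_union using closure_subset by blast
    then obtain K where "K \<in> \<T>" "x \<in> K" by (rule UnionE)
    then show "x \<in> (\<Union>K\<in>\<T>. frontier K)" using x element_frontier by blast
  qed
  then have n: "negligible (\<Omega> - ?W)" by (rule negligible_subset[OF negligible_skeleton])
  have n1: "negligible {x \<in> \<Omega> - ?W. h x \<noteq> 0}" by (rule negligible_subset[OF n]) blast
  have "{x \<in> ?W - \<Omega>. h x \<noteq> 0} = {}" using interiors_subset by blast
  then have n2: "negligible {x \<in> ?W - \<Omega>. h x \<noteq> 0}" by (simp only: negligible_empty)
  show *: "set_integrable lebesgue \<Omega> h" by (rule absolutely_integrable_spike_set[OF iW n2 n1])
  have "(LINT x:\<Omega>|lebesgue. h x) = integral \<Omega> h" by (rule set_lebesgue_integral_eq_integral(2)[OF *])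
  also have "\<dots> = integral ?W h" by (rule integral_spike_set[OF n1 n2])
  finally show "(LINT x:\<Omega>|lebesgue. h x) = (\<Sum>K\<in>\<T>. integral K (hK K))" unfolding W .
qed

lemma polyfun_integrable: "K \<in> \<T> \<Longrightarrow> polyfun f \<Longrightarrow> f integrable_on K"
  by (intro set_lebesgue_integral_eq_integral(1) continuous_set_integrable element_compact polyfun_continuous)

text \<open>Every point of a convex element with interior is a limit point of that interior, so the
  limit is unique and is the value of the continuous extension.\<close>

lemma face_trace_eq:
  fixes v :: "real^'d \<Rightarrow> 'b::real_normed_vector"
  assumes K: "K \<in> \<T>" and x: "x \<in> K" and eq: "\<And>y. y \<in> interior K \<Longrightarrow> v y = p y" and p: "continuous_on UNIV p"
  shows "face_trace K v x = p x"
  unfolding face_trace_def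
proof (rule tendsto_Lim)
  have "closure (interior K) = closure K"
    by (rule convex_closure_interior[OF element_convex[OF K] element_interior[OF K]])
  then have xc: "x \<in> closure (interior K)" using x closure_subset by blast
  have "x islimpt interior K"
  proof (cases "x \<in> interior K")
    case True
    then show ?thesis using interior_limit_point[of x "interior K"] by simp
  next
    case False
    then show ?thesis using xc unfolding closure_def by blast
  qed
  then show "at x within interior K \<noteq> bot" by (simp add: trivial_limit_within)
  have "(p \<longlongrightarrow> p x) (at x within interior K)"
    using p by (meson UNIV_I continuous_on_def subset_UNIV tendsto_within_subset)
  then show "(v \<longlongrightarrow> p x) (at x within interior K)"
    by (rule Lim_transform_eventually) (auto simp: eventually_at_filter eq)
qed

lemma divergence_element:
  assumes K: "K \<in> \<T>" and p: "polyfun p"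
  shows "integral K (\<lambda>x. grad p x \<bullet> e) = (\<Sum>F\<in>facets K. (outward_normal K F \<bullet> e) * face_integral F p)"
proof -
  obtain S where S: "full_simplex S" "K = convex hull S" by (rule element[OF K])
  interpret full_simplex S by fact
  show ?thesis unfolding S(2) divergence_theorem[OF p] facets
    by (subst sum.reindex[OF inj_face]) (simp add: outward_normal_face)
qed

lemma card_facets: assumes K: "K \<in> \<T>" shows "card (facets K) = Suc CARD('d)"
proof -
  obtain S where S: "full_simplex S" "K = convex hull S" by (rule element[OF K])
  interpret full_simplex S by fact
  show ?thesis unfolding S(2) facets using card_image[OF inj_face] card_S by simp
qed

text \<open>The one place where shape regularity is used: the diameter of a face is at most that of
  \<open>K\<close>, hence at most \<sigma> times the inball diameter, which the height
  bounds.\<close>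

lemma trace_element:
  assumes K: "K \<in> \<T>" and F: "F facet_of K" and p: "p \<in> polys_upto r"
    and \<sigma>: "0 \<le> \<sigma>" "diameter K \<le> \<sigma> * inball_diameter K"
  shows "diameter F * face_integral F (\<lambda>x. (p x)\<^sup>2) \<le> \<sigma> * trace_constant r CARD('d) * integral K (\<lambda>x. (p x)\<^sup>2)"
proof -
  obtain S v where S: "full_simplex S" "K = convex hull S" and v: "v \<in> S" "F = full_simplex.face S v"
    by (rule facet_vertex[OF K F])
  interpret full_simplex S by fact
  let ?I = "face_integral (face v) (\<lambda>x. (p x)\<^sup>2)"
  have "0 \<le> ?I"
    by (intro face_integral_nonneg flat_face_face v(1) polyfun_continuous real_polynomial_function_power
        polys_upto_polyfun[OF p]) simp
  moreover have "diameter (face v) \<le> \<sigma> * height v"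
  proof -
    have "diameter (face v) \<le> diameter K" unfolding S(2) by (rule diameter_face_le[OF v(1)])
    also have "\<dots> \<le> \<sigma> * inball_diameter K" by (rule \<sigma>(2))
    also have "\<dots> \<le> \<sigma> * height v" unfolding S(2) using \<sigma>(1) inball_le_height[OF v(1)] by (rule mult_left_mono[rotated])
    finally show ?thesis .
  qed
  ultimately have "diameter (face v) * ?I \<le> \<sigma> * height v * ?I" by (rule mult_right_mono[rotated])
  also have "\<dots> = \<sigma> * (height v * ?I)" by simp
  also have "\<dots> \<le> \<sigma> * (trace_constant r CARD('d) * integral (convex hull S) (\<lambda>x. (p x)\<^sup>2))"
    by (rule mult_left_mono[OF trace_inequality[OF v(1) p] \<sigma>(1)])
  finally show ?thesis unfolding S(2) v(2) by (simp only: mult.assoc)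
qed

end

section \<open>Broken polynomial fields\<close>

locale broken_field = mesh \<Omega> \<T> Kp for \<Omega> :: "(real^'d) set" and \<T> Kp +
  fixes r :: nat and w :: "real^'d \<Rightarrow> real^'d"
  assumes w: "w \<in> broken_vector_polys \<Omega> \<T> r"
begin

definition pol :: "(real^'d) set \<Rightarrow> 'd \<Rightarrow> real^'d \<Rightarrow> real" where
  "pol K i = (SOME p. p \<in> polys_upto r \<and> (\<forall>x\<in>interior K. w x $ i = p x))"

definition pv :: "(real^'d) set \<Rightarrow> real^'d \<Rightarrow> real^'d" where
  "pv K x = (\<chi> i. pol K i x)"

lemma pol: assumes "K \<in> \<T>" shows "pol K i \<in> polys_upto r" "x \<in> interior K \<Longrightarrow> w x $ i = pol K i x"
proof -
  have "\<exists>p. p \<in> polys_upto r \<and> (\<forall>x\<in>interior K. w x $ i = p x)"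
    using w assms unfolding broken_vector_polys_def by blast
  from someI_ex[OF this] show "pol K i \<in> polys_upto r" "x \<in> interior K \<Longrightarrow> w x $ i = pol K i x"
    unfolding pol_def by blast+
qed

lemma pol_polyfun: "K \<in> \<T> \<Longrightarrow> polyfun (pol K i)"
  by (rule polys_upto_polyfun[OF pol(1)])

lemma w_eq: "K \<in> \<T> \<Longrightarrow> x \<in> interior K \<Longrightarrow> w x = pv K x"
  unfolding pv_def by (simp add: vec_eq_iff pol)

lemma pv_continuous: "K \<in> \<T> \<Longrightarrow> continuous_on A (pv K)"
  unfolding pv_def[abs_def] by (intro continuous_on_vec_lambda polyfun_continuous pol_polyfun)

lemma trace_w: "K \<in> \<T> \<Longrightarrow> x \<in> K \<Longrightarrow> face_trace K w x = pv K x"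
  by (rule face_trace_eq[OF _ _ w_eq pv_continuous])

lemma trace_w_square: "K \<in> \<T> \<Longrightarrow> x \<in> K \<Longrightarrow> face_trace K (\<lambda>y. w y \<bullet> w y) x = pv K x \<bullet> pv K x"
  by (rule face_trace_eq[where p = "\<lambda>x. pv K x \<bullet> pv K x"])
    (auto simp: w_eq intro!: continuous_on_inner pv_continuous)

lemma gradient_w:
  assumes K: "K \<in> \<T>" and x: "x \<in> interior K"
  shows "gradient w x $ i $ j = grad (pol K i) x \<bullet> axis j 1"
proof -
  have "(pv K has_derivative (\<lambda>h. \<chi> i. grad (pol K i) x \<bullet> h)) (at x)"
    unfolding pv_def[abs_def]
    by (subst has_derivative_componentwise_within)
      (simp add: Basis_cart inner_axis polyfun_has_grad(1)[OF pol_polyfun[OF K]])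
  then have "(w has_derivative (\<lambda>h. \<chi> i. grad (pol K i) x \<bullet> h)) (at x)"
    by (rule has_derivative_transform_within_open[OF _ open_interior x]) (simp add: w_eq[OF K])
  note fd = frechet_derivative_at[OF this, symmetric]
  show ?thesis unfolding gradient_def jacobian_def matrix_def fd by simp
qed

lemma divergence_w:
  assumes "K \<in> \<T>" "x \<in> interior K"
  shows "divergence w x = (\<Sum>j\<in>UNIV. grad (pol K j) x \<bullet> axis j 1)"
  unfolding divergence_def trace_def by (simp add: gradient_w[OF assms])

end

lemma polyfun_grad_sum:
  assumes "finite I" "\<And>i. i \<in> I \<Longrightarrow> polyfun (f i :: real^'d \<Rightarrow> real)"
  shows "grad (\<lambda>x. \<Sum>i\<in>I. f i x) x = (\<Sum>i\<in>I. grad (f i) x)"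
proof (rule grad_eqI)
  have "((\<lambda>x. \<Sum>i\<in>I. f i x) has_derivative (\<lambda>h. \<Sum>i\<in>I. grad (f i) x \<bullet> h)) (at x)"
    by (intro has_derivative_sum polyfun_has_grad(1) assms(2))
  moreover have eq: "(\<bullet>) (\<Sum>i\<in>I. grad (f i) x) = (\<lambda>h. \<Sum>i\<in>I. grad (f i) x \<bullet> h)"
    by (rule ext) (rule inner_sum_left)
  ultimately show "((\<lambda>x. \<Sum>i\<in>I. f i x) has_derivative (\<bullet>) (\<Sum>i\<in>I. grad (f i) x)) (at x)"
    by (simp only:)
qed

lemma face_integral_sum:
  fixes F :: "(real^'d) set"
  assumes F: "flat_face F" and "finite I" and g: "\<And>i. i \<in> I \<Longrightarrow> continuous_on F (g i)"
  shows "face_integral F (\<lambda>x. \<Sum>i\<in>I. g i x) = (\<Sum>i\<in>I. face_integral F (g i))"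
  using assms(2) g
proof (induction I rule: finite_induct)
  case empty
  show ?case using face_integral_mult[OF F, of 0] by simp
next
  case (insert i I)
  have "face_integral F (\<lambda>x. g i x + (\<Sum>i\<in>I. g i x)) = face_integral F (g i) + face_integral F (\<lambda>x. \<Sum>i\<in>I. g i x)"
    by (rule face_integral_add[OF F]) (auto intro!: insert.prems continuous_on_sum)
  then show ?case using insert by simp
qed

lemma outer_mult_vec: "(a \<otimes>\<^sub>v b) *v c = (b \<bullet> c) *\<^sub>R a"
  by (simp add: outer_def vec_eq_iff matrix_vector_mult_def inner_vec_def sum_distrib_left sum_distrib_right mult_ac)

lemma outer_diff_left: "(a - b) \<otimes>\<^sub>v c = a \<otimes>\<^sub>v c - b \<otimes>\<^sub>v c"
  by (simp add: outer_def vec_eq_iff left_diff_distrib)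

lemma scaleR_mult_vec: "(c *\<^sub>R A) *v x = c *\<^sub>R (A *v (x :: real^'n))"
  by (simp add: vec_eq_iff matrix_vector_mult_def sum_distrib_left mult_ac)

section \<open>Sign of the convective form\<close>

context broken_field
begin

definition jmp :: "(real^'d) set \<Rightarrow> real^'d \<Rightarrow> real^'d" where
  "jmp F x = (if interior_face F then pv (Kp F) x - pv (Km F) x else pv (Kp F) x)"

definition avg :: "(real^'d) set \<Rightarrow> real^'d \<Rightarrow> real^'d" where
  "avg F x = (if interior_face F then (1/2) *\<^sub>R (pv (Kp F) x + pv (Km F) x) else pv (Kp F) x)"

lemma face_trace_values:
  assumes F: "F \<in> mesh_faces \<T>" and x: "x \<in> F"
  shows "jump \<Omega> \<T> Kp F w x = jmp F x" "average \<Omega> \<T> Kp F w x = avg F x"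
    "jump_normal \<Omega> \<T> Kp F w x = jmp F x \<otimes>\<^sub>v face_normal Kp F"
proof -
  have p: "face_trace (Kp F) w x = pv (Kp F) x"
    using facet_sub[OF Kp_facet[OF F]] x by (intro trace_w Kp_facet[OF F]) blast
  have m: "face_trace (Km F) w x = pv (Km F) x" if i: "interior_face F"
    using facet_sub[OF interior_face_elements(1,2)[OF i]] x by (intro trace_w interior_face_elements(1)[OF i]) blast
  show "jump \<Omega> \<T> Kp F w x = jmp F x" "average \<Omega> \<T> Kp F w x = avg F x"
    "jump_normal \<Omega> \<T> Kp F w x = jmp F x \<otimes>\<^sub>v face_normal Kp F"
    using p m unfolding jump_def average_def jump_normal_def jmp_def avg_def by (simp_all add: outer_diff_left)
qed

lemma avg_jmp_continuous:
  assumes F: "F \<in> mesh_faces \<T>"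
  shows "continuous_on A (avg F)" "continuous_on A (jmp F)"
proof -
  have p: "continuous_on A (pv (Kp F))" by (rule pv_continuous[OF Kp_facet(1)[OF F]])
  show "continuous_on A (avg F)"
  proof (cases "interior_face F")
    case True
    then show ?thesis unfolding avg_def[abs_def]
      using p pv_continuous[OF interior_face_elements(1)[OF True], of A] by (simp add: continuous_on_add continuous_on_scaleR)
  qed (use p in \<open>simp add: avg_def[abs_def]\<close>)
  show "continuous_on A (jmp F)"
  proof (cases "interior_face F")
    case True
    then show ?thesis unfolding jmp_def[abs_def]
      using p pv_continuous[OF interior_face_elements(1)[OF True], of A] by (simp add: continuous_on_diff)
  qed (use p in \<open>simp add: jmp_def[abs_def]\<close>)
qed

definition sq :: "(real^'d) set \<Rightarrow> real^'d \<Rightarrow> real" where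
  "sq K x = (\<Sum>i\<in>UNIV. pol K i x * pol K i x)"

lemma pv_inner: "pv K x \<bullet> pv K x = sq K x"
  by (simp add: sq_def pv_def inner_vec_def)

lemma sq_polyfun: "K \<in> \<T> \<Longrightarrow> polyfun (sq K)"
  unfolding sq_def[abs_def] by (intro real_polynomial_function_sum finite_class.finite_UNIV real_polynomial_function.intros(4) pol_polyfun)

definition avgs :: "(real^'d) set \<Rightarrow> real^'d \<Rightarrow> real" where
  "avgs F x = (if interior_face F then (1/2) * (sq (Kp F) x + sq (Km F) x) else sq (Kp F) x)"

lemma average_square:
  assumes F: "F \<in> mesh_faces \<T>" and x: "x \<in> F"
  shows "average \<Omega> \<T> Kp F (\<lambda>y. w y \<bullet> w y) x = avgs F x"
proof -
  have p: "face_trace (Kp F) (\<lambda>y. w y \<bullet> w y) x = sq (Kp F) x"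
    unfolding pv_inner[symmetric] using facet_sub[OF Kp_facet[OF F]] x by (intro trace_w_square Kp_facet[OF F]) blast
  have m: "face_trace (Km F) (\<lambda>y. w y \<bullet> w y) x = sq (Km F) x" if i: "interior_face F"
    unfolding pv_inner[symmetric]
    using facet_sub[OF interior_face_elements(1,2)[OF i]] x by (intro trace_w_square interior_face_elements(1)[OF i]) blast
  show ?thesis using p m unfolding average_def avgs_def by simp
qed

lemma avgs_continuous:
  assumes F: "F \<in> mesh_faces \<T>"
  shows "continuous_on A (avgs F)"
proof -
  have p: "continuous_on A (sq (Kp F))" by (rule polyfun_continuous[OF sq_polyfun[OF Kp_facet(1)[OF F]]])
  show ?thesis
  proof (cases "interior_face F")
    case True
    have "continuous_on A (sq (Km F))"
      by (rule polyfun_continuous[OF sq_polyfun[OF interior_face_elements(1)[OF True]]])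
    then have "continuous_on A (\<lambda>x. (1/2) * (sq (Kp F) x + sq (Km F) x))"
      using p by (intro continuous_on_mult continuous_on_add continuous_on_const)
    then show ?thesis unfolding avgs_def[abs_def] using True by simp
  qed (use p in \<open>simp add: avgs_def[abs_def]\<close>)
qed

lemma facet_mesh_face: "K \<in> \<T> \<Longrightarrow> F facet_of K \<Longrightarrow> F \<in> mesh_faces \<T>"
  unfolding mesh_faces_def by blast

lemma facet_trace: "K \<in> \<T> \<Longrightarrow> F facet_of K \<Longrightarrow> x \<in> F \<Longrightarrow> face_trace K w x = pv K x"
  using facet_sub by (intro trace_w) blast+

text \<open>On an element the divergence of |w|^2 w is twice the first integrand plus the second, so
  the volume terms are minus one half of its flux.\<close>

lemma convection_volume:
  "- L2_inner \<Omega> (\<lambda>x. w x \<otimes>\<^sub>v w x) (gradient w) - 1/2 * L2_inner \<Omega> (\<lambda>x. divergence w x *\<^sub>R w x) w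
    = (\<Sum>K\<in>\<T>. \<Sum>F\<in>facets K. - 1/2 * face_integral F (\<lambda>x. (pv K x \<bullet> outward_normal K F) * sq K x))"
proof -
  let ?D = "\<lambda>K i j x. grad (pol K i) x \<bullet> axis j 1"
  let ?h1 = "\<lambda>K x. \<Sum>i\<in>UNIV. \<Sum>j\<in>UNIV. pol K i x * pol K j x * ?D K i j x"
  let ?h2 = "\<lambda>K x. (\<Sum>j\<in>UNIV. ?D K j j x) * sq K x"
  have pD: "polyfun (?D K i j)" if "K \<in> \<T>" for K i j by (rule polyfun_has_grad(2)[OF pol_polyfun[OF that]])
  have p1: "polyfun (?h1 K)" if "K \<in> \<T>" for K
    by (intro real_polynomial_function_sum finite_class.finite_UNIV real_polynomial_function.intros(4) pol_polyfun pD that)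
  have p2: "polyfun (?h2 K)" if "K \<in> \<T>" for K
    by (intro real_polynomial_function_sum finite_class.finite_UNIV real_polynomial_function.intros(4) sq_polyfun pD that)
  have i1: "L2_inner \<Omega> (\<lambda>x. w x \<otimes>\<^sub>v w x) (gradient w) = (\<Sum>K\<in>\<T>. integral K (?h1 K))"
    unfolding L2_inner_def
  proof (rule integral_Omega(2))
    show "continuous_on K (?h1 K)" if "K \<in> \<T>" for K by (rule polyfun_continuous[OF p1[OF that]])
    fix K x assume K: "K \<in> \<T>" "x \<in> interior K"
    show "(w x \<otimes>\<^sub>v w x) \<bullet> gradient w x = ?h1 K x"
      unfolding inner_vec_def[of "w x \<otimes>\<^sub>v w x"] inner_vec_def[of "(w x \<otimes>\<^sub>v w x) $ _"]
      by (simp add: outer_def gradient_w[OF K] pol(2)[OF K])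
  qed
  have i2: "L2_inner \<Omega> (\<lambda>x. divergence w x *\<^sub>R w x) w = (\<Sum>K\<in>\<T>. integral K (?h2 K))"
    unfolding L2_inner_def
  proof (rule integral_Omega(2))
    show "continuous_on K (?h2 K)" if "K \<in> \<T>" for K by (rule polyfun_continuous[OF p2[OF that]])
    fix K x assume K: "K \<in> \<T>" "x \<in> interior K"
    show "(divergence w x *\<^sub>R w x) \<bullet> w x = ?h2 K x"
      by (simp add: divergence_w[OF K] w_eq[OF K] pv_inner)
  qed
  have el: "- integral K (?h1 K) - 1/2 * integral K (?h2 K)
      = (\<Sum>F\<in>facets K. - 1/2 * face_integral F (\<lambda>x. (pv K x \<bullet> outward_normal K F) * sq K x))"
    if K: "K \<in> \<T>" for K
  proof -
    let ?n = "\<lambda>F. outward_normal K F"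
    have pq: "polyfun (\<lambda>x. pol K j x * sq K x)" for j
      by (intro real_polynomial_function.intros(4) pol_polyfun sq_polyfun K)
    have gs: "grad (sq K) x = (\<Sum>i\<in>UNIV. (2 * pol K i x) *\<^sub>R grad (pol K i) x)" for x
      unfolding sq_def[abs_def]
    proof (subst polyfun_grad_sum)
      show "(\<Sum>i\<in>UNIV. grad (\<lambda>x. pol K i x * pol K i x) x) = (\<Sum>i\<in>UNIV. (2 * pol K i x) *\<^sub>R grad (pol K i) x)"
        by (intro sum.cong refl) (simp only: grad_mult[OF pol_polyfun[OF K] pol_polyfun[OF K]] scaleR_left_distrib[symmetric] mult_2)
    qed (auto intro!: real_polynomial_function.intros(4) pol_polyfun K)
    have "(\<Sum>j\<in>UNIV. grad (\<lambda>x. pol K j x * sq K x) x \<bullet> axis j 1) = 2 * ?h1 K x + ?h2 K x" for x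
    proof -
      have "grad (\<lambda>x. pol K j x * sq K x) x \<bullet> axis j 1
          = 2 * (\<Sum>i\<in>UNIV. pol K i x * pol K j x * ?D K i j x) + ?D K j j x * sq K x" for j
        unfolding grad_mult[OF pol_polyfun[OF K] sq_polyfun[OF K]] gs
        by (simp add: inner_add_left inner_sum_left sum_distrib_left mult_ac)
      then have "(\<Sum>j\<in>UNIV. grad (\<lambda>x. pol K j x * sq K x) x \<bullet> axis j 1)
          = (\<Sum>j\<in>UNIV. 2 * (\<Sum>i\<in>UNIV. pol K i x * pol K j x * ?D K i j x)) + (\<Sum>j\<in>UNIV. ?D K j j x * sq K x)"
        by (simp only: sum.distrib)
      also have "(\<Sum>j\<in>UNIV. 2 * (\<Sum>i\<in>UNIV. pol K i x * pol K j x * ?D K i j x)) = 2 * ?h1 K x"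
        unfolding sum_distrib_left[symmetric] by (subst sum.swap) (rule refl)
      also have "(\<Sum>j\<in>UNIV. ?D K j j x * sq K x) = ?h2 K x" by (simp only: sum_distrib_right)
      finally show ?thesis .
    qed
    then have "integral K (\<lambda>x. 2 * ?h1 K x + ?h2 K x) = integral K (\<lambda>x. \<Sum>j\<in>UNIV. grad (\<lambda>x. pol K j x * sq K x) x \<bullet> axis j 1)"
      by (simp only:)
    also have "\<dots> = (\<Sum>j\<in>UNIV. integral K (\<lambda>x. grad (\<lambda>x. pol K j x * sq K x) x \<bullet> axis j 1))"
      by (intro integral_sum finite_class.finite_UNIV polyfun_integrable polyfun_has_grad(2) K pq)
    also have "\<dots> = (\<Sum>j\<in>UNIV. \<Sum>F\<in>facets K. (?n F \<bullet> axis j 1) * face_integral F (\<lambda>x. pol K j x * sq K x))"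
      by (intro sum.cong refl divergence_element[OF K pq])
    also have "\<dots> = (\<Sum>F\<in>facets K. \<Sum>j\<in>UNIV. (?n F \<bullet> axis j 1) * face_integral F (\<lambda>x. pol K j x * sq K x))"
      by (rule sum.swap)
    also have "\<dots> = (\<Sum>F\<in>facets K. face_integral F (\<lambda>x. (pv K x \<bullet> ?n F) * sq K x))"
    proof (rule sum.cong[OF refl])
      fix F assume "F \<in> facets K"
      then have F: "flat_face F" using facet_flat[OF K] by blast
      have c: "continuous_on F (\<lambda>x. pol K j x * sq K x)" for j by (rule polyfun_continuous[OF pq])
      have "(\<Sum>j\<in>UNIV. (?n F \<bullet> axis j 1) * face_integral F (\<lambda>x. pol K j x * sq K x))
          = (\<Sum>j\<in>UNIV. face_integral F (\<lambda>x. (?n F \<bullet> axis j 1) * (pol K j x * sq K x)))"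
        by (simp only: face_integral_mult[OF F])
      also have "\<dots> = face_integral F (\<lambda>x. \<Sum>j\<in>UNIV. (?n F \<bullet> axis j 1) * (pol K j x * sq K x))"
        by (rule face_integral_sum[OF F finite_class.finite_UNIV, symmetric]) (intro continuous_on_mult continuous_on_const c)
      also have "(\<lambda>x. \<Sum>j\<in>UNIV. (?n F \<bullet> axis j 1) * (pol K j x * sq K x)) = (\<lambda>x. (pv K x \<bullet> ?n F) * sq K x)"
        by (rule ext) (simp add: pv_def inner_vec_def[of "vec_lambda _"] inner_axis sum_distrib_left sum_distrib_right mult_ac)
      finally show "(\<Sum>j\<in>UNIV. (?n F \<bullet> axis j 1) * face_integral F (\<lambda>x. pol K j x * sq K x))
          = face_integral F (\<lambda>x. (pv K x \<bullet> ?n F) * sq K x)" .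
    qed
    finally have eq: "integral K (\<lambda>x. 2 * ?h1 K x + ?h2 K x) = (\<Sum>F\<in>facets K. face_integral F (\<lambda>x. (pv K x \<bullet> ?n F) * sq K x))" .
    have I1: "?h1 K integrable_on K" and I2: "?h2 K integrable_on K"
      by (intro polyfun_integrable p1 p2 K)+
    have "integral K (\<lambda>x. 2 * ?h1 K x + ?h2 K x) = 2 * integral K (?h1 K) + integral K (?h2 K)"
      by (subst integral_add[OF integrable_on_mult_right[OF I1] I2]) (simp only: integral_mult_right)
    then have "- integral K (?h1 K) - 1/2 * integral K (?h2 K) = - 1/2 * (\<Sum>F\<in>facets K. face_integral F (\<lambda>x. (pv K x \<bullet> ?n F) * sq K x))"
      using eq by linarith
    then show ?thesis by (simp only: sum_distrib_left)
  qed
  have "- L2_inner \<Omega> (\<lambda>x. w x \<otimes>\<^sub>v w x) (gradient w) - 1/2 * L2_inner \<Omega> (\<lambda>x. divergence w x *\<^sub>R w x) w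
      = (\<Sum>K\<in>\<T>. - integral K (?h1 K) - 1/2 * integral K (?h2 K))"
    unfolding i1 i2 by (simp only: sum_subtractf sum_negf sum_distrib_left)
  also have "\<dots> = (\<Sum>K\<in>\<T>. \<Sum>F\<in>facets K. - 1/2 * face_integral F (\<lambda>x. (pv K x \<bullet> outward_normal K F) * sq K x))"
    by (rule sum.cong[OF refl el])
  finally show ?thesis .
qed

lemma inner_avg_jmp:
  fixes P M n :: "real^'d"
  shows "((1/2) *\<^sub>R (P + M) \<bullet> n) * ((1/2) *\<^sub>R (P + M) \<bullet> (P - M)) = 1/4 * ((P \<bullet> n + M \<bullet> n) * (P \<bullet> P - M \<bullet> M))"
proof -
  have 1: "(1/2) *\<^sub>R (P + M) \<bullet> n = 1/2 * (P \<bullet> n + M \<bullet> n)" by (simp add: inner_add_left)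
  have 2: "(1/2) *\<^sub>R (P + M) \<bullet> (P - M) = 1/2 * (P \<bullet> P - M \<bullet> M)"
  proof -
    have "(P + M) \<bullet> (P - M) = P \<bullet> P - M \<bullet> M"
      by (simp add: inner_add_left inner_diff_right inner_commute[of M P])
    then show ?thesis by (simp only: inner_scaleR_left)
  qed
  show ?thesis unfolding 1 2 by simp
qed

text \<open>On an interior face the contributions of the two elements add up to the upwind term: with
  \<open>P\<close>, \<open>M\<close> the two traces, everything else cancels because \<open>|P|\<^sup>2 - |M|\<^sup>2 = 2 {w} \<bullet> [w]\<close>.\<close>

lemma convection_nonneg:
  assumes z0: "\<And>F. F \<in> mesh_faces \<T> \<Longrightarrow> 0 \<le> \<zeta> F" and zb: "\<And>F. F \<in> boundary_faces \<Omega> \<T> \<Longrightarrow> 1/2 \<le> \<zeta> F"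
  shows "0 \<le> c_h \<Omega> \<T> Kp \<zeta> w w w"
proof -
  let ?n = "outward_normal" and ?nF = "face_normal Kp" and ?m = "K_minus \<T> Kp"
  \<comment> \<open>\<open>A\<close> is the upwind term, \<open>B\<close> the central flux,
    \<open>D\<close> the last term of \<open>c_h\<close> and \<open>E\<close> the flux from the
    volume terms. In \<open>A\<close> the product of the two normals is a sign: the jump is built
    with the normal of the face, but contracted with that of the element.\<close>
  define A where "A K F x = \<zeta> F * \<bar>avg F x \<bullet> ?n K F\<bar> * ((?nF F \<bullet> ?n K F) * (jmp F x \<bullet> pv K x))" for K F x
  define B where "B K F x = (avg F x \<bullet> ?n K F) * (avg F x \<bullet> pv K x)" for K F x
  define D where "D K F x = (pv K x \<bullet> ?n K F) * avgs F x" for K F x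
  define E where "E K F x = (pv K x \<bullet> ?n K F) * sq K x" for K F x
  \<comment> \<open>The coefficient of \<open>D\<close> is zero on a boundary face, as the last sum
    of \<open>c_h\<close> skips these.\<close>
  define Q where "Q K F x = A K F x + B K F x + (if interior_face F then 1/2 * D K F x else 0 * D K F x) + (- 1/2) * E K F x" for K F x
  have cA: "continuous_on F (A K F)" and cB: "continuous_on F (B K F)" and cD: "continuous_on F (D K F)" and cE: "continuous_on F (E K F)"
    if K: "K \<in> \<T>" "F facet_of K" for K F
  proof -
    note c = avg_jmp_continuous[OF facet_mesh_face[OF K], of F] avgs_continuous[OF facet_mesh_face[OF K], of F]
      pv_continuous[OF K(1), of F] polyfun_continuous[OF sq_polyfun[OF K(1)], of F]
    show "continuous_on F (A K F)" unfolding A_def[abs_def]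
      by (intro continuous_on_mult continuous_on_const continuous_on_rabs continuous_on_inner c)
    show "continuous_on F (B K F)" unfolding B_def[abs_def]
      by (intro continuous_on_mult continuous_on_const continuous_on_inner c)
    show "continuous_on F (D K F)" unfolding D_def[abs_def]
      by (intro continuous_on_mult continuous_on_const continuous_on_inner c)
    show "continuous_on F (E K F)" unfolding E_def[abs_def]
      by (intro continuous_on_mult continuous_on_const continuous_on_inner c)
  qed
  have cQ: "continuous_on F (Q K F)" if K: "K \<in> \<T>" "F facet_of K" for K F
  proof (cases "interior_face F")
    case True
    then show ?thesis unfolding Q_def[abs_def]
      by (simp only: if_True) (intro continuous_on_add continuous_on_mult continuous_on_const cA[OF K] cB[OF K] cD[OF K] cE[OF K])
  next
    case False
    then show ?thesis unfolding Q_def[abs_def]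
      by (simp only: if_False) (intro continuous_on_add continuous_on_mult continuous_on_const cA[OF K] cB[OF K] cD[OF K] cE[OF K])
  qed
  have FQ: "face_integral F (Q K F) = face_integral F (A K F) + face_integral F (B K F)
      + (if interior_face F then 1/2 * face_integral F (D K F) else 0) + (- 1/2) * face_integral F (E K F)"
    if K: "K \<in> \<T>" "F facet_of K" for K F
  proof -
    note fl = facet_flat[OF K] and cs = cA[OF K] cB[OF K] cD[OF K] cE[OF K]
    have "face_integral F (\<lambda>x. A K F x + B K F x + c * D K F x + (- 1/2) * E K F x)
        = face_integral F (A K F) + face_integral F (B K F) + c * face_integral F (D K F) + (- 1/2) * face_integral F (E K F)" for c
    proof -
      have "face_integral F (\<lambda>x. A K F x + B K F x + c * D K F x + (- 1/2) * E K F x)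
          = face_integral F (\<lambda>x. A K F x + B K F x + c * D K F x) + face_integral F (\<lambda>x. (- 1/2) * E K F x)"
        by (intro face_integral_add[OF fl] continuous_on_add continuous_on_mult continuous_on_const cs)
      also have "face_integral F (\<lambda>x. A K F x + B K F x + c * D K F x)
          = face_integral F (\<lambda>x. A K F x + B K F x) + face_integral F (\<lambda>x. c * D K F x)"
        by (intro face_integral_add[OF fl] continuous_on_add continuous_on_mult continuous_on_const cs)
      finally show ?thesis
        unfolding face_integral_add[OF fl cs(1) cs(2)] face_integral_mult[OF fl] .
    qed
    from this[of "if interior_face F then 1/2 else 0"] show ?thesis
      unfolding Q_def[abs_def] by (simp split: if_splits)
  qed
  have "\<forall>K\<in>\<T>. \<forall>F. F facet_of K \<longrightarrow> (\<forall>x\<in>F.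
        (((\<zeta> F * \<bar>average \<Omega> \<T> Kp F w x \<bullet> ?n K F\<bar>) *\<^sub>R jump_normal \<Omega> \<T> Kp F w x) *v ?n K F) \<bullet> face_trace K w x = A K F x)"
    "\<forall>K\<in>\<T>. \<forall>F. F facet_of K \<longrightarrow> (\<forall>x\<in>F.
        ((average \<Omega> \<T> Kp F w x \<otimes>\<^sub>v average \<Omega> \<T> Kp F w x) *v ?n K F) \<bullet> face_trace K w x = B K F x)"
    "\<forall>K\<in>\<T>. \<forall>F. F facet_of K \<longrightarrow> (\<forall>x\<in>F.
        face_trace K w x \<bullet> (average \<Omega> \<T> Kp F (\<lambda>y. w y \<bullet> w y) x *\<^sub>R ?n K F) = D K F x)"
    unfolding A_def B_def D_def
    by (auto simp: face_trace_values average_square facet_mesh_face facet_trace scaleR_mult_vec outer_mult_vec)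
  note t = sum_element_boundaries_eq[OF this(1)] sum_element_boundaries_eq[OF this(2)]
    sum_interior_element_boundaries_eq[OF this(3)]
  have "c_h \<Omega> \<T> Kp \<zeta> w w w = (\<Sum>K\<in>\<T>. \<Sum>F\<in>facets K. face_integral F (Q K F))"
  proof -
    have "c_h \<Omega> \<T> Kp \<zeta> w w w = (\<Sum>K\<in>\<T>. \<Sum>F\<in>facets K. - 1/2 * face_integral F (E K F))
      + (\<Sum>K\<in>\<T>. \<Sum>F\<in>facets K. face_integral F (A K F))
      + (\<Sum>K\<in>\<T>. \<Sum>F\<in>facets K. face_integral F (B K F))
      + 1/2 * (\<Sum>K\<in>\<T>. \<Sum>F\<in>facets K. if interior_face F then face_integral F (D K F) else 0)"
      unfolding c_h_def t convection_volume E_def[abs_def] by (rule refl)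
    also have "\<dots> = (\<Sum>K\<in>\<T>. \<Sum>F\<in>facets K. - 1/2 * face_integral F (E K F) + face_integral F (A K F)
        + face_integral F (B K F) + 1/2 * (if interior_face F then face_integral F (D K F) else 0))"
      by (simp only: sum.distrib sum_distrib_left)
    also have "\<dots> = (\<Sum>K\<in>\<T>. \<Sum>F\<in>facets K. face_integral F (Q K F))"
      by (intro sum.cong refl) (simp add: FQ)
    finally show ?thesis .
  qed
  also have "\<dots> = (\<Sum>F\<in>mesh_faces \<T>. face_sum (\<lambda>K F. face_integral F (Q K F)) F)"
    by (rule sum_over_elements)
  also have "0 \<le> \<dots>"
  proof (rule sum_nonneg)
    fix F assume F: "F \<in> mesh_faces \<T>"
    note Kp = Kp_facet[OF F]
    let ?N = "?nF F"
    have nn: "?N \<bullet> ?N = 1" using facet_norm[OF Kp] unfolding face_normal_def by (simp add: norm_eq_1)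
    have np: "?n (Kp F) F = ?N" unfolding face_normal_def by (rule refl)
    show "0 \<le> face_sum (\<lambda>K F. face_integral F (Q K F)) F"
    proof (cases "interior_face F")
      case True
      note Km = interior_face_elements(1,2)[OF True]
      have "0 \<le> face_integral F (\<lambda>x. Q (Kp F) F x + Q (?m F) F x)"
      proof (rule face_integral_nonneg[OF facet_flat[OF Kp]])
        show "continuous_on F (\<lambda>x. Q (Kp F) F x + Q (?m F) F x)" by (intro continuous_on_add cQ Kp Km)
        fix x
        let ?P = "pv (Kp F) x" and ?M = "pv (?m F) x" and ?a = "avg F x" and ?j = "jmp F x"
        have a: "?a = (1/2) *\<^sub>R (?P + ?M)" and j: "?j = ?P - ?M" and s: "avgs F x = 1/2 * (?P \<bullet> ?P + ?M \<bullet> ?M)"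
          using True unfolding avg_def jmp_def avgs_def pv_inner by simp_all
        have Qp: "Q (Kp F) F x = \<zeta> F * \<bar>?a \<bullet> ?N\<bar> * (?j \<bullet> ?P) + (?a \<bullet> ?N) * (?a \<bullet> ?P)
            + 1/2 * ((?P \<bullet> ?N) * avgs F x) + (- 1/2) * ((?P \<bullet> ?N) * (?P \<bullet> ?P))"
          unfolding Q_def A_def B_def D_def E_def np nn pv_inner using True by simp
        have Qm: "Q (?m F) F x = - (\<zeta> F * \<bar>?a \<bullet> ?N\<bar> * (?j \<bullet> ?M)) - (?a \<bullet> ?N) * (?a \<bullet> ?M)
            - 1/2 * ((?M \<bullet> ?N) * avgs F x) + 1/2 * ((?M \<bullet> ?N) * (?M \<bullet> ?M))"
          unfolding Q_def A_def B_def D_def E_def minus_normal[OF True] pv_inner using True nn by simp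
        have "(?a \<bullet> ?N) * (?a \<bullet> ?P) - (?a \<bullet> ?N) * (?a \<bullet> ?M) = (?a \<bullet> ?N) * (?a \<bullet> ?j)"
          unfolding j by (simp add: inner_diff_right right_diff_distrib)
        also have "\<dots> = 1/4 * ((?P \<bullet> ?N + ?M \<bullet> ?N) * (?P \<bullet> ?P - ?M \<bullet> ?M))"
          unfolding a j by (rule inner_avg_jmp)
        finally have c: "(?a \<bullet> ?N) * (?a \<bullet> ?P) - (?a \<bullet> ?N) * (?a \<bullet> ?M) = 1/4 * ((?P \<bullet> ?N + ?M \<bullet> ?N) * (?P \<bullet> ?P - ?M \<bullet> ?M))" .
        have u: "\<zeta> F * \<bar>?a \<bullet> ?N\<bar> * (?j \<bullet> ?P) - \<zeta> F * \<bar>?a \<bullet> ?N\<bar> * (?j \<bullet> ?M) = \<zeta> F * \<bar>?a \<bullet> ?N\<bar> * (?j \<bullet> ?j)"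
          unfolding right_diff_distrib[symmetric] inner_diff_right[symmetric] by (simp only: j)
        have "Q (Kp F) F x + Q (?m F) F x = \<zeta> F * \<bar>?a \<bullet> ?N\<bar> * (?j \<bullet> ?j)
            + (1/4 * ((?P \<bullet> ?N + ?M \<bullet> ?N) * (?P \<bullet> ?P - ?M \<bullet> ?M))
              + 1/2 * ((?P \<bullet> ?N) * (1/2 * (?P \<bullet> ?P + ?M \<bullet> ?M))) - 1/2 * ((?P \<bullet> ?N) * (?P \<bullet> ?P))
              - 1/2 * ((?M \<bullet> ?N) * (1/2 * (?P \<bullet> ?P + ?M \<bullet> ?M))) + 1/2 * ((?M \<bullet> ?N) * (?M \<bullet> ?M)))"
          unfolding Qp Qm s using c u by linarith
        also have "\<dots> = \<zeta> F * \<bar>?a \<bullet> ?N\<bar> * (?j \<bullet> ?j)" by (simp add: algebra_simps)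
        also have "0 \<le> \<dots>" using z0[OF F] by simp
        finally show "0 \<le> Q (Kp F) F x + Q (?m F) F x" .
      qed
      also have "\<dots> = face_integral F (Q (Kp F) F) + face_integral F (Q (?m F) F)"
        by (rule face_integral_add[OF facet_flat[OF Kp] cQ[OF Kp] cQ[OF Km]])
      finally show ?thesis using True by (simp add: face_sum_def)
    next
      case False
      then have "F \<in> boundary_faces \<Omega> \<T>" using F unfolding interior_faces_def by blast
      then have z: "1/2 \<le> \<zeta> F" by (rule zb)
      have "0 \<le> face_integral F (Q (Kp F) F)"
      proof (rule face_integral_nonneg[OF facet_flat[OF Kp] cQ[OF Kp]])
        fix x
        let ?P = "pv (Kp F) x"
        \<comment> \<open>On the boundary the central flux counts once and the volume terms take
          back one half. The remaining half can be negative on inflow, and \<zeta> \<ge> 1/2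
          compensates exactly that.\<close>
        have "Q (Kp F) F x = (\<zeta> F * \<bar>?P \<bullet> ?N\<bar> + 1/2 * (?P \<bullet> ?N)) * (?P \<bullet> ?P)"
          unfolding Q_def A_def B_def D_def E_def np nn avg_def jmp_def pv_inner[symmetric] using False
          by (simp add: algebra_simps)
        moreover have "1/2 * \<bar>?P \<bullet> ?N\<bar> \<le> \<zeta> F * \<bar>?P \<bullet> ?N\<bar>" using z by (rule mult_right_mono) simp
        then have "0 \<le> \<zeta> F * \<bar>?P \<bullet> ?N\<bar> + 1/2 * (?P \<bullet> ?N)" by linarith
        ultimately show "0 \<le> Q (Kp F) F x" by simp
      qed
      then show ?thesis using False by (simp add: face_sum_def)
    qed
  qed
  finally show ?thesis .
qed

end

section \<open>Discrete Poincare inequality\<close>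

context broken_field
begin

definition jump_energy :: "'d \<Rightarrow> real" where
  "jump_energy i = (\<Sum>F\<in>mesh_faces \<T>. face_integral F (\<lambda>x. (jmp F x $ i)\<^sup>2) / diameter F)"

text \<open>Testing with the field \<open>x\<^sub>i e\<^sub>i\<close> involves no derivative of \<open>w\<^sub>i\<close> but \<open>\<partial>\<^sub>i w\<^sub>i\<close>. This entry is
  controlled by the symmetric gradient as well, so no Korn inequality is needed.\<close>

lemma poincare_component:
  assumes R: "0 < R" "\<And>x. x \<in> closure \<Omega> \<Longrightarrow> \<bar>x $ i\<bar> \<le> R"
    and \<sigma>: "0 < \<sigma>" "\<And>K. K \<in> \<T> \<Longrightarrow> diameter K \<le> \<sigma> * inball_diameter K"
  defines "A \<equiv> 2 * R * (real (Suc CARD('d)) * \<sigma> * trace_constant r CARD('d))"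
  shows "(\<Sum>K\<in>\<T>. integral K (\<lambda>x. (pol K i x)\<^sup>2))
    \<le> 8 * R\<^sup>2 * (\<Sum>K\<in>\<T>. integral K (\<lambda>x. (grad (pol K i) x \<bullet> axis i 1)\<^sup>2)) + 2 * R * A * jump_energy i"
proof -
  let ?e = "axis i 1 :: real^'d" and ?n = "outward_normal"
  let ?p = "\<lambda>K. pol K i" and ?d = "\<lambda>K x. grad (pol K i) x \<bullet> axis i 1"
  let ?t = "trace_constant r CARD('d)"
  let ?M = "\<Sum>K\<in>\<T>. integral K (\<lambda>x. (?p K x)\<^sup>2)" and ?E = "\<Sum>K\<in>\<T>. integral K (\<lambda>x. (?d K x)\<^sup>2)"
  \<comment> \<open>\<open>A\<close> is the parameter of Young's inequality on the faces, chosen so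
    that the trace terms, which come with the factor \<open>R / (2 * A)\<close>, sum to at most a
    quarter of \<open>?M\<close>.\<close>
  have A: "0 < A" unfolding A_def using R(1) \<sigma>(1) trace_constant_pos[of r "CARD('d)"] by simp
  define q where "q K x = x $ i * (?p K x * ?p K x)" for K x
  have pp: "polyfun (\<lambda>x. ?p K x * ?p K x)" if "K \<in> \<T>" for K
    by (intro real_polynomial_function.intros(4) pol_polyfun that)
  have pq: "polyfun (q K)" if "K \<in> \<T>" for K
    unfolding q_def[abs_def] by (intro real_polynomial_function.intros(4) polyfun_nth pol_polyfun that)
  have int: "f integrable_on K" if "K \<in> \<T>" "polyfun f" for K f
    by (rule polyfun_integrable[OF that])
  have p2: "polyfun (\<lambda>x. (?p K x)\<^sup>2)" and d2: "polyfun (\<lambda>x. (?d K x)\<^sup>2)" if "K \<in> \<T>" for K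
    by (intro real_polynomial_function_power pol_polyfun polyfun_has_grad(2) that)+
  have K_bound: "\<bar>x $ i\<bar> \<le> R" if "K \<in> \<T>" "x \<in> K" for K x
    using R(2) that mesh_union by blast
  have gq: "grad (q K) x \<bullet> ?e = (?p K x)\<^sup>2 + 2 * (x $ i) * ?p K x * ?d K x" if K: "K \<in> \<T>" for K x
    unfolding q_def[abs_def] grad_mult[OF polyfun_nth pp[OF K]] grad_mult[OF pol_polyfun[OF K] pol_polyfun[OF K]] grad_nth
    by (simp only: inner_add_left inner_scaleR_left inner_axis_axis) (simp add: power2_eq_square algebra_simps)
  \<comment> \<open>Young's inequality gives up a quarter of the squared norm here and the faces
    another quarter. One half remains, hence the factors 8 and 2 in the claim.\<close>
  have el: "3/4 * integral K (\<lambda>x. (?p K x)\<^sup>2) - 4 * R\<^sup>2 * integral K (\<lambda>x. (?d K x)\<^sup>2)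
      \<le> (\<Sum>F\<in>facets K. (?n K F \<bullet> ?e) * face_integral F (q K))" if K: "K \<in> \<T>" for K
  proof -
    have "3/4 * integral K (\<lambda>x. (?p K x)\<^sup>2) - 4 * R\<^sup>2 * integral K (\<lambda>x. (?d K x)\<^sup>2)
        = integral K (\<lambda>x. 3/4 * (?p K x)\<^sup>2 - 4 * R\<^sup>2 * (?d K x)\<^sup>2)"
      by (subst integral_diff[OF integrable_on_mult_right[OF int[OF K p2[OF K]]] integrable_on_mult_right[OF int[OF K d2[OF K]]]])
        (simp only: integral_mult_right)
    also have "\<dots> \<le> integral K (\<lambda>x. grad (q K) x \<bullet> ?e)"
    proof (rule integral_le)
      show "(\<lambda>x. 3/4 * (?p K x)\<^sup>2 - 4 * R\<^sup>2 * (?d K x)\<^sup>2) integrable_on K"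
        by (intro integrable_diff integrable_on_mult_right int K p2 d2)
      show "(\<lambda>x. grad (q K) x \<bullet> ?e) integrable_on K" by (intro int K polyfun_has_grad(2) pq)
      fix x assume x: "x \<in> K"
      let ?a = "?p K x" and ?b = "?d K x"
      have "\<bar>2 * (x $ i) * ?a * ?b\<bar> = 2 * \<bar>x $ i\<bar> * (\<bar>?a\<bar> * \<bar>?b\<bar>)" by (simp add: abs_mult)
      also have "\<dots> \<le> 2 * R * (\<bar>?a\<bar> * \<bar>?b\<bar>)" using K_bound[OF K x] by (intro mult_right_mono mult_left_mono) auto
      also have "\<dots> = 2 * (\<bar>?a\<bar> / 2) * (2 * R * \<bar>?b\<bar>)" by simp
      also have "\<dots> \<le> (\<bar>?a\<bar> / 2)\<^sup>2 + (2 * R * \<bar>?b\<bar>)\<^sup>2" by (rule sum_squares_bound)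
      also have "\<dots> = 1/4 * ?a\<^sup>2 + 4 * R\<^sup>2 * ?b\<^sup>2" by (simp add: power_mult_distrib power_divide)
      finally show "3/4 * ?a\<^sup>2 - 4 * R\<^sup>2 * ?b\<^sup>2 \<le> grad (q K) x \<bullet> ?e" unfolding gq[OF K] by linarith
    qed
    also have "\<dots> = (\<Sum>F\<in>facets K. (?n K F \<bullet> ?e) * face_integral F (q K))"
      by (rule divergence_element[OF K pq[OF K]])
    finally show ?thesis .
  qed
  let ?h = "\<lambda>K F. diameter F * face_integral F (\<lambda>x. (?p K x)\<^sup>2)"
  have face: "face_sum (\<lambda>K F. (?n K F \<bullet> ?e) * face_integral F (q K)) F
      \<le> R * A * (face_integral F (\<lambda>x. (jmp F x $ i)\<^sup>2) / diameter F) + R / (2 * A) * face_sum ?h F"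
    if F: "F \<in> mesh_faces \<T>" for F
  proof -
    note Kp = Kp_facet[OF F]
    note fl = facet_flat[OF Kp]
    define h where "h = diameter F"
    have h: "0 < h" unfolding h_def by (rule facet_diameter[OF Kp])
    let ?N = "face_normal Kp F"
    have np: "?n (Kp F) F = ?N" unfolding face_normal_def by (rule refl)
    have nb: "\<bar>?N \<bullet> ?e\<bar> \<le> 1"
      using Cauchy_Schwarz_ineq2[of ?N ?e] facet_norm[OF Kp] by (simp add: np norm_axis_1)
    \<comment> \<open>The weights follow the face size: 1/h goes to the jump, as in
      \<open>jump_energy\<close>, and h to the traces, as in \<open>trace_element\<close>.\<close>
    have young: "\<bar>a\<bar> * \<bar>b\<bar> \<le> A / h * a\<^sup>2 + h / (4 * A) * b\<^sup>2" for a b :: real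
    proof -
      have s: "0 < A / h" "0 < h / A" using A h by simp_all
      have "\<bar>a\<bar> * \<bar>b\<bar> = 2 * (sqrt (A / h) * \<bar>a\<bar>) * (sqrt (h / A) * \<bar>b\<bar> / 2)"
        using A h by (simp add: real_sqrt_divide)
      also have "\<dots> \<le> (sqrt (A / h) * \<bar>a\<bar>)\<^sup>2 + (sqrt (h / A) * \<bar>b\<bar> / 2)\<^sup>2" by (rule sum_squares_bound)
      also have "\<dots> = A / h * a\<^sup>2 + h / (4 * A) * b\<^sup>2"
        using s by (simp add: power_mult_distrib power_divide real_sqrt_pow2)
      finally show ?thesis .
    qed
    have xb: "\<bar>(?N \<bullet> ?e) * x $ i\<bar> \<le> R" if "x \<in> F" for x
    proof -
      have "\<bar>x $ i\<bar> \<le> R" using K_bound[OF Kp(1)] facet_sub[OF Kp] that by blast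
      then have "\<bar>?N \<bullet> ?e\<bar> * \<bar>x $ i\<bar> \<le> 1 * R" using nb by (intro mult_mono) auto
      then show ?thesis by (simp add: abs_mult)
    qed
    have cj: "continuous_on F (\<lambda>x. (jmp F x $ i)\<^sup>2)"
      by (intro continuous_on_power bounded_linear.continuous_on[OF bounded_linear_vec_nth] avg_jmp_continuous(2)[OF F])
    let ?a = "?p (Kp F)" and ?m = "Km F"
    \<comment> \<open>The trace from the other side, set to zero on the boundary, so that the jump
      is a difference of two traces on every face.\<close>
    define b where "b = (if interior_face F then ?p ?m else (\<lambda>x. 0))"
    have j: "jmp F x $ i = ?a x - b x" for x unfolding jmp_def pv_def b_def by simp
    have pb: "polyfun b" and pa: "polyfun ?a"
      unfolding b_def using pol_polyfun interior_face_elements(1) Kp by (auto intro: real_polynomial_function.intros(2))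
    have z: "face_integral F (\<lambda>x. 0) = 0" using face_integral_mult[OF fl, of 0] by simp
    have c: "continuous_on F (\<lambda>x. x $ i * (f x * f x))" "continuous_on F (\<lambda>x. (f x)\<^sup>2)" if "polyfun f" for f
      by (intro polyfun_continuous real_polynomial_function.intros(4) real_polynomial_function_power polyfun_nth that)+
    have cd: "continuous_on F (\<lambda>x. x $ i * (?a x * ?a x) - x $ i * (b x * b x))" by (intro continuous_on_diff c pa pb)
    have cs: "continuous_on F (\<lambda>x. (?a x)\<^sup>2 + (b x)\<^sup>2)" by (intro continuous_on_add c pa pb)
    have cr: "continuous_on F (\<lambda>x. R * A / h * (jmp F x $ i)\<^sup>2)" "continuous_on F (\<lambda>x. R * h / (2 * A) * ((?a x)\<^sup>2 + (b x)\<^sup>2))"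
      by (intro continuous_on_mult continuous_on_const cj cs)+
    have "face_sum (\<lambda>K F. (?n K F \<bullet> ?e) * face_integral F (q K)) F
        = (?N \<bullet> ?e) * (face_integral F (\<lambda>x. x $ i * (?a x * ?a x)) - face_integral F (\<lambda>x. x $ i * (b x * b x)))"
    proof (cases "interior_face F")
      case True
      then show ?thesis unfolding face_sum_def minus_normal[OF True] np b_def q_def[abs_def] by (simp add: right_diff_distrib)
    qed (simp add: face_sum_def np b_def q_def[abs_def] z)
    also have "\<dots> = face_integral F (\<lambda>x. (?N \<bullet> ?e) * (x $ i * (?a x * ?a x) - x $ i * (b x * b x)))"
      unfolding face_integral_mult[OF fl] face_integral_diff[OF fl c(1)[OF pa] c(1)[OF pb]] by (rule refl)
    also have "\<dots> \<le> face_integral F (\<lambda>x. R * A / h * (jmp F x $ i)\<^sup>2 + R * h / (2 * A) * ((?a x)\<^sup>2 + (b x)\<^sup>2))"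
    proof (rule face_integral_mono[OF fl continuous_on_mult[OF continuous_on_const cd] continuous_on_add[OF cr]])
      fix x assume x: "x \<in> F"
      let ?a = "?p (Kp F) x" and ?b = "b x"
      have "(?N \<bullet> ?e) * (x $ i * (?a * ?a) - x $ i * (?b * ?b)) = ((?N \<bullet> ?e) * x $ i) * ((?a - ?b) * (?a + ?b))"
        by (simp add: algebra_simps)
      also have "\<dots> \<le> \<bar>(?N \<bullet> ?e) * x $ i\<bar> * (\<bar>?a - ?b\<bar> * \<bar>?a + ?b\<bar>)" unfolding abs_mult[symmetric] by (rule abs_ge_self)
      also have "\<dots> \<le> R * (\<bar>?a - ?b\<bar> * \<bar>?a + ?b\<bar>)" by (intro mult_right_mono xb x) simp
      also have "\<dots> \<le> R * (A / h * (?a - ?b)\<^sup>2 + h / (4 * A) * (?a + ?b)\<^sup>2)" by (rule mult_left_mono[OF young less_imp_le[OF R(1)]])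
      also have "\<dots> \<le> R * (A / h * (?a - ?b)\<^sup>2 + h / (4 * A) * (2 * (?a\<^sup>2 + ?b\<^sup>2)))"
      proof -
        have "(?a + ?b)\<^sup>2 \<le> 2 * (?a\<^sup>2 + ?b\<^sup>2)" using sum_squares_bound[of ?a ?b] by (simp add: power2_sum)
        then show ?thesis using R(1) A h by (intro mult_left_mono add_left_mono) auto
      qed
      also have "\<dots> = R * A / h * (?a - ?b)\<^sup>2 + R * h / (2 * A) * (?a\<^sup>2 + ?b\<^sup>2)" by (simp add: distrib_left)
      finally show "(?N \<bullet> ?e) * (x $ i * (?a * ?a) - x $ i * (?b * ?b)) \<le> R * A / h * (jmp F x $ i)\<^sup>2 + R * h / (2 * A) * (?a\<^sup>2 + ?b\<^sup>2)"
        unfolding j .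
    qed
    also have "\<dots> = R * A / h * face_integral F (\<lambda>x. (jmp F x $ i)\<^sup>2)
        + R * h / (2 * A) * (face_integral F (\<lambda>x. (?a x)\<^sup>2) + face_integral F (\<lambda>x. (b x)\<^sup>2))"
      unfolding face_integral_add[OF fl cr] face_integral_mult[OF fl] face_integral_add[OF fl c(2)[OF pa] c(2)[OF pb]] by (rule refl)
    also have "\<dots> = R * A * (face_integral F (\<lambda>x. (jmp F x $ i)\<^sup>2) / diameter F) + R / (2 * A) * face_sum ?h F"
      unfolding face_sum_def h_def b_def by (simp add: z distrib_left add_divide_distrib mult.assoc)
    finally show ?thesis .
  qed
  have "3/4 * ?M - 4 * R\<^sup>2 * ?E = (\<Sum>K\<in>\<T>. 3/4 * integral K (\<lambda>x. (?p K x)\<^sup>2) - 4 * R\<^sup>2 * integral K (\<lambda>x. (?d K x)\<^sup>2))"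
    by (simp only: sum_subtractf sum_distrib_left)
  also have "\<dots> \<le> (\<Sum>K\<in>\<T>. \<Sum>F\<in>facets K. (?n K F \<bullet> ?e) * face_integral F (q K))" by (rule sum_mono[OF el])
  also have "\<dots> = (\<Sum>F\<in>mesh_faces \<T>. face_sum (\<lambda>K F. (?n K F \<bullet> ?e) * face_integral F (q K)) F)"
    by (rule sum_over_elements)
  also have "\<dots> \<le> (\<Sum>F\<in>mesh_faces \<T>. R * A * (face_integral F (\<lambda>x. (jmp F x $ i)\<^sup>2) / diameter F) + R / (2 * A) * face_sum ?h F)"
    by (rule sum_mono[OF face])
  also have "\<dots> = R * A * jump_energy i + R / (2 * A) * (\<Sum>F\<in>mesh_faces \<T>. face_sum ?h F)"
    unfolding jump_energy_def by (simp only: sum.distrib sum_distrib_left)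
  also have "(\<Sum>F\<in>mesh_faces \<T>. face_sum ?h F) = (\<Sum>K\<in>\<T>. \<Sum>F\<in>facets K. ?h K F)"
    by (rule sum_over_elements[symmetric])
  finally have 1: "3/4 * ?M - 4 * R\<^sup>2 * ?E \<le> R * A * jump_energy i + R / (2 * A) * (\<Sum>K\<in>\<T>. \<Sum>F\<in>facets K. ?h K F)" .
  have "(\<Sum>K\<in>\<T>. \<Sum>F\<in>facets K. ?h K F) \<le> (\<Sum>K\<in>\<T>. \<Sum>F\<in>facets K. \<sigma> * ?t * integral K (\<lambda>x. (?p K x)\<^sup>2))"
    using \<sigma> by (intro sum_mono trace_element pol(1)) auto
  also have "\<dots> = (\<Sum>K\<in>\<T>. real (Suc CARD('d)) * (\<sigma> * ?t * integral K (\<lambda>x. (?p K x)\<^sup>2)))"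
    by (intro sum.cong refl) (simp only: sum_constant card_facets)
  also have "\<dots> = real (Suc CARD('d)) * \<sigma> * ?t * ?M" by (simp only: sum_distrib_left mult.assoc)
  finally have "R / (2 * A) * (\<Sum>K\<in>\<T>. \<Sum>F\<in>facets K. ?h K F) \<le> R / (2 * A) * (real (Suc CARD('d)) * \<sigma> * ?t * ?M)"
    using R(1) A by (intro mult_left_mono) auto
  also have "\<dots> = 1/4 * ?M"
  proof -
    have "R * (real (Suc CARD('d)) * \<sigma> * ?t) = A / 2" unfolding A_def by simp
    then have "R / (2 * A) * (real (Suc CARD('d)) * \<sigma> * ?t) = 1/4" using A by (simp only: times_divide_eq_left) simp
    then show ?thesis by (simp only: mult.assoc[symmetric])
  qed
  finally show ?thesis using 1 by linarith
qed

end

lemma L2_inner_self_nonneg: "0 \<le> L2_inner \<Omega> f f"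
  unfolding L2_inner_def set_lebesgue_integral_def by (rule Bochner_Integration.integral_nonneg) simp

lemma L2_norm_square: "(L2_norm \<Omega> f)\<^sup>2 = L2_inner \<Omega> f f"
  unfolding L2_norm_def using L2_inner_self_nonneg by (rule real_sqrt_pow2)

context broken_field
begin

lemma L2_norm_w: "(L2_norm \<Omega> w)\<^sup>2 = (\<Sum>i\<in>UNIV. \<Sum>K\<in>\<T>. integral K (\<lambda>x. (pol K i x)\<^sup>2))"
proof -
  have p: "polyfun (\<lambda>x. (pol K i x)\<^sup>2)" if "K \<in> \<T>" for K i
    by (intro real_polynomial_function_power pol_polyfun that)
  have "(L2_norm \<Omega> w)\<^sup>2 = (\<Sum>K\<in>\<T>. integral K (\<lambda>x. \<Sum>i\<in>UNIV. (pol K i x)\<^sup>2))"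
    unfolding L2_norm_square L2_inner_def
  proof (rule integral_Omega(2))
    show "continuous_on K (\<lambda>x. \<Sum>i\<in>UNIV. (pol K i x)\<^sup>2)" if "K \<in> \<T>" for K
      by (intro continuous_on_sum polyfun_continuous p that)
    show "w x \<bullet> w x = (\<Sum>i\<in>UNIV. (pol K i x)\<^sup>2)" if "K \<in> \<T>" "x \<in> interior K" for K x
      unfolding inner_vec_def using pol(2)[OF that] by (simp add: power2_eq_square)
  qed
  also have "\<dots> = (\<Sum>K\<in>\<T>. \<Sum>i\<in>UNIV. integral K (\<lambda>x. (pol K i x)\<^sup>2))"
    by (intro sum.cong refl integral_sum finite_class.finite_UNIV polyfun_integrable p)
  also have "\<dots> = (\<Sum>i\<in>UNIV. \<Sum>K\<in>\<T>. integral K (\<lambda>x. (pol K i x)\<^sup>2))" by (rule sum.swap)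
  finally show ?thesis .
qed

text \<open>With \<open>c\<close> equal to 0 or 1 both tensors are the gradient plus
  \<open>c\<close> times its transpose, so a diagonal entry of the stress is \<open>1 + c\<close>
  times that of the gradient. The trace subtracted in \<open>dev_stress\<close> would destroy
  this.\<close>

lemma diagonal_le_stress:
  assumes \<tau>: "\<tau> = gradient \<or> \<tau> = sym_stress"
  shows "(\<Sum>i\<in>UNIV. \<Sum>K\<in>\<T>. integral K (\<lambda>x. (grad (pol K i) x \<bullet> axis i 1)\<^sup>2)) \<le> (L2_norm \<Omega> (\<tau> w))\<^sup>2"
proof -
  let ?D = "\<lambda>K i j x. grad (pol K i) x \<bullet> axis j 1"
  define c :: real where "c = (if \<tau> = gradient then 0 else 1)"
  have \<tau>w: "\<tau> w x $ i $ j = gradient w x $ i $ j + c * gradient w x $ j $ i" for x i j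
    using \<tau> unfolding c_def sym_stress_def transpose_def by auto
  have c0: "0 \<le> c" unfolding c_def by simp
  let ?H = "\<lambda>K x. \<Sum>i\<in>UNIV. \<Sum>j\<in>UNIV. (?D K i j x + c * ?D K j i x)\<^sup>2"
  have pD: "polyfun (?D K i j)" if "K \<in> \<T>" for K i j by (rule polyfun_has_grad(2)[OF pol_polyfun[OF that]])
  have pH: "polyfun (?H K)" if "K \<in> \<T>" for K
    by (intro real_polynomial_function_sum finite_class.finite_UNIV real_polynomial_function_power
        real_polynomial_function.intros(3) polyfun_scaled pD that)
  have pd: "polyfun (\<lambda>x. (?D K i i x)\<^sup>2)" if "K \<in> \<T>" for K i by (intro real_polynomial_function_power pD that)
  have eq: "(L2_norm \<Omega> (\<tau> w))\<^sup>2 = (\<Sum>K\<in>\<T>. integral K (?H K))"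
    unfolding L2_norm_square L2_inner_def
  proof (rule integral_Omega(2))
    show "continuous_on K (?H K)" if "K \<in> \<T>" for K by (rule polyfun_continuous[OF pH[OF that]])
    show "\<tau> w x \<bullet> \<tau> w x = ?H K x" if "K \<in> \<T>" "x \<in> interior K" for K x
      unfolding inner_vec_def[of "\<tau> w x"] inner_vec_def[of "\<tau> w x $ _"]
      by (simp add: \<tau>w gradient_w[OF that] power2_eq_square)
  qed
  have "(\<Sum>i\<in>UNIV. \<Sum>K\<in>\<T>. integral K (\<lambda>x. (?D K i i x)\<^sup>2)) = (\<Sum>K\<in>\<T>. \<Sum>i\<in>UNIV. integral K (\<lambda>x. (?D K i i x)\<^sup>2))"
    by (rule sum.swap)
  also have "\<dots> = (\<Sum>K\<in>\<T>. integral K (\<lambda>x. \<Sum>i\<in>UNIV. (?D K i i x)\<^sup>2))"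
    by (intro sum.cong refl integral_sum[symmetric] finite_class.finite_UNIV polyfun_integrable pd)
  also have "\<dots> \<le> (\<Sum>K\<in>\<T>. integral K (?H K))"
  proof (rule sum_mono)
    fix K assume K: "K \<in> \<T>"
    show "integral K (\<lambda>x. \<Sum>i\<in>UNIV. (?D K i i x)\<^sup>2) \<le> integral K (?H K)"
    proof (rule integral_le)
      show "(\<lambda>x. \<Sum>i\<in>UNIV. (?D K i i x)\<^sup>2) integrable_on K"
        by (intro polyfun_integrable K real_polynomial_function_sum finite_class.finite_UNIV pd)
      show "?H K integrable_on K" by (intro polyfun_integrable K pH)
      fix x
      show "(\<Sum>i\<in>UNIV. (?D K i i x)\<^sup>2) \<le> ?H K x"
      proof (rule sum_mono)
        fix i :: 'd
        have "(?D K i i x)\<^sup>2 \<le> ((1 + c) * ?D K i i x)\<^sup>2"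
          unfolding power_mult_distrib using c0 by (simp add: mult_le_cancel_right1)
        also have "\<dots> = (?D K i i x + c * ?D K i i x)\<^sup>2" by (simp add: distrib_right)
        also have "\<dots> \<le> (\<Sum>j\<in>UNIV. (?D K i j x + c * ?D K j i x)\<^sup>2)"
          by (rule member_le_sum[of i UNIV "\<lambda>j. (?D K i j x + c * ?D K j i x)\<^sup>2"]) auto
        finally show "(?D K i i x)\<^sup>2 \<le> (\<Sum>j\<in>UNIV. (?D K i j x + c * ?D K j i x)\<^sup>2)" .
      qed
    qed
  qed
  finally show ?thesis unfolding eq .
qed

lemma jump_energy_le:
  assumes "0 < \<eta>\<^sub>0" "\<And>F. F \<in> mesh_faces \<T> \<Longrightarrow> \<eta>\<^sub>0 \<le> \<eta> F"
  shows "\<eta>\<^sub>0 * (\<Sum>i\<in>UNIV. jump_energy i)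
    \<le> sum_faces \<T> (\<lambda>F x. ((\<eta> F / diameter F) *\<^sub>R jump \<Omega> \<T> Kp F w x) \<bullet> jump \<Omega> \<T> Kp F w x)"
proof -
  have "\<eta>\<^sub>0 * (\<Sum>i\<in>UNIV. jump_energy i)
      = (\<Sum>F\<in>mesh_faces \<T>. \<Sum>i\<in>UNIV. \<eta>\<^sub>0 * (face_integral F (\<lambda>x. (jmp F x $ i)\<^sup>2) / diameter F))"
    unfolding jump_energy_def sum_distrib_left by (rule sum.swap)
  also have "\<dots> \<le> (\<Sum>F\<in>mesh_faces \<T>. face_integral F (\<lambda>x. ((\<eta> F / diameter F) *\<^sub>R jump \<Omega> \<T> Kp F w x) \<bullet> jump \<Omega> \<T> Kp F w x))"
  proof (rule sum_mono)
    fix F assume F: "F \<in> mesh_faces \<T>"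
    note fl = facet_flat[OF Kp_facet[OF F]] and h = facet_diameter[OF Kp_facet[OF F]]
    have c: "continuous_on F (\<lambda>x. (jmp F x $ i)\<^sup>2)" for i
      by (intro continuous_on_power bounded_linear.continuous_on[OF bounded_linear_vec_nth] avg_jmp_continuous(2)[OF F])
    have "face_integral F (\<lambda>x. ((\<eta> F / diameter F) *\<^sub>R jump \<Omega> \<T> Kp F w x) \<bullet> jump \<Omega> \<T> Kp F w x)
        = face_integral F (\<lambda>x. (\<eta> F / diameter F) * (\<Sum>i\<in>UNIV. (jmp F x $ i)\<^sup>2))"
      by (rule face_integral_cong[OF fl]) (simp add: face_trace_values[OF F] inner_vec_def power2_eq_square sum_distrib_left mult.assoc)
    also have "\<dots> = (\<eta> F / diameter F) * (\<Sum>i\<in>UNIV. face_integral F (\<lambda>x. (jmp F x $ i)\<^sup>2))"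
      unfolding face_integral_mult[OF fl] face_integral_sum[OF fl finite_class.finite_UNIV c] by (rule refl)
    also have "\<dots> \<ge> (\<eta>\<^sub>0 / diameter F) * (\<Sum>i\<in>UNIV. face_integral F (\<lambda>x. (jmp F x $ i)\<^sup>2))"
      using assms(2)[OF F] h by (intro mult_right_mono divide_right_mono sum_nonneg face_integral_nonneg[OF fl c]) auto
    finally show "(\<Sum>i\<in>UNIV. \<eta>\<^sub>0 * (face_integral F (\<lambda>x. (jmp F x $ i)\<^sup>2) / diameter F))
        \<le> face_integral F (\<lambda>x. ((\<eta> F / diameter F) *\<^sub>R jump \<Omega> \<T> Kp F w x) \<bullet> jump \<Omega> \<T> Kp F w x)"
      by (simp add: sum_distrib_left)
  qed
  finally show ?thesis unfolding sum_faces_def .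
qed

lemma jump_energy_nonneg: "0 \<le> jump_energy i"
  unfolding jump_energy_def
proof (intro sum_nonneg divide_nonneg_nonneg)
  fix F assume F: "F \<in> mesh_faces \<T>"
  show "0 \<le> diameter F" using facet_diameter[OF Kp_facet[OF F]] by simp
  show "0 \<le> face_integral F (\<lambda>x. (jmp F x $ i)\<^sup>2)"
    by (rule face_integral_nonneg[OF facet_flat[OF Kp_facet[OF F]]])
      (auto intro!: continuous_on_power bounded_linear.continuous_on[OF bounded_linear_vec_nth] avg_jmp_continuous(2)[OF F])
qed

text \<open>Sums the component estimates. \<open>R\<close> bounds the coordinates on the domain;
  \<open>\<eta>\<^sub>0\<close> enters because the norm weighs the jumps by the penalty.\<close>

theorem poincare:
  assumes R: "0 < R" "\<And>x i. x \<in> closure \<Omega> \<Longrightarrow> \<bar>x $ i\<bar> \<le> R"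
    and \<sigma>: "0 < \<sigma>" "\<And>K. K \<in> \<T> \<Longrightarrow> diameter K \<le> \<sigma> * inball_diameter K"
    and \<eta>: "0 < \<eta>\<^sub>0" "\<And>F. F \<in> mesh_faces \<T> \<Longrightarrow> \<eta>\<^sub>0 \<le> \<eta> F"
    and \<tau>: "\<tau> = gradient \<or> \<tau> = sym_stress"
  shows "(L2_norm \<Omega> w)\<^sup>2 \<le> (8 * R\<^sup>2 + 2 * R * (2 * R * (real (Suc CARD('d)) * \<sigma> * trace_constant r CARD('d))) / \<eta>\<^sub>0)
    * (norm_1h \<Omega> \<T> Kp \<eta> \<tau> w)\<^sup>2"
proof -
  let ?A = "2 * R * (real (Suc CARD('d)) * \<sigma> * trace_constant r CARD('d))"
  let ?J = "sum_faces \<T> (\<lambda>F x. ((\<eta> F / diameter F) *\<^sub>R jump \<Omega> \<T> Kp F w x) \<bullet> jump \<Omega> \<T> Kp F w x)"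
  let ?T = "(L2_norm \<Omega> (\<tau> w))\<^sup>2"
  have A: "0 \<le> 2 * R * ?A" using R(1) \<sigma>(1) trace_constant_pos[of r "CARD('d)"] by simp
  have J: "\<eta>\<^sub>0 * (\<Sum>i\<in>UNIV. jump_energy i) \<le> ?J" by (rule jump_energy_le[OF \<eta>])
  moreover have "0 \<le> \<eta>\<^sub>0 * (\<Sum>i\<in>UNIV. jump_energy i)" using \<eta>(1) by (intro mult_nonneg_nonneg sum_nonneg jump_energy_nonneg) simp
  ultimately have J0: "0 \<le> ?J" by linarith
  \<comment> \<open>Squaring undoes the root in \<open>norm_1h\<close> because the jump part is
    nonnegative.\<close>
  have n: "(norm_1h \<Omega> \<T> Kp \<eta> \<tau> w)\<^sup>2 = ?T + ?J"
    unfolding norm_1h_def using J0 by (intro real_sqrt_pow2 add_nonneg_nonneg zero_le_power2)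
  have "(L2_norm \<Omega> w)\<^sup>2 \<le> (\<Sum>i\<in>UNIV. 8 * R\<^sup>2 * (\<Sum>K\<in>\<T>. integral K (\<lambda>x. (grad (pol K i) x \<bullet> axis i 1)\<^sup>2)) + 2 * R * ?A * jump_energy i)"
    unfolding L2_norm_w by (intro sum_mono poincare_component R \<sigma>)
  also have "\<dots> = 8 * R\<^sup>2 * (\<Sum>i\<in>UNIV. \<Sum>K\<in>\<T>. integral K (\<lambda>x. (grad (pol K i) x \<bullet> axis i 1)\<^sup>2)) + 2 * R * ?A * (\<Sum>i\<in>UNIV. jump_energy i)"
    by (simp only: sum.distrib sum_distrib_left)
  also have "\<dots> \<le> 8 * R\<^sup>2 * ?T + 2 * R * ?A * (?J / \<eta>\<^sub>0)"
  proof (intro add_mono mult_left_mono diagonal_le_stress[OF \<tau>] A)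
    show "(\<Sum>i\<in>UNIV. jump_energy i) \<le> ?J / \<eta>\<^sub>0" using J \<eta>(1) by (simp add: pos_le_divide_eq mult.commute)
  qed simp
  also have "\<dots> \<le> 8 * R\<^sup>2 * (?T + ?J) + 2 * R * ?A / \<eta>\<^sub>0 * (?T + ?J)"
  proof (rule add_mono)
    show "8 * R\<^sup>2 * ?T \<le> 8 * R\<^sup>2 * (?T + ?J)" using J0 by (intro mult_left_mono) auto
    have "2 * R * ?A * (?J / \<eta>\<^sub>0) = 2 * R * ?A / \<eta>\<^sub>0 * ?J" by simp
    also have "\<dots> \<le> 2 * R * ?A / \<eta>\<^sub>0 * (?T + ?J)"
      using A \<eta>(1) by (intro mult_left_mono divide_nonneg_pos) auto
    finally show "2 * R * ?A * (?J / \<eta>\<^sub>0) \<le> 2 * R * ?A / \<eta>\<^sub>0 * (?T + ?J)" .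
  qed
  finally show ?thesis unfolding n by (simp only: distrib_right)
qed

end

section \<open>Energy identity of the collocation method\<close>

context gauss
begin

text \<open>To be read with \<open>g i\<close> the i-th slope at the old value, \<open>h i\<close>
  the same slope at its stage, and \<open>G\<close> the Gram matrix of the slopes. Symmetrising the
  sum with coefficients b_i a_ij against the symmetric \<open>G\<close> yields half the sum with b_i
  b_j.\<close>

lemma energy_algebra:
  assumes h: "\<And>i. i \<in> I \<Longrightarrow> h i = g i + t * (\<Sum>j=1..m. a i j * G i j)"
    and sym: "\<And>i j. G i j = G j i"
  shows "2 * t * (\<Sum>i=1..m. b i * g i) + t\<^sup>2 * (\<Sum>i=1..m. \<Sum>j=1..m. b i * b j * G i j) = 2 * t * (\<Sum>i=1..m. b i * h i)"
proof -
  let ?X = "\<Sum>i=1..m. \<Sum>j=1..m. b i * a i j * G i j"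
  have "(\<Sum>i=1..m. b i * h i) = (\<Sum>i=1..m. b i * g i + t * (\<Sum>j=1..m. b i * a i j * G i j))"
    by (intro sum.cong refl) (simp add: h sum_distrib_left algebra_simps)
  then have 1: "(\<Sum>i=1..m. b i * h i) = (\<Sum>i=1..m. b i * g i) + t * ?X"
    by (simp only: sum.distrib sum_distrib_left)
  have "?X = (\<Sum>j=1..m. \<Sum>i=1..m. b i * a i j * G i j)" by (rule sum.swap)
  also have "\<dots> = (\<Sum>i=1..m. \<Sum>j=1..m. b j * a j i * G i j)" using sym by simp
  finally have "2 * ?X = ?X + (\<Sum>i=1..m. \<Sum>j=1..m. b j * a j i * G i j)" by simp
  also have "\<dots> = (\<Sum>i=1..m. \<Sum>j=1..m. (b i * a i j + b j * a j i) * G i j)"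
    by (simp only: sum.distrib distrib_right)
  also have "\<dots> = (\<Sum>i=1..m. \<Sum>j=1..m. b i * b j * G i j)"
    by (intro sum.cong refl) (simp add: symplectic)
  finally have "t\<^sup>2 * (\<Sum>i=1..m. \<Sum>j=1..m. b i * b j * G i j) = 2 * t * (t * ?X)" by (simp add: power2_eq_square)
  then show ?thesis unfolding 1 by (simp only: distrib_left)
qed

end

section \<open>The L2 inner product on a linear space of functions\<close>

lemma L2_product_integrable:
  fixes f g :: "real^'d \<Rightarrow> 'b::euclidean_space"
  assumes f: "f \<in> L2 \<Omega>" and g: "g \<in> L2 \<Omega>"
  shows "set_integrable lebesgue \<Omega> (\<lambda>x. f x \<bullet> g x)"
proof (rule set_integrable_bound)
  show "set_integrable lebesgue \<Omega> (\<lambda>x. (norm (f x))\<^sup>2 + (norm (g x))\<^sup>2)"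
    using f g unfolding L2_def by (intro set_integral_add) auto
  have "set_borel_measurable lebesgue \<Omega> f" "set_borel_measurable lebesgue \<Omega> g" using f g unfolding L2_def by blast+
  then have "(\<lambda>x. (indicator \<Omega> x *\<^sub>R f x) \<bullet> (indicator \<Omega> x *\<^sub>R g x)) \<in> borel_measurable lebesgue"
    unfolding set_borel_measurable_def by (rule borel_measurable_inner)
  moreover have "(\<lambda>x. (indicator \<Omega> x *\<^sub>R f x) \<bullet> (indicator \<Omega> x *\<^sub>R g x)) = (\<lambda>x. indicator \<Omega> x *\<^sub>R (f x \<bullet> g x))"
    by (rule ext) (simp add: indicator_def)
  ultimately show "set_borel_measurable lebesgue \<Omega> (\<lambda>x. f x \<bullet> g x)" unfolding set_borel_measurable_def by simp
  have "norm (f x \<bullet> g x) \<le> norm ((norm (f x))\<^sup>2 + (norm (g x))\<^sup>2)" for x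
  proof -
    have "\<bar>f x \<bullet> g x\<bar> \<le> norm (f x) * norm (g x)" by (rule Cauchy_Schwarz_ineq2)
    also have "\<dots> \<le> (norm (f x))\<^sup>2 + (norm (g x))\<^sup>2"
    proof -
      have "0 \<le> norm (f x) * norm (g x)" by simp
      then show ?thesis using sum_squares_bound[of "norm (f x)" "norm (g x)"] by linarith
    qed
    finally show ?thesis by simp
  qed
  then show "AE x in lebesgue. x \<in> \<Omega> \<longrightarrow> norm (f x \<bullet> g x) \<le> norm ((norm (f x))\<^sup>2 + (norm (g x))\<^sup>2)" by simp
qed

lemma L2_inner_commute: "L2_inner \<Omega> f g = L2_inner \<Omega> g f"
  unfolding L2_inner_def by (simp only: inner_commute)

lemma L2_inner_diff_left:
  assumes "f \<in> L2 \<Omega>" "g \<in> L2 \<Omega>" "v \<in> L2 \<Omega>"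
  shows "L2_inner \<Omega> (\<lambda>x. f x - g x) v = L2_inner \<Omega> f v - L2_inner \<Omega> g v"
  unfolding L2_inner_def inner_diff_left
  by (rule set_integral_diff(2)[OF L2_product_integrable L2_product_integrable]) (rule assms)+

lemma L2_inner_sum_left:
  assumes "finite J" "\<And>j. j \<in> J \<Longrightarrow> f j \<in> L2 \<Omega>" "v \<in> L2 \<Omega>"
  shows "L2_inner \<Omega> (\<lambda>x. \<Sum>j\<in>J. c j *\<^sub>R f j x) v = (\<Sum>j\<in>J. c j * L2_inner \<Omega> (f j) v)"
  using assms(1,2)
proof (induction J rule: finite_induct)
  case empty
  show ?case unfolding L2_inner_def by (simp add: set_lebesgue_integral_def)
next
  case (insert i J)
  have int: "set_integrable lebesgue \<Omega> (\<lambda>x. c j * (f j x \<bullet> v x))" if "j \<in> insert i J" for j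
    using L2_product_integrable[OF insert.prems[OF that] assms(3)] by simp
  have "set_integrable lebesgue \<Omega> (\<lambda>x. \<Sum>j\<in>J. c j * (f j x \<bullet> v x))"
    unfolding set_integrable_def scaleR_sum_right
    by (intro Bochner_Integration.integrable_sum) (use int in \<open>auto simp: set_integrable_def\<close>)
  then have "(LINT x:\<Omega>|lebesgue. c i * (f i x \<bullet> v x) + (\<Sum>j\<in>J. c j * (f j x \<bullet> v x)))
      = (LINT x:\<Omega>|lebesgue. c i * (f i x \<bullet> v x)) + (LINT x:\<Omega>|lebesgue. \<Sum>j\<in>J. c j * (f j x \<bullet> v x))"
    by (intro set_integral_add(2) int) auto
  then show ?case
    using insert unfolding L2_inner_def by (simp add: inner_add_left inner_sum_left)
qed

lemma L2_inner_young:
  fixes f g :: "real^'d \<Rightarrow> 'b::euclidean_space"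
  assumes f: "f \<in> L2 \<Omega>" and g: "g \<in> L2 \<Omega>" and e: "0 < e"
  shows "L2_inner \<Omega> f g \<le> 1 / (4 * e) * (L2_norm \<Omega> f)\<^sup>2 + e * (L2_norm \<Omega> g)\<^sup>2"
proof -
  have i: "set_integrable lebesgue \<Omega> (\<lambda>x. 1 / (4 * e) * (f x \<bullet> f x))" "set_integrable lebesgue \<Omega> (\<lambda>x. e * (g x \<bullet> g x))"
    using L2_product_integrable[OF f f] L2_product_integrable[OF g g] by simp_all
  have "L2_inner \<Omega> f g \<le> (LINT x:\<Omega>|lebesgue. 1 / (4 * e) * (f x \<bullet> f x) + e * (g x \<bullet> g x))"
    unfolding L2_inner_def
  proof (rule set_integral_mono[OF L2_product_integrable[OF f g] set_integral_add(1)[OF i]])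
    fix x
    let ?s = "2 * e"
    have "0 \<le> (f x - ?s *\<^sub>R g x) \<bullet> (f x - ?s *\<^sub>R g x)" by simp
    also have "\<dots> = f x \<bullet> f x - 2 * ?s * (f x \<bullet> g x) + ?s\<^sup>2 * (g x \<bullet> g x)"
      by (simp add: inner_diff_left inner_diff_right inner_commute[of "g x" "f x"] power2_eq_square algebra_simps)
    finally have "4 * e * (f x \<bullet> g x) \<le> f x \<bullet> f x + 4 * e * (e * (g x \<bullet> g x))" by (simp add: power2_eq_square)
    then show "f x \<bullet> g x \<le> 1 / (4 * e) * (f x \<bullet> f x) + e * (g x \<bullet> g x)" using e by (simp add: field_simps)
  qed
  also have "\<dots> = 1 / (4 * e) * (L2_norm \<Omega> f)\<^sup>2 + e * (L2_norm \<Omega> g)\<^sup>2"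
    unfolding set_integral_add(2)[OF i] L2_norm_square L2_inner_def by simp
  finally show ?thesis .
qed

lemma lin_subspace_add: "lin_subspace V \<Longrightarrow> f \<in> V \<Longrightarrow> g \<in> V \<Longrightarrow> (\<lambda>x. f x + g x) \<in> V"
  unfolding lin_subspace_def by blast

lemma lin_subspace_scale: "lin_subspace V \<Longrightarrow> f \<in> V \<Longrightarrow> (\<lambda>x. c *\<^sub>R f x) \<in> V"
  unfolding lin_subspace_def by blast

lemma lin_subspace_sum:
  assumes V: "lin_subspace V" and J: "finite J" "\<And>j. j \<in> J \<Longrightarrow> f j \<in> V"
  shows "(\<lambda>x. \<Sum>j\<in>J. c j *\<^sub>R f j x) \<in> V"
  using J
proof (induction J rule: finite_induct)
  case empty then show ?case using V unfolding lin_subspace_def by simp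
next
  case (insert i J)
  have "(\<lambda>x. c i *\<^sub>R f i x + (\<Sum>j\<in>J. c j *\<^sub>R f j x)) \<in> V"
    by (intro lin_subspace_add[OF V] lin_subspace_scale[OF V] insert.IH insert.prems) auto
  then show ?case using insert.hyps by simp
qed

lemma lin_subspace_diff:
  assumes V: "lin_subspace V" and "f \<in> V" "g \<in> V"
  shows "(\<lambda>x. f x - g x) \<in> V"
  using lin_subspace_add[OF V assms(2) lin_subspace_scale[OF V assms(3), of "- 1"]] by simp

text \<open>Since the coefficient matrix is invertible, the stage equations represent every slope as the
  inner product with an element of the space.\<close>

lemma (in gauss) energy_identity:
  fixes u u' :: "real^'d \<Rightarrow> 'b::euclidean_space" and U :: "nat \<Rightarrow> real^'d \<Rightarrow> 'b"
  assumes V: "lin_subspace V" "V \<subseteq> L2 \<Omega>" and u: "u \<in> V" and u': "u' \<in> V" and U: "\<And>i. i \<in> I \<Longrightarrow> U i \<in> V"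
    and t: "t \<noteq> 0"
    and stage: "\<And>i v. i \<in> I \<Longrightarrow> v \<in> V \<Longrightarrow> L2_inner \<Omega> (U i) v = L2_inner \<Omega> u v + t * (\<Sum>j=1..m. a i j * s j v)"
    and update: "\<And>v. v \<in> V \<Longrightarrow> L2_inner \<Omega> u' v = L2_inner \<Omega> u v + t * (\<Sum>i=1..m. b i * s i v)"
  shows "(L2_norm \<Omega> u')\<^sup>2 = (L2_norm \<Omega> u)\<^sup>2 + 2 * t * (\<Sum>i=1..m. b i * s i (U i))"
proof -
  obtain e where e: "\<forall>i\<in>I. \<forall>j\<in>I. (\<Sum>k=1..m. e i k * a k j) = (if i = j then 1 else 0)"
    by (rule coefficient_inverse)
  \<comment> \<open>Solves U_l - u = t (sum over i of a_li k_i). Nothing is assumed of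
    \<open>s\<close> beyond the two equations; its linearity on \<open>V\<close> comes out through
    \<open>ks\<close>.\<close>
  define k where "k j = (\<lambda>x. \<Sum>l=1..m. (e j l / t) *\<^sub>R (U l x - u x))" for j
  have W: "(\<lambda>x. U l x - u x) \<in> V" if "l \<in> I" for l by (rule lin_subspace_diff[OF V(1) U[OF that] u])
  have kV: "k j \<in> V" for j unfolding k_def by (rule lin_subspace_sum[OF V(1) _ W]) auto
  have ks: "L2_inner \<Omega> (k j) v = s j v" if j: "j \<in> I" and v: "v \<in> V" for j v
  proof -
    have vL: "v \<in> L2 \<Omega>" and uL: "u \<in> L2 \<Omega>" using v u V(2) by blast+
    have "L2_inner \<Omega> (k j) v = (\<Sum>l=1..m. e j l / t * L2_inner \<Omega> (\<lambda>x. U l x - u x) v)"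
      unfolding k_def using W V(2) by (intro L2_inner_sum_left vL) auto
    also have "\<dots> = (\<Sum>l=1..m. \<Sum>i=1..m. e j l * a l i * s i v)"
    proof (intro sum.cong refl)
      fix l assume l: "l \<in> I"
      have "L2_inner \<Omega> (\<lambda>x. U l x - u x) v = t * (\<Sum>i=1..m. a l i * s i v)"
        using L2_inner_diff_left[OF _ uL vL, of "U l"] U[OF l] V(2) stage[OF l v] by auto
      then show "e j l / t * L2_inner \<Omega> (\<lambda>x. U l x - u x) v = (\<Sum>i=1..m. e j l * a l i * s i v)"
        using t by (simp add: sum_distrib_left mult.assoc)
    qed
    also have "\<dots> = (\<Sum>i=1..m. \<Sum>l=1..m. e j l * a l i * s i v)" by (rule sum.swap)
    also have "\<dots> = (\<Sum>i=1..m. (\<Sum>l=1..m. e j l * a l i) * s i v)" by (simp only: sum_distrib_right)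
    also have "\<dots> = (\<Sum>i=1..m. if i = j then s i v else 0)"
      using e j by (intro sum.cong refl) simp
    also have "\<dots> = s j v" using j by simp
    finally show ?thesis .
  qed
  define G' where "G' i j = L2_inner \<Omega> (k i) (k j)" for i j
  have sym: "G' i j = G' j i" for i j unfolding G'_def by (rule L2_inner_commute)
  \<comment> \<open>The i-th stage equation tested with \<open>k i\<close>.\<close>
  have h: "s i (U i) = s i u + t * (\<Sum>j=1..m. a i j * G' i j)" if i: "i \<in> I" for i
  proof -
    have "s i (U i) = L2_inner \<Omega> (U i) (k i)" using ks[OF i U[OF i]] L2_inner_commute[of \<Omega> "k i" "U i"] by simp
    also have "\<dots> = L2_inner \<Omega> u (k i) + t * (\<Sum>j=1..m. a i j * s j (k i))" by (rule stage[OF i kV])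
    also have "L2_inner \<Omega> u (k i) = s i u" using ks[OF i u] L2_inner_commute[of \<Omega> u "k i"] by simp
    also have "(\<Sum>j=1..m. a i j * s j (k i)) = (\<Sum>j=1..m. a i j * G' i j)"
      using sym by (intro sum.cong refl) (simp add: G'_def ks[OF _ kV])
    finally show ?thesis .
  qed
  \<comment> \<open>The update is tested with \<open>u'\<close> and with \<open>u\<close>; tested
    with \<open>k i\<close> below, it rewrites the slopes at \<open>u'\<close>.\<close>
  have "L2_inner \<Omega> u' u' = L2_inner \<Omega> u u' + t * (\<Sum>i=1..m. b i * s i u')" by (rule update[OF u'])
  moreover have "L2_inner \<Omega> u u' = L2_inner \<Omega> u u + t * (\<Sum>i=1..m. b i * s i u)"
    using update[OF u] L2_inner_commute[of \<Omega> u u'] by simp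
  moreover have "s i u' = s i u + t * (\<Sum>j=1..m. b j * G' i j)" if i: "i \<in> I" for i
  proof -
    have "s i u' = L2_inner \<Omega> u' (k i)" using ks[OF i u'] L2_inner_commute[of \<Omega> "k i" u'] by simp
    also have "\<dots> = L2_inner \<Omega> u (k i) + t * (\<Sum>j=1..m. b j * s j (k i))" by (rule update[OF kV])
    also have "L2_inner \<Omega> u (k i) = s i u" using ks[OF i u] L2_inner_commute[of \<Omega> u "k i"] by simp
    also have "(\<Sum>j=1..m. b j * s j (k i)) = (\<Sum>j=1..m. b j * G' i j)"
      using sym by (intro sum.cong refl) (simp add: G'_def ks[OF _ kV])
    finally show ?thesis .
  qed
  then have "(\<Sum>i=1..m. b i * s i u') = (\<Sum>i=1..m. b i * s i u + t * (\<Sum>j=1..m. b i * b j * G' i j))"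
    by (intro sum.cong refl) (simp add: sum_distrib_left algebra_simps)
  then have "(\<Sum>i=1..m. b i * s i u') = (\<Sum>i=1..m. b i * s i u) + t * (\<Sum>i=1..m. \<Sum>j=1..m. b i * b j * G' i j)"
    by (simp only: sum.distrib sum_distrib_left)
  ultimately have "L2_inner \<Omega> u' u' = L2_inner \<Omega> u u
      + (2 * t * (\<Sum>i=1..m. b i * s i u) + t\<^sup>2 * (\<Sum>i=1..m. \<Sum>j=1..m. b i * b j * G' i j))"
    by (simp add: power2_eq_square distrib_left)
  also have "\<dots> = L2_inner \<Omega> u u + 2 * t * (\<Sum>i=1..m. b i * s i (U i))"
    using energy_algebra[where h = "\<lambda>i. s i (U i)" and g = "\<lambda>i. s i u" and G = G' and t = t, OF h sym] by simp
  finally show ?thesis unfolding L2_norm_square .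
qed

section \<open>Stability of the fully discrete scheme\<close>

lemma stage_dissipation:
  fixes w g :: "real^'d \<Rightarrow> real^'d"
  assumes conv: "0 \<le> c_h \<Omega> \<T> Kp \<zeta> w w w" and diff: "C\<^sub>0 * X\<^sup>2 \<le> a_h \<Omega> \<T> Kp \<eta> \<tau> w w"
    and pen: "0 \<le> d w w" and div: "b_h \<Omega> \<T> Kp w P = 0"
    and poin: "(L2_norm \<Omega> w)\<^sup>2 \<le> D * X\<^sup>2"
    and pos: "0 < C\<^sub>0" "0 < \<nu>" "0 < D" and L2: "w \<in> L2 \<Omega>" "g \<in> L2 \<Omega>"
  shows "rk_slope \<Omega> \<T> Kp \<eta> \<zeta> \<tau> \<nu> d g w P w \<le> D / (4 * \<nu> * C\<^sub>0) * (L2_norm \<Omega> g)\<^sup>2"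
proof -
  \<comment> \<open>The weight in Young's inequality for which the Poincare bound and coercivity let
    the viscous form absorb the velocity term completely.\<close>
  define e where "e = \<nu> * C\<^sub>0 / D"
  have e: "0 < e" unfolding e_def using pos by simp
  have "e * (L2_norm \<Omega> w)\<^sup>2 \<le> e * (D * X\<^sup>2)" by (rule mult_left_mono[OF poin less_imp_le[OF e]])
  also have "\<dots> = \<nu> * (C\<^sub>0 * X\<^sup>2)" unfolding e_def using pos by simp
  also have "\<dots> \<le> \<nu> * a_h \<Omega> \<T> Kp \<eta> \<tau> w w" using diff less_imp_le[OF pos(2)] by (rule mult_left_mono)
  finally have "L2_inner \<Omega> g w \<le> 1 / (4 * e) * (L2_norm \<Omega> g)\<^sup>2 + \<nu> * a_h \<Omega> \<T> Kp \<eta> \<tau> w w"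
    using L2_inner_young[OF L2(2) L2(1) e] by linarith
  moreover have "1 / (4 * e) = D / (4 * \<nu> * C\<^sub>0)" unfolding e_def by simp
  ultimately show ?thesis unfolding rk_slope_def N_h_def using conv pen div by simp
qed

theorem theorem2:
  fixes \<Omega> :: "(real^'d) set"
    and \<nu> T \<eta>\<^sub>0 :: real
    and r k m :: nat
    and a :: "nat \<Rightarrow> nat \<Rightarrow> real" and b c :: "nat \<Rightarrow> real"
    and \<tau> :: "(real^'d \<Rightarrow> real^'d) \<Rightarrow> real^'d \<Rightarrow> real^'d^'d"
    and \<T> :: "'h \<Rightarrow> (real^'d) set set"
    and Kp :: "'h \<Rightarrow> (real^'d) set \<Rightarrow> (real^'d) set"
    and \<eta> \<zeta> :: "'h \<Rightarrow> (real^'d) set \<Rightarrow> real"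
    and V :: "'h \<Rightarrow> (real^'d \<Rightarrow> real^'d) set"
    and Q :: "'h \<Rightarrow> (real^'d \<Rightarrow> real) set"
  assumes dimension: "CARD('d) \<in> {2, 3}"
    and domain: "bounded \<Omega>" "lipschitz_domain \<Omega>"
    and data: "0 < \<nu>" "0 < T"
    and collocation: "1 \<le> m" "gauss_legendre m a b c"
    and mesh: "\<And>h. simplicial_mesh \<Omega> (\<T> h)" "shape_regular_family \<T>"
    and orientation: "\<And>h. face_orientation (\<T> h) (Kp h)"
    and velocity_space: "\<And>h. lin_subspace (V h)" "\<And>h. V h \<subseteq> broken_vector_polys \<Omega> (\<T> h) r"
    and pressure_space: "\<And>h. lin_subspace (Q h)" "\<And>h. Q h \<subseteq> broken_mean_zero_polys \<Omega> (\<T> h) k"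
    and eta_nonneg: "\<And>h F. F \<in> mesh_faces (\<T> h) \<Longrightarrow> 0 \<le> \<eta> h F"
    and zeta_nonneg: "\<And>h F. F \<in> mesh_faces (\<T> h) \<Longrightarrow> 0 \<le> \<zeta> h F"
    and eta0: "sufficiently_large_penalty \<Omega> \<T> Kp \<tau> V \<eta>\<^sub>0"
    and eta: "\<And>h F. F \<in> mesh_faces (\<T> h) \<Longrightarrow> \<eta>\<^sub>0 \<le> \<eta> h F"
    and zeta: "\<And>h F. F \<in> boundary_faces \<Omega> (\<T> h) \<Longrightarrow> 1/2 \<le> \<zeta> h F"
    and stress: "\<tau> = gradient \<or> \<tau> = sym_stress \<or>
      (\<tau> = dev_stress \<and>
        (\<exists>C'>0. \<forall>h. \<forall>v\<in>V h. L2_norm \<Omega> v \<le> C' * norm_1h \<Omega> (\<T> h) (Kp h) (\<eta> h) \<tau> v))"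
  shows "\<exists>C>0. \<forall>h f u\<^sub>0 d N t u U P.
     (AE s in lebesgue. s \<in> {0..T} \<longrightarrow> f s \<in> L2 \<Omega>) \<longrightarrow>
     (\<forall>s\<in>{0..T}. set_integrable lebesgue {0..s} (\<lambda>s'. L2_norm \<Omega> (f s'))) \<longrightarrow>
     (\<forall>v\<in>V h. linear_form_on (V h) (d v)) \<longrightarrow>
     (\<forall>v\<in>V h. 0 \<le> d v v) \<longrightarrow>
     (\<forall>u\<^sub>e p\<^sub>e. navier_stokes_solution \<Omega> \<nu> T \<tau> f u\<^sub>0 u\<^sub>e p\<^sub>e \<longrightarrow>
        (\<forall>s\<in>{0<..T}. \<forall>v\<in>V h. d (u\<^sub>e s) v = 0)) \<longrightarrow>
     t 0 = 0 \<longrightarrow> t N = T \<longrightarrow> (\<forall>n<N. t n < t (Suc n)) \<longrightarrow>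
     (\<forall>n<N. \<forall>i\<in>{1..m}. f (t n + c i * (t (Suc n) - t n)) \<in> L2 \<Omega>) \<longrightarrow>
     fully_discrete_solution \<Omega> (\<T> h) (Kp h) (\<eta> h) (\<zeta> h) \<tau> \<nu> d (V h) (Q h) m a b c f N t u U P
     \<longrightarrow>
     (\<forall>n\<in>{1..N}. (L2_norm \<Omega> (u n))\<^sup>2 \<le> (L2_norm \<Omega> (u 0))\<^sup>2 +
        C * (\<Sum>j<n. (t (Suc j) - t j) *
          (\<Sum>i=1..m. b i * (L2_norm \<Omega> (f (t j + c i * (t (Suc j) - t j))))\<^sup>2)))"
proof -
  have dim2: "CARD('d) \<ge> 2" using dimension by auto
  interpret gauss m a b c by unfold_locales (rule collocation)+
  have m: "mesh \<Omega> (\<T> h) (Kp h)" for h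
    by unfold_locales (rule mesh domain orientation dim2)+
  have bf: "broken_field \<Omega> (\<T> h) (Kp h) r v" if "v \<in> V h" for h v
    using m[of h] velocity_space(2)[of h] that by (auto simp: broken_field_def broken_field_axioms_def)
  obtain C\<^sub>0 where C0: "0 < C\<^sub>0" and coercive: "\<forall>h \<eta>. (\<forall>F\<in>mesh_faces (\<T> h). \<eta>\<^sub>0 \<le> \<eta> F) \<longrightarrow>
        (\<forall>v\<in>V h. C\<^sub>0 * (norm_1h \<Omega> (\<T> h) (Kp h) \<eta> \<tau> v)\<^sup>2 \<le> a_h \<Omega> (\<T> h) (Kp h) \<eta> \<tau> v v)"
    and \<eta>0: "0 < \<eta>\<^sub>0" using eta0 unfolding sufficiently_large_penalty_def by blast
  \<comment> \<open>One Poincare constant for the whole family: from \<open>poincare\<close> in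
    cases (a) and (b), and the square of C' in case (c).\<close>
  have "\<exists>D>0. \<forall>h. \<forall>v\<in>V h. (L2_norm \<Omega> v)\<^sup>2 \<le> D * (norm_1h \<Omega> (\<T> h) (Kp h) (\<eta> h) \<tau> v)\<^sup>2"
  proof (cases "\<tau> = gradient \<or> \<tau> = sym_stress")
    case True
    obtain \<sigma> where \<sigma>: "0 < \<sigma>" "\<forall>h. \<forall>K\<in>\<T> h. diameter K \<le> \<sigma> * inball_diameter K"
      using mesh(2) unfolding shape_regular_family_def by blast
    obtain R where R: "0 < R" "\<forall>x\<in>closure \<Omega>. norm x \<le> R"
      using bounded_closure[OF domain(1)] unfolding bounded_pos by blast
    let ?D = "8 * R\<^sup>2 + 2 * R * (2 * R * (real (Suc CARD('d)) * \<sigma> * trace_constant r CARD('d))) / \<eta>\<^sub>0"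
    show ?thesis
    proof (intro exI[of _ ?D] conjI allI ballI)
      show "0 < ?D" using R(1) \<sigma>(1) \<eta>0 trace_constant_pos[of r "CARD('d)"]
        by (intro add_pos_nonneg divide_nonneg_pos mult_nonneg_nonneg) auto
      fix h v assume v: "v \<in> V h"
      interpret broken_field \<Omega> "\<T> h" "Kp h" r v by (rule bf[OF v])
      show "(L2_norm \<Omega> v)\<^sup>2 \<le> ?D * (norm_1h \<Omega> (\<T> h) (Kp h) (\<eta> h) \<tau> v)\<^sup>2"
      proof (rule poincare[OF R(1) _ \<sigma>(1) _ \<eta>0 eta True])
        show "\<bar>x $ i\<bar> \<le> R" if "x \<in> closure \<Omega>" for x i
          using R(2) that component_le_norm_cart[of x i] by force
        show "diameter K \<le> \<sigma> * inball_diameter K" if "K \<in> \<T> h" for K using \<sigma>(2) that by blast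
      qed
    qed
  next
    case False
    then obtain C' where C': "0 < C'" "\<forall>h. \<forall>v\<in>V h. L2_norm \<Omega> v \<le> C' * norm_1h \<Omega> (\<T> h) (Kp h) (\<eta> h) \<tau> v"
      using stress by blast
    have "0 \<le> L2_norm \<Omega> v" for v :: "real^'d \<Rightarrow> real^'d"
      unfolding L2_norm_def using L2_inner_self_nonneg by (rule real_sqrt_ge_zero)
    then have "(L2_norm \<Omega> v)\<^sup>2 \<le> C'\<^sup>2 * (norm_1h \<Omega> (\<T> h) (Kp h) (\<eta> h) \<tau> v)\<^sup>2" if "v \<in> V h" for h v
      unfolding power_mult_distrib[symmetric] using C'(2) that by (intro power_mono) auto
    then show ?thesis using C'(1) by (intro exI[of _ "C'\<^sup>2"]) auto
  qed
  then obtain D where D: "0 < D"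
    and poin: "\<forall>h. \<forall>v\<in>V h. (L2_norm \<Omega> v)\<^sup>2 \<le> D * (norm_1h \<Omega> (\<T> h) (Kp h) (\<eta> h) \<tau> v)\<^sup>2" by blast
  \<comment> \<open>Twice the constant of \<open>stage_dissipation\<close>, the two coming from the
    energy identity. It is fixed before the mesh, the time grid and the data are introduced.\<close>
  define C where "C = D / (2 * \<nu> * C\<^sub>0)"
  have C: "0 < C" unfolding C_def using D data(1) C0 by simp
  show ?thesis
  proof (rule exI[of _ C], intro conjI C allI impI)
    fix h :: 'h and f :: "real \<Rightarrow> real^'d \<Rightarrow> real^'d" and u\<^sub>0 :: "real^'d \<Rightarrow> real^'d"
      and d :: "(real^'d \<Rightarrow> real^'d) \<Rightarrow> (real^'d \<Rightarrow> real^'d) \<Rightarrow> real"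
      and N :: nat and t :: "nat \<Rightarrow> real" and u U P
    assume pen: "\<forall>v\<in>V h. 0 \<le> d v v" and tmono: "\<forall>n<N. t n < t (Suc n)"
      and fL2: "\<forall>n<N. \<forall>i\<in>I. f (t n + c i * (t (Suc n) - t n)) \<in> L2 \<Omega>"
      and sol: "fully_discrete_solution \<Omega> (\<T> h) (Kp h) (\<eta> h) (\<zeta> h) \<tau> \<nu> d (V h) (Q h) m a b c f N t u U P"
    let ?f = "\<lambda>n i. f (t n + c i * (t (Suc n) - t n))"
    let ?s = "\<lambda>n i. rk_slope \<Omega> (\<T> h) (Kp h) (\<eta> h) (\<zeta> h) \<tau> \<nu> d (?f n i) (U n i) (P n i)"
    have VL2: "V h \<subseteq> L2 \<Omega>" using velocity_space(2)[of h] unfolding broken_vector_polys_def by blast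
    have uV: "u n \<in> V h" if "n \<le> N" for n using sol that unfolding fully_discrete_solution_def by blast
    have step: "(L2_norm \<Omega> (u (Suc n)))\<^sup>2 \<le> (L2_norm \<Omega> (u n))\<^sup>2
        + C * ((t (Suc n) - t n) * (\<Sum>i=1..m. b i * (L2_norm \<Omega> (?f n i))\<^sup>2))" if n: "n < N" for n
    proof -
      let ?t = "t (Suc n) - t n"
      have t: "0 < ?t" using tmono n by simp
      have S: "(\<forall>i\<in>I. U n i \<in> V h \<and> P n i \<in> Q h \<and>
             (\<forall>v\<in>V h. L2_inner \<Omega> (U n i) v = L2_inner \<Omega> (u n) v + ?t * (\<Sum>j=1..m. a i j * ?s n j v)) \<and>
             (\<forall>q\<in>Q h. b_h \<Omega> (\<T> h) (Kp h) (U n i) q = 0)) \<and>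
          (\<forall>v\<in>V h. L2_inner \<Omega> (u (Suc n)) v = L2_inner \<Omega> (u n) v + ?t * (\<Sum>i=1..m. b i * ?s n i v))"
        using sol n unfolding fully_discrete_solution_def Let_def by blast
      have Un: "U n i \<in> V h" "P n i \<in> Q h" if "i \<in> I" for i using S that by blast+
      have "(L2_norm \<Omega> (u (Suc n)))\<^sup>2 = (L2_norm \<Omega> (u n))\<^sup>2 + 2 * ?t * (\<Sum>i=1..m. b i * ?s n i (U n i))"
      proof (rule energy_identity[where U = "U n" and s = "?s n" and t = ?t and u = "u n" and u' = "u (Suc n)",
            OF velocity_space(1)[of h] VL2])
        show "u n \<in> V h" "u (Suc n) \<in> V h" using uV n by simp_all
        show "?t \<noteq> 0" using t by simp
        show "U n i \<in> V h" if "i \<in> I" for i by (rule Un(1)[OF that])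
        show "L2_inner \<Omega> (U n i) v = L2_inner \<Omega> (u n) v + ?t * (\<Sum>j=1..m. a i j * ?s n j v)" if "i \<in> I" "v \<in> V h" for i v
          using S that by blast
        show "L2_inner \<Omega> (u (Suc n)) v = L2_inner \<Omega> (u n) v + ?t * (\<Sum>i=1..m. b i * ?s n i v)" if "v \<in> V h" for v
          using S that by blast
      qed
      also have "\<dots> \<le> (L2_norm \<Omega> (u n))\<^sup>2 + 2 * ?t * (\<Sum>i=1..m. b i * (D / (4 * \<nu> * C\<^sub>0) * (L2_norm \<Omega> (?f n i))\<^sup>2))"
      proof (intro add_left_mono mult_left_mono sum_mono)
        fix i assume i: "i \<in> I"
        \<comment> \<open>Positive weights allow the stage bounds to be summed without loss of
          sign.\<close>
        show "0 \<le> b i" using b_pos[OF i] by simp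
        interpret broken_field \<Omega> "\<T> h" "Kp h" r "U n i" by (rule bf[OF Un(1)[OF i]])
        show "?s n i (U n i) \<le> D / (4 * \<nu> * C\<^sub>0) * (L2_norm \<Omega> (?f n i))\<^sup>2"
        proof (rule stage_dissipation)
          show "0 \<le> c_h \<Omega> (\<T> h) (Kp h) (\<zeta> h) (U n i) (U n i) (U n i)"
            by (rule convection_nonneg[OF zeta_nonneg zeta])
          show "C\<^sub>0 * (norm_1h \<Omega> (\<T> h) (Kp h) (\<eta> h) \<tau> (U n i))\<^sup>2 \<le> a_h \<Omega> (\<T> h) (Kp h) (\<eta> h) \<tau> (U n i) (U n i)"
            using coercive eta Un(1)[OF i] by blast
          show "0 \<le> d (U n i) (U n i)" using pen Un(1)[OF i] by blast
          show "b_h \<Omega> (\<T> h) (Kp h) (U n i) (P n i) = 0" using S i Un(2)[OF i] by blast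
          show "(L2_norm \<Omega> (U n i))\<^sup>2 \<le> D * (norm_1h \<Omega> (\<T> h) (Kp h) (\<eta> h) \<tau> (U n i))\<^sup>2"
            using poin Un(1)[OF i] by blast
          show "U n i \<in> L2 \<Omega>" using Un(1)[OF i] VL2 by blast
          show "?f n i \<in> L2 \<Omega>" using fL2 n i by blast
        qed (rule C0 data(1) D)+
      qed (use t in simp)
      also have "2 * ?t * (\<Sum>i=1..m. b i * (D / (4 * \<nu> * C\<^sub>0) * (L2_norm \<Omega> (?f n i))\<^sup>2))
          = C * (?t * (\<Sum>i=1..m. b i * (L2_norm \<Omega> (?f n i))\<^sup>2))"
      proof -
        have "C = 2 * (D / (4 * \<nu> * C\<^sub>0))" unfolding C_def by simp
        then show ?thesis by (simp only: sum_distrib_left mult_ac)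
      qed
      finally show ?thesis .
    qed
    have "(L2_norm \<Omega> (u n))\<^sup>2 \<le> (L2_norm \<Omega> (u 0))\<^sup>2
        + C * (\<Sum>j<n. (t (Suc j) - t j) * (\<Sum>i=1..m. b i * (L2_norm \<Omega> (?f j i))\<^sup>2))" if "n \<le> N" for n
      using that
    proof (induction n)
      case (Suc n)
      then show ?case using step[of n] by (simp add: distrib_left)
    qed simp
    then show "\<forall>n\<in>{1..N}. (L2_norm \<Omega> (u n))\<^sup>2 \<le> (L2_norm \<Omega> (u 0))\<^sup>2
        + C * (\<Sum>j<n. (t (Suc j) - t j) * (\<Sum>i=1..m. b i * (L2_norm \<Omega> (?f j i))\<^sup>2))" by simp
  qed
qed

end
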